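(* Let $X$ be a nonempty completely metrizable space with no isolated points, and let $\kappa = w_\downarrow(X)$. Then $$\mathrm{non}(\mathcal M_X) = \mathrm{non}(\mathcal M) \cdot \mathrm{cf}[\kappa]^\omega.$$
   Context: For a topological space $X$, $\mathcal M_X$ is the collection of all meager subsets of $X$ (countable unions of nowhere dense sets), and $\mathcal M = \mathcal M_{\mathbb R}$. For an ideal $\mathcal I$ of subsets of a set $X$, $\mathrm{non}(\mathcal I) = \min\{|Y| : Y \subseteq X \text{ and } Y \notin \mathcal I\}$. The weight $w(X)$ of a space is the minimum cardinality of a basis, and $w_\downarrow(X) = \min\{\kappa : \text{some nonempty open } U \subseteq X \text{ has weight } \kappa\}$. For an infinite cardinal $\kappa$, $[\kappa]^\omega$ is the set of all countably infinite subsets of $\kappa$; a family $\mathcal F \subseteq [\kappa]^\omega$ is cofinal if for every $A \in [\kappa]^\omega$ there is $B \in \mathcal F$ with $B \supseteq A$; and $\mathrm{cf}[\kappa]^\omega$ is the minimum cardinality of a cofinal subset of $[\kappa]^\omega$. The dot denotes cardinal multiplication. *)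

theory Defs
  imports "HOL-Analysis.Analysis"
begin

unbundle cardinal_syntax
no_notation Set_Algebras.elt_set_eq (infix \<open>=o\<close> 50)

(* Cardinals are cardinal orders ('a rel), compared by =o and <=o across types.
   The choice below is determined only up to =o (least_cardinal_unique), and
   is meaningful only for nonempty sets of cardinals. *)
definition least_cardinal :: "'a rel set \<Rightarrow> 'a rel" where
  "least_cardinal R = (SOME r. r \<in> R \<and> (\<forall>r'\<in>R. r \<le>o r'))"

lemma least_cardinal:
  assumes "R \<noteq> {}" and "\<forall>r\<in>R. Card_order r"
  shows "least_cardinal R \<in> R" and "\<forall>r\<in>R. least_cardinal R \<le>o r"
proof -
  have "\<exists>r. r \<in> R \<and> (\<forall>r'\<in>R. r \<le>o r')"
    using exists_minim_Card_order[OF assms] by blast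
  from someI_ex[OF this] show "least_cardinal R \<in> R" and "\<forall>r\<in>R. least_cardinal R \<le>o r"
    by (simp_all add: least_cardinal_def)
qed

lemma least_cardinal_unique:
  assumes "\<forall>r\<in>R. Card_order r" and "r \<in> R" and "\<forall>r'\<in>R. r \<le>o r'"
  shows "least_cardinal R =o r"
  using least_cardinal[of R] assms by (metis empty_iff ordIso_iff_ordLeq)

definition nowhere_dense_in :: "'a topology \<Rightarrow> 'a set \<Rightarrow> bool" where
  "nowhere_dense_in X A \<longleftrightarrow> A \<subseteq> topspace X \<and> X interior_of (X closure_of A) = {}"

definition meager_sets :: "'a topology \<Rightarrow> 'a set set" where
  "meager_sets X =
    {A. \<exists>\<N>. countable \<N> \<and> (\<forall>N\<in>\<N>. nowhere_dense_in X N) \<and> A = \<Union>\<N>}"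

definition non_ideal :: "'a set \<Rightarrow> 'a set set \<Rightarrow> 'a rel" where
  "non_ideal S \<I> = least_cardinal (card_of ` {Y. Y \<subseteq> S \<and> Y \<notin> \<I>})"

definition base_of :: "'a topology \<Rightarrow> 'a set set \<Rightarrow> bool" where
  "base_of X \<B> \<longleftrightarrow> openin X = arbitrary union_of (\<lambda>U. U \<in> \<B>)"

definition weight :: "'a topology \<Rightarrow> 'a set rel" where
  "weight X = least_cardinal (card_of ` {\<B>. base_of X \<B>})"

definition local_weight :: "'a topology \<Rightarrow> 'a set rel" where
  "local_weight X =
    least_cardinal {weight (subtopology X U) |U. openin X U \<and> U \<noteq> {}}"

(* The underlying set of a cardinal \<kappa> is Field \<kappa>. *)
definition ctbl_inf_subsets :: "'a rel \<Rightarrow> 'a set set" where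
  "ctbl_inf_subsets \<kappa> = {A. A \<subseteq> Field \<kappa> \<and> countable A \<and> infinite A}"

definition cofinal_family :: "'a rel \<Rightarrow> 'a set set \<Rightarrow> bool" where
  "cofinal_family \<kappa> \<F> \<longleftrightarrow>
    \<F> \<subseteq> ctbl_inf_subsets \<kappa> \<and> (\<forall>A\<in>ctbl_inf_subsets \<kappa>. \<exists>B\<in>\<F>. A \<subseteq> B)"

definition cf_ctbl :: "'a rel \<Rightarrow> 'a set rel" where
  "cf_ctbl \<kappa> = least_cardinal (card_of ` {\<F>. cofinal_family \<kappa> \<F>})"

end

theory Submission
  imports Defs "HOL-Library.Countable_Set_Type"
begin

text \<open>
  For the upper bound, fix an open set with a base \<open>K\<close> of size \<open>\<kappa>\<close>. A point is produced from a countable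
  \<open>A \<subseteq> K\<close> and a binary sequence by a machine that reads the bits and shrinks to members of \<open>A\<close>; given
  countably many nowhere dense sets, a nonmeager set of sequences suffices as soon as \<open>A\<close> is closed under
  suitable functions. So one needs a stationary family of countable subsets of \<open>K\<close> of size
  \<open>cf[\<kappa>]\<^sup>\<omega>\<close>. Its existence is a theorem of Shelah, proved here with a fragment of pcf theory: let \<open>N\<close> be
  the union of an increasing \<open>\<omega>\<^sub>1\<close>-chain of members of the cofinal family, taken sufficiently closed. For
  every countable set of ordinals \<open>n \<in> N\<close>, the function \<open>n \<mapsto> sup (N \<inter> n)\<close> is assembled from finitely
  many members of fixed scales, so there are only \<open>cf[\<kappa>]\<^sup>\<omega>\<close> candidates for it; and the \<open>\<delta>\<close>-th stage of
  the chain can be recovered from \<open>\<delta>\<close>, this function and one countable set covering the stage.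

  For the lower bounds, a tree of disjoint families of open sets, with labels attached to the nodes,
  maps a comeager subset of the space to sequences of labels. Labels in \<open>{0,1}\<close> give a nonmeager set of
  binary sequences, and the machine above turns it into a nonmeager set of reals; labels in \<open>K\<close> give
  a cofinal family, a point being sent to the set of labels along its branch.
\<close>

section \<open>Well-orders and the first uncountable ordinal\<close>

text \<open>A cofinal family alone is not enough: the machine needs sets closed under functions that
  depend on the given nowhere dense sets, and closing off a member depends on these functions too.
  The family must be fixed beforehand, so every closed set is to be recovered from few parameters.
  The length omega1 is chosen for three reasons. Two continuous omega1-sequences with the same
  supremum agree on a club, so a whole sequence of scale positions can be replaced by its supremum.
  The sets containing clubs are closed under countable intersections, so countably many coordinates
  are handled at once. And \<open>N\<close> absorbs a cofinal sequence of each member of cofinality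
  at most omega1, so scales are needed only for larger cofinalities, where the products are
  omega1-directed. Codes are finite because the set where a guess is wrong has a product of smaller
  cofinality, so scale lengths descend. They are few because the functions
  \<open>sup_below p\<close>, for \<open>p\<close> in the cofinal family, dominate all the products
  involved; this bounds every scale length.\<close>

text \<open>Carries a well-order of the given type with a new largest element, so that every set is
  equinumerous to an initial segment.\<close>

datatype 'a wo = Elt 'a | Top

definition some_wo :: "'a rel" where
  "some_wo = (SOME r. well_order_on UNIV r)"

lemma some_wo: "well_order_on UNIV (some_wo :: 'a rel)"
  unfolding some_wo_def by (rule someI_ex) (rule well_order_on)

instantiation wo :: (type) wellorder
begin

definition less_eq_wo :: "'a wo \<Rightarrow> 'a wo \<Rightarrow> bool" where
  "x \<le> y \<longleftrightarrow> (case y of Top \<Rightarrow> True | Elt b \<Rightarrow> (case x of Top \<Rightarrow> False | Elt a \<Rightarrow> (a, b) \<in> some_wo))"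

definition less_wo :: "'a wo \<Rightarrow> 'a wo \<Rightarrow> bool" where
  "less_wo x y \<longleftrightarrow> x \<le> y \<and> \<not> y \<le> x"

instance
proof
  have lin: "linear_order_on UNIV (some_wo :: 'a rel)" and wf: "wf (some_wo - Id :: 'a rel)"
    using some_wo[where 'a='a] by (auto simp: well_order_on_def)
  have refl: "(a, a) \<in> (some_wo :: 'a rel)" for a
    using lin by (auto simp: order_on_defs refl_on_def)
  have trans: "(a, b) \<in> (some_wo :: 'a rel) \<Longrightarrow> (b, c) \<in> some_wo \<Longrightarrow> (a, c) \<in> some_wo" for a b c
    using lin by (auto simp: order_on_defs dest: transD)
  have antisym: "(a, b) \<in> (some_wo :: 'a rel) \<Longrightarrow> (b, a) \<in> some_wo \<Longrightarrow> a = b" for a b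
    using lin by (auto simp: order_on_defs dest: antisymD)
  have total: "(a, b) \<in> (some_wo :: 'a rel) \<or> (b, a) \<in> some_wo" for a b
    using lin refl by (cases "a = b") (auto simp: order_on_defs total_on_def)
  fix x y z :: "'a wo"
  show "x < y \<longleftrightarrow> x \<le> y \<and> \<not> y \<le> x" by (simp add: less_wo_def)
  show "x \<le> x" by (auto simp: less_eq_wo_def refl split: wo.splits)
  show "x \<le> y \<Longrightarrow> y \<le> z \<Longrightarrow> x \<le> z"
    by (auto simp: less_eq_wo_def split: wo.splits intro: trans)
  show "x \<le> y \<Longrightarrow> y \<le> x \<Longrightarrow> x = y"
    by (auto simp: less_eq_wo_def split: wo.splits intro: antisym)
  show "x \<le> y \<or> y \<le> x"
    using total by (auto simp: less_eq_wo_def split: wo.splits)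
  fix P :: "'a wo \<Rightarrow> bool" and a
  assume step: "\<And>x. (\<And>y. y < x \<Longrightarrow> P y) \<Longrightarrow> P x"
  have elt: "P (Elt b)" for b
  proof (induction b rule: wf_induct_rule[OF wf])
    case (1 b)
    show ?case
    proof (rule step)
      fix y assume "y < Elt b"
      then obtain c where "y = Elt c" "(c, b) \<in> some_wo" "c \<noteq> b"
        using refl by (auto simp: less_wo_def less_eq_wo_def split: wo.splits)
      then show "P y" using 1 by auto
    qed
  qed
  show "P a"
  proof (cases a)
    case Top
    have "y < Top \<Longrightarrow> P y" for y
      using elt by (cases y) (auto simp: less_wo_def)
    with step Top show ?thesis by blast
  qed (use elt in auto)
qed

end

lemma lessThan_Top: "{..<Top} = range Elt"
proof -
  have "x < Top \<longleftrightarrow> x \<in> range Elt" for x :: "'a wo"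
    by (cases x) (auto simp: less_wo_def less_eq_wo_def)
  then show ?thesis by blast
qed

lemma not_card_le_iff: "\<not> |A| \<le>o |B| \<longleftrightarrow> |B| <o |A|"
  by (rule not_ordLeq_iff_ordLess[OF card_of_Well_order card_of_Well_order])

lemma wo_rel:
  fixes S :: "'w :: wellorder set"
  defines "r \<equiv> {(x, y). x \<in> S \<and> y \<in> S \<and> x \<le> y}"
  shows "Well_order r" "Field r = S"
proof -
  show F: "Field r = S" by (auto simp: r_def Field_def)
  have "wf (r - Id)"
    by (rule wf_subset[OF wf]) (auto simp: r_def)
  then show "Well_order r"
    unfolding well_order_on_def order_on_defs F
    by (auto simp: r_def refl_on_def trans_def antisym_def total_on_def)
qed

text \<open>The cardinal \<open>|S|\<close> is least among the well-orders of \<open>S\<close>, so a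
  strictly smaller cardinal is isomorphic to a proper initial segment of the given order.\<close>

lemma card_initial_segment:
  fixes S :: "'w :: wellorder set"
  assumes "|A| <o |S|"
  obtains s where "s \<in> S" "|A| =o |S \<inter> {..<s}|"
proof -
  define r where "r = {(x, y). x \<in> S \<and> y \<in> S \<and> x \<le> y}"
  have r: "Well_order r" "Field r = S"
    using wo_rel[of S] by (auto simp: r_def)
  have "|S| \<le>o r" using card_of_least[of S r] r by simp
  with assms have "|A| <o r" by (rule ordLess_ordLeq_trans)
  then obtain s where s: "s \<in> Field r" "|A| =o Restr r (underS r s)"
    using ordLess_iff_ordIso_Restr[OF r(1) card_of_Well_order] by blast
  have "|A| =o | Field (Restr r (underS r s)) |"
    using card_of_cong[OF s(2)] by (simp add: Field_card_of)
  moreover have "Field (Restr r (underS r s)) = S \<inter> {..<s}"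
    using s(1) r(2) by (auto simp: r_def Field_def underS_def)
  ultimately show thesis using that s(1) r(2) by auto
qed

text \<open>Here \<open>t\<close> serves as the initial ordinal of \<open>|A|\<close>: in a
  recursion of length \<open>t\<close> every step has fewer than \<open>|A|\<close>
  predecessors.\<close>

lemma wo_index:
  fixes A :: "'a set"
  obtains t :: "'a wo" where "|{..<t}| =o |A|" "\<And>s. s < t \<Longrightarrow> |{..<s}| <o |A|"
proof -
  let ?Q = "\<lambda>t :: 'a wo. |A| \<le>o |{..<t}|"
  have "?Q Top"
  proof -
    have "|A| \<le>o |range (Elt :: 'a \<Rightarrow> _)|"
      by (rule card_of_ordLeqI[of Elt]) (auto simp: inj_on_def)
    then show ?thesis by (simp add: lessThan_Top)
  qed
  define t where "t = (LEAST t. ?Q t)"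
  have 1: "?Q t" unfolding t_def using \<open>?Q Top\<close> by (rule LeastI)
  have 2: "|{..<s}| <o |A|" if "s < t" for s
    using not_less_Least[of s ?Q] that unfolding t_def by (simp add: not_card_le_iff)
  have "\<not> |A| <o |{..<t}|"
  proof
    assume "|A| <o |{..<t}|"
    then obtain s where s: "s \<in> {..<t}" "|A| =o |{..<t} \<inter> {..<s}|"
      by (rule card_initial_segment)
    moreover from s have "{..<t} \<inter> {..<s} = {..<s}" by auto
    ultimately have "|A| =o |{..<s}|" by simp
    with 2[of s] s(1) show False
      using not_ordLess_ordIso ordIso_symmetric by auto
  qed
  with 1 have "|{..<t}| =o |A|"
    unfolding ordIso_iff_ordLeq by (simp flip: not_card_le_iff)
  from this 2 show thesis by (rule that)  
qed

text \<open>The type \<open>nat set\<close> only supplies an uncountable well-order, whose least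
  uncountable initial segment becomes \<open>omega1\<close>.\<close>

definition omega1_bound :: "nat set wo" where
  "omega1_bound = (LEAST t. uncountable {..<t})"

lemma uncountable_nat_sets: "uncountable (UNIV :: nat set set)"
proof
  assume "countable (UNIV :: nat set set)"
  then obtain f :: "nat \<Rightarrow> nat set" where "range f = UNIV"
    using uncountable_def[of "UNIV :: nat set set"] by blast
  then show False using Cantors_theorem[of UNIV] by auto
qed

lemma omega1_bound: "uncountable {..<omega1_bound}" "t < omega1_bound \<Longrightarrow> countable {..<t}"
proof -
  have "uncountable (range (Elt :: nat set \<Rightarrow> _))"
    using uncountable_nat_sets by (simp add: countable_image_inj_eq inj_on_def)
  then have "uncountable {..<(Top :: nat set wo)}" by (simp add: lessThan_Top)
  then show "uncountable {..<omega1_bound}"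
    unfolding omega1_bound_def by (rule LeastI)
  show "t < omega1_bound \<Longrightarrow> countable {..<t}"
    unfolding omega1_bound_def using not_less_Least by blast
qed

typedef omega1 = "{..<omega1_bound}"
proof -
  have "{..<omega1_bound} \<noteq> {}" using omega1_bound(1) by (metis countable_empty)
  then show "\<exists>x. x \<in> {..<omega1_bound}" by blast
qed

setup_lifting type_definition_omega1

instantiation omega1 :: wellorder
begin
lift_definition less_eq_omega1 :: "omega1 \<Rightarrow> omega1 \<Rightarrow> bool" is "(\<le>)" .
lift_definition less_omega1 :: "omega1 \<Rightarrow> omega1 \<Rightarrow> bool" is "(<)" .
instance
proof
  fix P :: "omega1 \<Rightarrow> bool" and a
  assume step: "\<And>x. (\<And>y. y < x \<Longrightarrow> P y) \<Longrightarrow> P x"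
  show "P a"
  proof (induction "Rep_omega1 a" arbitrary: a rule: less_induct)
    case less
    then show ?case by (metis step less_omega1.rep_eq)
  qed
qed (auto simp: less_eq_omega1.rep_eq less_omega1.rep_eq simp flip: Rep_omega1_inject)
end

lemma countable_lessThan_omega1 [simp]: "countable {..<(x :: omega1)}"
proof -
  have "Rep_omega1 ` {..<x} \<subseteq> {..<Rep_omega1 x}" by (auto simp: less_omega1.rep_eq)
  moreover have "countable {..<Rep_omega1 x}"
    using omega1_bound(2) Rep_omega1[of x] by auto
  ultimately have "countable (Rep_omega1 ` {..<x})" by (rule countable_subset)
  then show ?thesis
    by (rule countable_image_inj_on) (simp add: inj_on_def Rep_omega1_inject)
qed

lemma uncountable_UNIV_omega1: "uncountable (UNIV :: omega1 set)"
proof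
  assume "countable (UNIV :: omega1 set)"
  then have "countable (range Rep_omega1)" by simp
  then show False
    using omega1_bound(1) type_definition.Rep_range[OF type_definition_omega1] by simp
qed

text \<open>Regularity of omega1: countably many countable initial segments do not exhaust
  it.\<close>

lemma countable_bounded_omega1:
  fixes A :: "omega1 set"
  assumes "countable A"
  obtains b where "\<And>a. a \<in> A \<Longrightarrow> a < b"
proof -
  have "countable (\<Union>a\<in>A. insert a {..<a})" using assms by simp
  with uncountable_UNIV_omega1 have "(\<Union>a\<in>A. insert a {..<a}) \<noteq> UNIV" by metis
  then obtain b where b: "b \<notin> (\<Union>a\<in>A. insert a {..<a})" by blast
  have "a < b" if "a \<in> A" for a
    using b that by (cases a b rule: linorder_cases) auto
  then show thesis by (rule that)
qed

lemma card_omega1_le: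
  assumes "uncountable A"
  shows "|UNIV :: omega1 set| \<le>o |A|"
proof (rule ccontr)
  assume "\<not> ?thesis"
  then have "|A| <o |UNIV :: omega1 set|" by (simp add: not_card_le_iff)
  then obtain s :: omega1 where "|A| =o |UNIV \<inter> {..<s}|"
    by (rule card_initial_segment)
  then have "|A| \<le>o |{..<s}|" by (simp add: ordIso_imp_ordLeq)
  then have "countable A" by (rule countable_ordLeq) simp
  with assms show False by simp
qed

lemma surj_omega1:
  assumes "|A| \<le>o |UNIV :: omega1 set|" "A \<noteq> {}"
  obtains f :: "omega1 \<Rightarrow> 'a" where "range f = A"
proof -
  have "\<exists>g :: omega1 \<Rightarrow> 'a. g ` UNIV = A"
    using card_of_ordLeq2[OF assms(2), of "UNIV :: omega1 set"] assms(1) by blast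
  with that show thesis by blast
qed

lemma countable_le_omega1:
  assumes "countable A"
  shows "|A| \<le>o |UNIV :: omega1 set|"
proof -
  have "|A| \<le>o |UNIV :: nat set|"
    using assms by (simp add: countable_card_of_nat)
  also have "|UNIV :: nat set| \<le>o |UNIV :: omega1 set|"
    using uncountable_UNIV_omega1 infinite_iff_card_of_nat countable_finite by blast
  finally show ?thesis .
qed

section \<open>Products of ordinals modulo small sets\<close>

text \<open>\<open>big n\<close>: the ordinal \<open>n\<close> is positive and of cofinality greater than \<open>\<omega>\<^sub>1\<close>.\<close>

definition big :: "'w :: wellorder \<Rightarrow> bool" where
  "big n \<longleftrightarrow> (\<exists>b. b < n) \<and> (\<forall>m :: omega1 \<Rightarrow> 'w. (\<forall>i. m i < n) \<longrightarrow> (\<exists>b<n. \<forall>i. m i < b))"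

text \<open>The product of the ordinals in \<open>Y\<close>. Functions are total with arbitrary
  values off \<open>Y\<close>.\<close>

definition below :: "'w set \<Rightarrow> ('w :: wellorder \<Rightarrow> 'w) set" where
  "below Y = {f. \<forall>n\<in>Y. f n < n}"

text \<open>Domination is pointwise, not modulo an ideal; the least size of such a \<open>D\<close>
  is the cofinality of the product in the pointwise order.\<close>

definition dominating :: "'w set \<Rightarrow> ('w :: wellorder \<Rightarrow> 'w) set \<Rightarrow> bool" where
  "dominating Y D \<longleftrightarrow> D \<subseteq> below Y \<and> (\<forall>f\<in>below Y. \<exists>d\<in>D. \<forall>n\<in>Y. f n \<le> d n)"

lemma belowI: "(\<And>n. n \<in> Y \<Longrightarrow> f n < n) \<Longrightarrow> f \<in> below Y"
  by (simp add: below_def)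

lemma belowD: "f \<in> below Y \<Longrightarrow> n \<in> Y \<Longrightarrow> f n < n"
  by (simp add: below_def)

lemma dominating_less: "dominating Y D \<Longrightarrow> d \<in> D \<Longrightarrow> n \<in> Y \<Longrightarrow> d n < n"
  by (auto simp: dominating_def below_def)

lemma big_pos: "big n \<Longrightarrow> \<exists>b. b < n"
  by (simp add: big_def)

lemma below_nonempty:
  assumes "\<And>n. n \<in> Z \<Longrightarrow> big n"
  obtains f where "f \<in> below Z"
proof -
  have "\<forall>n\<in>Z. \<exists>b. b < n" using assms big_pos by blast
  then obtain f where "\<forall>n\<in>Z. f n < n" by metis
  then have "f \<in> below Z" by (simp add: below_def)
  then show thesis by (rule that)
qed

lemma below_extend:
  assumes "\<And>n. n \<in> Z \<Longrightarrow> big n" and "f \<in> below X"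
  obtains f' where "f' \<in> below Z" "\<And>n. n \<in> X \<Longrightarrow> f' n = f n"
proof -
  obtain u where u: "u \<in> below Z" using below_nonempty[of Z] assms(1) by blast
  define f' where "f' = (\<lambda>n. if n \<in> X then f n else u n)"
  have "f' \<in> below Z" using u assms(2) by (auto simp: f'_def below_def)
  then show thesis using that[of f'] by (simp add: f'_def)
qed

lemma dominating_subset:
  assumes "\<And>n. n \<in> Y \<Longrightarrow> big n" and "X \<subseteq> Y" and D: "dominating Y D"
  shows "dominating X D"
  unfolding dominating_def
proof (intro conjI ballI)
  show "D \<subseteq> below X" using assms by (auto simp: dominating_def below_def)
  fix f assume "f \<in> below X"
  then obtain f' where "f' \<in> below Y" "\<And>n. n \<in> X \<Longrightarrow> f' n = f n"
    using below_extend[of Y f X] assms(1) by blast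
  then show "\<exists>d\<in>D. \<forall>n\<in>X. f n \<le> d n"
    using D \<open>X \<subseteq> Y\<close> unfolding dominating_def by (metis subsetD)
qed

text \<open>Gluing along \<open>X\<close> bounds the cofinality on a union by a product of two
  cofinalities, so the small sets below form an ideal.\<close>

lemma dominating_Un:
  assumes "dominating X D" "dominating Y E"
  shows "dominating (X \<union> Y) ((\<lambda>(d, e) n. if n \<in> X then d n else e n) ` (D \<times> E))"
  unfolding dominating_def
proof (intro conjI ballI)
  show "(\<lambda>(d, e) n. if n \<in> X then d n else e n) ` (D \<times> E) \<subseteq> below (X \<union> Y)"
    using assms[THEN dominating_less] by (auto intro!: belowI)
  fix f assume f: "f \<in> below (X \<union> Y)"
  then have "f \<in> below X" "f \<in> below Y" by (auto simp: below_def)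
  then obtain d e where "d \<in> D" "e \<in> E" and de: "\<forall>n\<in>X. f n \<le> d n" "\<forall>n\<in>Y. f n \<le> e n"
    using assms unfolding dominating_def by blast
  show "\<exists>d\<in>(\<lambda>(d, e) n. if n \<in> X then d n else e n) ` (D \<times> E). \<forall>n\<in>X \<union> Y. f n \<le> d n"
  proof
    show "(\<lambda>n. if n \<in> X then d n else e n) \<in> (\<lambda>(d, e) n. if n \<in> X then d n else e n) ` (D \<times> E)"
      using \<open>d \<in> D\<close> \<open>e \<in> E\<close> by (intro image_eqI[of _ _ "(d, e)"]) auto
  qed (use de in auto)
qed

text \<open>This is what \<open>big\<close> is for: in each coordinate, omega1 many values below an
  ordinal of cofinality greater than omega1 are bounded.\<close>

lemma below_sup_omega1:
  fixes F :: "omega1 \<Rightarrow> 'w :: wellorder \<Rightarrow> 'w"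
  assumes "\<And>n. n \<in> Z \<Longrightarrow> big n" and "\<And>i. F i \<in> below Z"
  obtains g where "g \<in> below Z" "\<And>i n. n \<in> Z \<Longrightarrow> F i n < g n"
proof -
  have "\<forall>n\<in>Z. \<exists>b<n. \<forall>i. F i n < b"
    using assms by (auto simp: big_def below_def)
  then obtain g where "\<forall>n\<in>Z. g n < n \<and> (\<forall>i. F i n < g n)" by metis
  then show thesis using that[of g] by (auto simp: below_def)
qed

lemma big_countable_bound:
  assumes "big n" "countable S" "\<And>x. x \<in> S \<Longrightarrow> x < n"
  obtains b where "b < n" "\<And>x. x \<in> S \<Longrightarrow> x < b"
proof (cases "S = {}")
  case True
  then show ?thesis using that big_pos[OF assms(1)] by auto
next
  case False
  then obtain m :: "omega1 \<Rightarrow> 'a" where m: "range m = S"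
    using surj_omega1[OF countable_le_omega1[OF assms(2)]] by blast
  then have "m i < n" for i using assms(3) by auto
  then obtain b where "b < n" "\<forall>i. m i < b"
    using assms(1) unfolding big_def by blast
  then show ?thesis using that[of b] m by auto
qed

text \<open>A pcf ideal, defined by cofinalities of pointwise orders instead of ultraproducts;
  \<open>E\<close> only contributes its cardinality.\<close>

definition le_small :: "('w :: wellorder \<Rightarrow> 'w) set \<Rightarrow> 'w set \<Rightarrow> bool" where
  "le_small E X \<longleftrightarrow> (\<exists>D. dominating X D \<and> |D| \<le>o |E| )"

lemma le_small_mono:
  assumes "le_small E Y" "\<And>n. n \<in> Y \<Longrightarrow> big n" "X \<subseteq> Y"
  shows "le_small E X"
  using assms dominating_subset unfolding le_small_def by blast

lemma le_small_card_mono: "le_small E X \<Longrightarrow> |E| \<le>o |F| \<Longrightarrow> le_small F X"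
  unfolding le_small_def using ordLeq_transitive by blast

lemma le_small_empty: "E \<noteq> {} \<Longrightarrow> le_small E {}"
  unfolding le_small_def
  by (intro exI[of _ "{\<lambda>n. n}"]) (auto simp: dominating_def below_def card_of_singl_ordLeq)

text \<open>The analogue of the \<open>\<lambda>\<close>-directedness of \<open>\<Prod>a / J\<^bsub><\<lambda>\<^esub>\<close> in pcf theory. After arranging \<open>E\<close> in a
  sequence that increases modulo small sets, a missing bound would yield an increasing \<open>\<omega>\<^sub>1\<close>-sequence of
  functions \<open>G i\<close> such that, for one fixed member \<open>f\<close> of the sequence, \<open>{n. G i n < f n}\<close> strictly
  decreases with \<open>i\<close>; but these are subsets of a countable set.\<close>

theorem upper_bound_mod_small:
  fixes Z :: "'w :: wellorder set" and E :: "('w \<Rightarrow> 'w) set"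
  assumes Z: "countable Z" "\<And>n. n \<in> Z \<Longrightarrow> big n" and E: "E \<subseteq> below Z"
  shows "\<exists>g\<in>below Z. \<forall>f\<in>E. le_small E {n \<in> Z. g n < f n}"
  using E
proof (induction E rule: wf_induct_rule[OF wf_inv_image[OF wf_ordLess, of card_of]])
  case (1 E)
  have IH: "\<exists>g\<in>below Z. \<forall>f\<in>F. le_small F {n \<in> Z. g n < f n}" if "F \<subseteq> below Z" "|F| <o |E|" for F
    using 1(1)[of F] that by (simp add: inv_image_def)
  have E: "E \<subseteq> below Z" by fact
  obtain g0 where g0: "g0 \<in> below Z" using below_nonempty Z(2) by blast
  show ?case
  proof (cases "E = {}")
    case True
    then show ?thesis using g0 by auto
  next
    case ne: False
    obtain t :: "('w \<Rightarrow> 'w) wo" where t: "|{..<t}| =o |E|" "\<And>s. s < t \<Longrightarrow> |{..<s}| <o |E|"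
      using wo_index by blast
    then obtain f where f: "bij_betw f {..<t} E" using card_of_ordIso by blast
    \<comment> \<open>The enumeration of \<open>E\<close> is raised to a sequence \<open>f'\<close>
      that increases modulo small sets: the induction hypothesis bounds the earlier values, fewer
      than \<open>|E|\<close> in number, and the maximum with \<open>f s\<close> keeps
      \<open>E\<close> covered.\<close>
    have "\<exists>f'. \<forall>s. s < t \<longrightarrow> f' s \<in> below Z \<and> (\<forall>n\<in>Z. f s n \<le> f' s n)
      \<and> (\<forall>r<s. le_small E {n \<in> Z. f' s n < f' r n})"
    proof (rule dependent_wf_choice[OF wf, where P = "\<lambda>f' s g. s < t \<longrightarrow> g \<in> below Z \<and> (\<forall>n\<in>Z. f s n \<le> g n)
      \<and> (\<forall>r<s. le_small E {n \<in> Z. g n < f' r n})"])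
      fix F G :: "('w \<Rightarrow> 'w) wo \<Rightarrow> 'w \<Rightarrow> 'w" and s r
      assume "\<And>z. (z, s) \<in> {(x, y). x < y} \<Longrightarrow> F z = G z"
      then show "(s < t \<longrightarrow> r \<in> below Z \<and> (\<forall>n\<in>Z. f s n \<le> r n) \<and> (\<forall>ra<s. le_small E {n \<in> Z. r n < F ra n})) =
         (s < t \<longrightarrow> r \<in> below Z \<and> (\<forall>n\<in>Z. f s n \<le> r n) \<and> (\<forall>ra<s. le_small E {n \<in> Z. r n < G ra n}))"
        by simp
    next
      fix s and F :: "('w \<Rightarrow> 'w) wo \<Rightarrow> 'w \<Rightarrow> 'w"
      assume F: "\<And>y. (y, s) \<in> {(x, y). x < y} \<Longrightarrow> y < t \<longrightarrow> F y \<in> below Z \<and> (\<forall>n\<in>Z. f y n \<le> F y n)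
             \<and> (\<forall>r<y. le_small E {n \<in> Z. F y n < F r n})"
      show "\<exists>g. s < t \<longrightarrow> g \<in> below Z \<and> (\<forall>n\<in>Z. f s n \<le> g n) \<and> (\<forall>r<s. le_small E {n \<in> Z. g n < F r n})"
      proof (cases "s < t")
        case True
        have "|F ` {..<s}| \<le>o |{..<s}|" by (rule card_of_image)
        with t(2)[OF True] have c: "|F ` {..<s}| <o |E|" by (rule ordLeq_ordLess_trans[rotated])
        have "F ` {..<s} \<subseteq> below Z" using F True by auto
        from IH[OF this c] obtain g where g: "g \<in> below Z"
          "\<forall>h\<in>F ` {..<s}. le_small (F ` {..<s}) {n \<in> Z. g n < h n}" by blast
        have fs: "f s \<in> below Z" using True f E by (auto dest: bij_betwE)
        show ?thesis
        proof (intro exI[of _ "\<lambda>n. max (f s n) (g n)"] impI conjI ballI allI)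
          show "(\<lambda>n. max (f s n) (g n)) \<in> below Z" using fs g(1) by (auto simp: below_def)
          fix r assume "r < s"
          then have "le_small (F ` {..<s}) {n \<in> Z. g n < F r n}" using g(2) by auto
          then have "le_small E {n \<in> Z. g n < F r n}"
            using le_small_card_mono c ordLess_imp_ordLeq by blast
          then show "le_small E {n \<in> Z. max (f s n) (g n) < F r n}"
            by (rule le_small_mono) (use Z in auto)
        qed simp
      qed simp
    qed
    then obtain f' where f': "\<And>s. s < t \<Longrightarrow> f' s \<in> below Z" "\<And>s n. s < t \<Longrightarrow> n \<in> Z \<Longrightarrow> f s n \<le> f' s n"
      "\<And>s r. s < t \<Longrightarrow> r < s \<Longrightarrow> le_small E {n \<in> Z. f' s n < f' r n}" by blast
    have f'_le: "le_small E {n \<in> Z. f' s n < f' r n}" if "s < t" "r \<le> s" for r s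
      using f'(3)[OF that(1), of r] that(2) le_small_empty[OF ne] by (cases "r = s") auto
    have suff: "\<forall>h\<in>E. le_small E {n \<in> Z. g n < h n}" if "\<And>s. s < t \<Longrightarrow> le_small E {n \<in> Z. g n < f' s n}" for g
    proof
      fix h assume "h \<in> E"
      then obtain s where s: "s < t" "h = f s" using f by (auto simp: bij_betw_def)
      show "le_small E {n \<in> Z. g n < h n}"
        by (rule le_small_mono[OF that[OF s(1)]]) (use f'(2)[OF s(1)] s(2) Z in \<open>auto intro: less_le_trans\<close>)
    qed
    show ?thesis
    \<comment> \<open>If \<open>t\<close> has cofinality at most omega1, pointwise bounds along a
      cofinal sequence suffice. Otherwise any omega1 many positions are bounded below
      \<open>t\<close>.\<close>
    proof (cases "\<exists>m :: omega1 \<Rightarrow> _. (\<forall>i. m i < t) \<and> (\<forall>s<t. \<exists>i. s \<le> m i)")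
      case True
      then obtain m :: "omega1 \<Rightarrow> _" where m: "\<And>i. m i < t" "\<And>s. s < t \<Longrightarrow> \<exists>i. s \<le> m i" by blast
      obtain g where g: "g \<in> below Z" "\<And>i n. n \<in> Z \<Longrightarrow> f' (m i) n < g n"
        using below_sup_omega1[of Z "\<lambda>i. f' (m i)"] Z(2) f'(1) m(1) by blast
      have "le_small E {n \<in> Z. g n < f' s n}" if s: "s < t" for s
      proof -
        obtain i where i: "s \<le> m i" using m(2)[OF s] by blast
        show ?thesis
          by (rule le_small_mono[OF f'_le[OF m(1) i]]) (use Z g(2)[of _ i] in \<open>auto intro: less_trans\<close>)
      qed
      with suff g(1) show ?thesis by blast
    next
      case bdd: False
      have tinf: "infinite {..<t}"
      proof
        assume fin: "finite {..<t}"
        have "{..<t} \<noteq> {}" using ne t(1) f by (auto simp: bij_betw_def)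
        then have "Max {..<t} < t" "\<And>s. s < t \<Longrightarrow> s \<le> Max {..<t}" using fin Max_in[OF fin] by auto
        then show False
          using bdd[unfolded not_ex, THEN spec, of "\<lambda>_. Max {..<t}"] by auto
      qed
      then have Einf: "infinite E" using t(1) card_of_ordIso_finite by blast
      show ?thesis
      proof (rule ccontr)
        assume no: "\<not> ?thesis"
        \<comment> \<open>A failed bound \<open>g\<close> has a successor \<open>g'\<close> such
          that, from some position on, every \<open>f' r\<close> has a coordinate strictly between
          the two.\<close>
        have step: "\<exists>g' s. g' \<in> below Z \<and> s < t \<and>
          (\<forall>r. s \<le> r \<longrightarrow> r < t \<longrightarrow> (\<exists>n\<in>Z. g n < f' r n \<and> f' r n < g' n))" if g: "g \<in> below Z" for g
        proof -
          obtain s where s: "s < t" "\<not> le_small E {n \<in> Z. g n < f' s n}"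
            using no suff[of g] g by blast
          let ?X = "{n \<in> Z. g n < f' s n}"
          show ?thesis
          proof (rule ccontr)
            assume neg: "\<not> ?thesis"
            have neg': "\<exists>r. s \<le> r \<and> r < t \<and> (\<forall>n\<in>Z. g n < f' r n \<longrightarrow> g' n \<le> f' r n)" if "g' \<in> below Z" for g'
              using neg that s(1) by (meson not_le_imp_less)
            let ?Y = "\<lambda>r. {n \<in> Z. f' r n < f' s n}"
            have "\<forall>r\<in>{s..<t}. \<exists>D. dominating (?Y r) D \<and> |D| \<le>o |E|"
              using f'_le by (auto simp: le_small_def)
            from bchoice[OF this] obtain D where D': "\<forall>r\<in>{s..<t}. dominating (?Y r) (D r) \<and> |D r| \<le>o |E|" ..
            then have D: "\<And>r. s \<le> r \<Longrightarrow> r < t \<Longrightarrow> dominating (?Y r) (D r)"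
              "\<And>r. s \<le> r \<Longrightarrow> r < t \<Longrightarrow> |D r| \<le>o |E|" by auto
            \<comment> \<open>Without such a \<open>g'\<close>, the set \<open>?X\<close> would be
              small: every \<open>h\<close> is bounded on \<open>?X\<close> by some
              \<open>f' r\<close>, except where \<open>f' r\<close> drops below \<open>f' s\<close>,
              and there \<open>D r\<close> dominates.\<close>
            let ?G = "(\<lambda>(r, d) n. if n \<in> ?Y r then d n else f' r n) ` (SIGMA r:{s..<t}. D r)"
            have "dominating ?X ?G" unfolding dominating_def
            proof (intro conjI ballI)
              show "?G \<subseteq> below ?X"
                using dominating_less[OF D(1)] belowD[OF f'(1)] by (auto intro!: belowI)
              fix h assume hX: "h \<in> below ?X"
              then obtain h' where h': "h' \<in> below Z" "\<And>n. n \<in> ?X \<Longrightarrow> h' n = h n"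
                using below_extend[OF Z(2) hX] by blast
              obtain r where r: "s \<le> r" "r < t" "\<forall>n\<in>Z. g n < f' r n \<longrightarrow> h' n \<le> f' r n"
                using neg'[OF h'(1)] by blast
              have "h' \<in> below (?Y r)" using h'(1) by (auto simp: below_def)
              then obtain d where d: "d \<in> D r" "\<forall>n\<in>?Y r. h' n \<le> d n"
                using D(1)[OF r(1,2)] by (auto simp: dominating_def)
              show "\<exists>d\<in>?G. \<forall>n\<in>?X. h n \<le> d n"
              proof (intro bexI ballI)
                show "(\<lambda>n. if n \<in> ?Y r then d n else f' r n) \<in> ?G"
                  using r d(1) by (intro image_eqI[of _ _ "(r, d)"]) auto
                fix n assume n: "n \<in> ?X"
                then have "g n < f' r n" if "n \<notin> ?Y r" using that by auto
                then show "h n \<le> (if n \<in> ?Y r then d n else f' r n)"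
                  using n d(2) r(3) h'(2) by (auto split: if_splits)
              qed
            qed
            moreover have "|?G| \<le>o |E|"
            proof -
              have "|SIGMA r:{s..<t}. D r| \<le>o |E|"
              proof (rule card_of_Sigma_ordLeq_infinite[OF Einf])
                have "|{s..<t}| \<le>o |{..<t}|" by (rule card_of_mono1) auto
                also have "|{..<t}| \<le>o |E|" using t(1) by (rule ordIso_imp_ordLeq)
                finally show "|{s..<t}| \<le>o |E|" .
              qed (use D(2) in auto)
              with card_of_image show ?thesis by (rule ordLeq_transitive)
            qed
            ultimately show False using s(2) unfolding le_small_def by blast
          qed
        qed
        then have "\<forall>g\<in>below Z. \<exists>p. fst p \<in> below Z \<and> snd p < t \<and>
          (\<forall>r. snd p \<le> r \<longrightarrow> r < t \<longrightarrow> (\<exists>n\<in>Z. g n < f' r n \<and> f' r n < fst p n))"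
          by (metis fst_conv snd_conv)
        from bchoice[OF this] obtain p where p: "\<forall>g\<in>below Z. fst (p g) \<in> below Z \<and> snd (p g) < t \<and>
          (\<forall>r. snd (p g) \<le> r \<longrightarrow> r < t \<longrightarrow> (\<exists>n\<in>Z. g n < f' r n \<and> f' r n < fst (p g) n))" ..
        define st where "st g = fst (p g)" for g
        define sb where "sb g = snd (p g)" for g
        from p have st: "\<And>g. g \<in> below Z \<Longrightarrow> st g \<in> below Z" "\<And>g. g \<in> below Z \<Longrightarrow> sb g < t"
          "\<And>g r. g \<in> below Z \<Longrightarrow> sb g \<le> r \<Longrightarrow> r < t \<Longrightarrow> \<exists>n\<in>Z. g n < f' r n \<and> f' r n < st g n"
          unfolding st_def sb_def by blast+
        have "\<exists>G. \<forall>i :: omega1. G i \<in> below Z \<and> (\<forall>j<i. \<forall>n\<in>Z. st (G j) n < G i n)"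
        proof (rule dependent_wf_choice[OF wf, where P = "\<lambda>G i g. g \<in> below Z \<and> (\<forall>j<i. \<forall>n\<in>Z. st (G j) n < g n)"])
          fix i and G :: "omega1 \<Rightarrow> 'w \<Rightarrow> 'w"
          assume G: "\<And>j. (j, i) \<in> {(x, y). x < y} \<Longrightarrow> G j \<in> below Z \<and> (\<forall>k<j. \<forall>n\<in>Z. st (G k) n < G j n)"
          \<comment> \<open>The family to be bounded must be indexed by all of omega1;
            \<open>g0\<close> fills the indices from \<open>i\<close> on.\<close>
          then have "(if j < i then st (G j) else g0) \<in> below Z" for j using st(1) g0 by auto
          from below_sup_omega1[of Z "\<lambda>j. if j < i then st (G j) else g0", OF Z(2) this]
          obtain g where g: "g \<in> below Z" "\<And>j n. n \<in> Z \<Longrightarrow> (if j < i then st (G j) else g0) n < g n" by blast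
          have "st (G j) n < g n" if "j < i" "n \<in> Z" for j n using g(2)[of n j] that by simp
          with g(1) show "\<exists>g. g \<in> below Z \<and> (\<forall>j<i. \<forall>n\<in>Z. st (G j) n < g n)" by blast
        qed simp
        then obtain G where G: "\<And>i :: omega1. G i \<in> below Z"
          "\<And>i j n. j < i \<Longrightarrow> n \<in> Z \<Longrightarrow> st (G j) n < G i n" by blast
        \<comment> \<open>As the cofinality of \<open>t\<close> now exceeds omega1, one position
          \<open>r\<close> lies beyond all the thresholds.\<close>
        have "\<exists>r<t. \<forall>i. sb (G i) < r"
          using bdd[unfolded not_ex, THEN spec, of "\<lambda>i. sb (G i)"] st(2)[OF G(1)] by (auto simp: not_le)
        then obtain r where r: "r < t" "\<And>i. sb (G i) \<le> r" by (auto intro: less_imp_le)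
        have "\<forall>i. \<exists>n\<in>Z. G i n < f' r n \<and> f' r n < st (G i) n"
          using st(3)[OF G(1) r(2) r(1)] by blast
        then obtain \<nu> where \<nu>: "\<And>i. \<nu> i \<in> Z" "\<And>i. G i (\<nu> i) < f' r (\<nu> i)" "\<And>i. f' r (\<nu> i) < st (G i) (\<nu> i)"
          by metis
        have "inj \<nu>"
        proof (rule linorder_injI)
          fix i j :: omega1 assume "i < j"
          then have "st (G i) (\<nu> i) < G j (\<nu> i)" using G(2) \<nu>(1) by blast
          with \<nu>(3)[of i] have "f' r (\<nu> i) < G j (\<nu> i)" by (rule less_trans)
        with \<nu>(2)[of j] show "\<nu> i \<noteq> \<nu> j" by (metis less_asym)
        qed
        moreover have "countable (range \<nu>)" using \<nu>(1) Z(1) by (meson countable_subset image_subsetI)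
        ultimately show False
          using uncountable_UNIV_omega1 by (simp add: countable_image_inj_eq)
      qed
    qed
  qed
qed

section \<open>Scales for countable products\<close>

definition small :: "('w :: wellorder \<Rightarrow> 'w) wo \<Rightarrow> 'w set \<Rightarrow> bool" where
  "small l X \<longleftrightarrow> (\<exists>D. dominating X D \<and> |D| <o |{..<l}| )"

lemma small_mono:
  assumes "small l Y" "\<And>n. n \<in> Y \<Longrightarrow> big n" "X \<subseteq> Y"
  shows "small l X"
  using assms dominating_subset unfolding small_def by blast

lemma card_of_Times_less:
  assumes inf: "infinite C" and "|A| <o |C|" "|B| <o |C|"
  shows "|A \<times> B| <o |C|"
proof (cases "finite A \<and> finite B")
  case True
  have "\<not> |C| \<le>o |A \<times> B|"
    using True inf card_of_ordLeq_infinite[of C "A \<times> B"] by blast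
  then show ?thesis by (simp add: not_card_le_iff)
next
  case False
  show ?thesis
  proof (cases "|A| \<le>o |B|")
    case True
    then have "infinite B" using False card_of_ordLeq_infinite by blast
    then have "|A \<times> B| \<le>o |B|" using True by (intro card_of_Sigma_ordLeq_infinite) (auto intro: card_of_mono1)
    then show ?thesis using assms(3) by (rule ordLeq_ordLess_trans)
  next
    case le: False
    then have "|B| \<le>o |A|" by (simp add: not_card_le_iff ordLess_imp_ordLeq)
    moreover from this have "infinite A" using False card_of_ordLeq_infinite by blast
    ultimately have "|A \<times> B| \<le>o |A|" by (intro card_of_Sigma_ordLeq_infinite) (auto intro: card_of_mono1)
    then show ?thesis using assms(2) by (rule ordLeq_ordLess_trans)
  qed
qed

lemma small_Un:
  assumes "infinite {..<l}" "small l X" "small l Y"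
  shows "small l (X \<union> Y)"
proof -
  obtain D E where D: "dominating X D" "|D| <o |{..<l}|" and E: "dominating Y E" "|E| <o |{..<l}|"
    using assms(2,3) unfolding small_def by blast
  have "|D \<times> E| <o |{..<l}|" using assms(1) D(2) E(2) by (rule card_of_Times_less)
  with card_of_image have "|(\<lambda>(d, e) n. if n \<in> X then d n else e n) ` (D \<times> E)| <o |{..<l}|"
    by (rule ordLeq_ordLess_trans)
  then show ?thesis using dominating_Un[OF D(1) E(1)] unfolding small_def by blast
qed

lemma le_small_imp_small: "le_small E X \<Longrightarrow> |E| <o |{..<l}| \<Longrightarrow> small l X"
  unfolding le_small_def small_def using ordLeq_ordLess_trans by blast

text \<open>The length \<open>l\<close> is the initial ordinal of the cofinality of the product. The
  sequence increases only modulo sets of smaller cofinality, but is cofinal pointwise. The clause on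
  \<open>omega1\<close> says that \<open>l\<close> has cofinality greater than omega1.\<close>

definition is_scale :: "'w set \<Rightarrow> ('w \<Rightarrow> 'w) wo \<Rightarrow> (('w \<Rightarrow> 'w) wo \<Rightarrow> 'w :: wellorder \<Rightarrow> 'w) \<Rightarrow> bool" where
  "is_scale Y l f \<longleftrightarrow>
    (\<forall>x<l. f x \<in> below Y) \<and>
    (\<forall>x<l. \<forall>y<x. small l {n \<in> Y. f x n < f y n}) \<and>
    (\<forall>h\<in>below Y. \<exists>x<l. \<forall>n\<in>Y. h n \<le> f x n) \<and>
    (\<forall>m :: omega1 \<Rightarrow> _. (\<forall>i. m i < l) \<longrightarrow> (\<exists>x<l. \<forall>i. m i < x)) \<and>
    (\<forall>D. dominating Y D \<longrightarrow> |{..<l}| \<le>o |D| ) \<and>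
    (\<forall>x<l. |{..<x}| <o |{..<l}| )"

lemma is_scaleD:
  assumes "is_scale Y l f"
  shows "x < l \<Longrightarrow> f x \<in> below Y" "x < l \<Longrightarrow> y < x \<Longrightarrow> small l {n \<in> Y. f x n < f y n}"
    "h \<in> below Y \<Longrightarrow> \<exists>x<l. \<forall>n\<in>Y. h n \<le> f x n"
    "\<forall>i :: omega1. m i < l \<Longrightarrow> \<exists>x<l. \<forall>i. m i < x"
    "dominating Y D \<Longrightarrow> |{..<l}| \<le>o |D|" "x < l \<Longrightarrow> |{..<x}| <o |{..<l}|"
  using assms by (simp_all add: is_scale_def)

text \<open>A dominating family of least size is enumerated along its initial ordinal and raised to
  an increasing sequence; proper initial segments are smaller than the family, so
  \<open>upper_bound_mod_small\<close> bounds them modulo sets that are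
  \<open>small l\<close>.\<close>

lemma scale_exists:
  fixes Y :: "'w :: wellorder set"
  assumes Y: "countable Y" "\<And>n. n \<in> Y \<Longrightarrow> big n" and "Y \<noteq> {}"
  shows "\<exists>l f. is_scale Y l f"
proof -
  let ?R = "card_of ` {D. dominating Y D}"
  have "dominating Y (below Y)" by (auto simp: dominating_def)
  then have "?R \<noteq> {}" by blast
  then obtain D where D: "dominating Y D" and D_min: "\<And>D'. dominating Y D' \<Longrightarrow> |D| \<le>o |D'|"
    using exists_minim_Card_order[of ?R] by (auto simp: card_of_Card_order)
  obtain l :: "('w \<Rightarrow> 'w) wo" where l: "|{..<l}| =o |D|" "\<And>s. s < l \<Longrightarrow> |{..<s}| <o |D|"
    using wo_index[of D] by blast
  have l_less: "|{..<s}| <o |{..<l}|" if "s < l" for s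
    using l(2)[OF that] ordIso_symmetric[OF l(1)] by (rule ordLess_ordIso_trans)
  obtain d where d: "bij_betw d {..<l} D" using l(1) card_of_ordIso by blast
  have "\<exists>f. \<forall>s. s < l \<longrightarrow> f s \<in> below Y \<and> (\<forall>n\<in>Y. d s n \<le> f s n)
      \<and> (\<forall>r<s. small l {n \<in> Y. f s n < f r n})"
  proof (rule dependent_wf_choice[OF wf, where P = "\<lambda>f s g. s < l \<longrightarrow> g \<in> below Y \<and> (\<forall>n\<in>Y. d s n \<le> g n)
      \<and> (\<forall>r<s. small l {n \<in> Y. g n < f r n})"])
    fix F G :: "('w \<Rightarrow> 'w) wo \<Rightarrow> 'w \<Rightarrow> 'w" and s g
    assume "\<And>z. (z, s) \<in> {(x, y). x < y} \<Longrightarrow> F z = G z"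
    then show "(s < l \<longrightarrow> g \<in> below Y \<and> (\<forall>n\<in>Y. d s n \<le> g n) \<and> (\<forall>r<s. small l {n \<in> Y. g n < F r n})) =
       (s < l \<longrightarrow> g \<in> below Y \<and> (\<forall>n\<in>Y. d s n \<le> g n) \<and> (\<forall>r<s. small l {n \<in> Y. g n < G r n}))"
      by simp
  next
    fix s and F :: "('w \<Rightarrow> 'w) wo \<Rightarrow> 'w \<Rightarrow> 'w"
    assume F: "\<And>y. (y, s) \<in> {(x, y). x < y} \<Longrightarrow> y < l \<longrightarrow> F y \<in> below Y \<and> (\<forall>n\<in>Y. d y n \<le> F y n)
           \<and> (\<forall>r<y. small l {n \<in> Y. F y n < F r n})"
    show "\<exists>g. s < l \<longrightarrow> g \<in> below Y \<and> (\<forall>n\<in>Y. d s n \<le> g n) \<and> (\<forall>r<s. small l {n \<in> Y. g n < F r n})"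
    proof (cases "s < l")
      case True
      have "|F ` {..<s}| \<le>o |{..<s}|" by (rule card_of_image)
      with l_less[OF True] have c: "|F ` {..<s}| <o |{..<l}|" by (rule ordLeq_ordLess_trans[rotated])
      have "F ` {..<s} \<subseteq> below Y" using F True by auto
      from upper_bound_mod_small[OF Y this] obtain g where g: "g \<in> below Y"
        "\<forall>h\<in>F ` {..<s}. le_small (F ` {..<s}) {n \<in> Y. g n < h n}" by blast
      have ds: "d s \<in> below Y" using True d D by (auto dest: bij_betwE simp: dominating_def)
      show ?thesis
      proof (intro exI[of _ "\<lambda>n. max (d s n) (g n)"] impI conjI ballI allI)
        show "(\<lambda>n. max (d s n) (g n)) \<in> below Y" using ds g(1) by (auto simp: below_def)
        fix r assume "r < s"
        then have "le_small (F ` {..<s}) {n \<in> Y. g n < F r n}" using g(2) by auto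
        then have "small l {n \<in> Y. g n < F r n}" using c by (rule le_small_imp_small)
        then show "small l {n \<in> Y. max (d s n) (g n) < F r n}"
          by (rule small_mono) (use Y in auto)
      qed simp
    qed simp
  qed
  then obtain f where f: "\<And>s. s < l \<Longrightarrow> f s \<in> below Y" "\<And>s n. s < l \<Longrightarrow> n \<in> Y \<Longrightarrow> d s n \<le> f s n"
    "\<And>s r. s < l \<Longrightarrow> r < s \<Longrightarrow> small l {n \<in> Y. f s n < f r n}" by blast
  have cofinal: "\<exists>x<l. \<forall>n\<in>Y. h n \<le> f x n" if h: "h \<in> below Y" for h
  proof -
    obtain e where "e \<in> D" "\<forall>n\<in>Y. h n \<le> e n"
      using D h unfolding dominating_def by blast
    moreover obtain x where "x < l" "e = d x" using \<open>e \<in> D\<close> d by (auto simp: bij_betw_def)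
    ultimately show ?thesis using f(2) order_trans by blast
  qed
  have "is_scale Y l f" unfolding is_scale_def
  proof (intro conjI allI impI ballI)
    fix m :: "omega1 \<Rightarrow> _" assume m: "\<forall>i. m i < l"
    obtain g where g: "g \<in> below Y" "\<And>i n. n \<in> Y \<Longrightarrow> f (m i) n < g n"
      using below_sup_omega1[of Y "\<lambda>i. f (m i)"] Y(2) f(1) m by blast
    obtain x where x: "x < l" "\<forall>n\<in>Y. g n \<le> f x n" using cofinal[OF g(1)] by blast
    \<comment> \<open>If \<open>m i\<close> were not below \<open>x\<close>, then
      \<open>f (m i)\<close> lying below \<open>f x\<close> on all of \<open>Y\<close> would make
      \<open>Y\<close> itself small, against the minimality of \<open>D\<close>.\<close>
    have "m i < x" for i
    proof (rule ccontr)
      assume "\<not> m i < x"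
      have less: "f (m i) n < f x n" if "n \<in> Y" for n
        using g(2)[OF that] x(2) that by (auto intro: less_le_trans)
      have "x \<noteq> m i" using less \<open>Y \<noteq> {}\<close> by auto
      with \<open>\<not> m i < x\<close> have "small l {n \<in> Y. f (m i) n < f x n}"
        using f(3)[of "m i" x] m by auto
      moreover have "{n \<in> Y. f (m i) n < f x n} = Y" using less by auto
      ultimately obtain E where "dominating Y E" "|E| <o |{..<l}|" by (auto simp: small_def)
      then have "|E| <o |D|" using l(1) ordLess_ordIso_trans by blast
      with D_min[OF \<open>dominating Y E\<close>] show False by (simp flip: not_card_le_iff)
    qed
    with x(1) show "\<exists>x<l. \<forall>i. m i < x" by blast
  next
    fix E assume "dominating Y E"
    with l(1) D_min[of E] show "|{..<l}| \<le>o |E|" using ordIso_ordLeq_trans by blast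
  qed (use f cofinal l_less in auto)
  then show ?thesis by blast
qed

lemma is_scale_infinite:
  fixes Y :: "'w :: wellorder set"
  assumes "is_scale Y l f" "\<And>n. n \<in> Y \<Longrightarrow> big n"
  shows "infinite {..<l}"
proof
  assume fin: "finite {..<l}"
  obtain u where "u \<in> below Y" using below_nonempty assms(2) by blast
  then have "{..<l} \<noteq> {}" using is_scaleD(3)[OF assms(1)] by blast
  then have "Max {..<l} < l" using fin Max_in by blast
  then have "\<exists>x<l. \<forall>i :: omega1. Max {..<l} < x"
    by (intro is_scaleD(4)[OF assms(1)] allI)
  then obtain x where "x < l" "Max {..<l} < x" by blast
  then show False using Max_ge[OF fin, of x] by auto
qed

text \<open>Passing to a small set strictly shortens the scale; this makes the recursion in
  \<open>decode_eq\<close> terminate.\<close>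

lemma small_scale_less:
  assumes "is_scale Y l f" "is_scale X k g" "small l X"
  shows "k < l"
proof (rule ccontr)
  assume "\<not> k < l"
  then have "|{..<l}| \<le>o |{..<k}|" by (intro card_of_mono1) auto
  also obtain D where D: "dominating X D" "|D| <o |{..<l}|" using assms(3) small_def by blast
  have "|{..<k}| \<le>o |D|" using assms(2) D(1) by (rule is_scaleD(5))
  finally show False using D(2) by (simp flip: not_card_le_iff)
qed

section \<open>Chains of countable sets\<close>

text \<open>\<open>large C\<close> says that \<open>C\<close> contains a club: the limit ordinals closed under some function.\<close>

definition closing :: "(omega1 \<Rightarrow> omega1) \<Rightarrow> omega1 \<Rightarrow> bool" where
  "closing g d \<longleftrightarrow> (\<exists>i. i < d) \<and> (\<forall>i<d. g i < d)"

definition large :: "omega1 set \<Rightarrow> bool" where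
  "large C \<longleftrightarrow> (\<exists>g. \<forall>d. closing g d \<longrightarrow> d \<in> C)"

lemma countable_atMost_omega1 [simp]: "countable {..(x :: omega1)}"
proof -
  have "{..x} = insert x {..<x}" by auto
  then show ?thesis by simp
qed

text \<open>The witness is the least strict upper bound of omega many iterates of \<open>s\<close>,
  where \<open>s x\<close> exceeds \<open>x\<close> and all values of \<open>g\<close> up to
  \<open>x\<close>.\<close>

lemma closing_above:
  obtains d where "i < d" "closing g d"
proof -
  have "\<exists>b. x < b \<and> (\<forall>i\<le>x. g i < b)" for x
  proof -
    have "countable (insert x (g ` {..x}))" by simp
    then obtain b where "\<And>a. a \<in> insert x (g ` {..x}) \<Longrightarrow> a < b"
      using countable_bounded_omega1 by blast
    then show ?thesis by blast
  qed
  then obtain s where s: "\<And>x. x < s x" "\<And>x i. i \<le> x \<Longrightarrow> g i < s x" by metis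
  define a where "a n = (s ^^ n) i" for n
  have a_Suc: "a (Suc n) = s (a n)" for n by (simp add: a_def)
  have "countable (range a)" by simp
  then obtain b where b: "\<And>x. x \<in> range a \<Longrightarrow> x < b"
    using countable_bounded_omega1 by blast
  define d where "d = (LEAST d. \<forall>n. a n < d)"
  have d: "a n < d" for n
    unfolding d_def using LeastI[of "\<lambda>d. \<forall>n. a n < d" b] b by blast
  have "a 0 = i" by (simp add: a_def)
  with d[of 0] have "i < d" by simp
  moreover have "g x < d" if "x < d" for x
  proof -
    have "\<not> (\<forall>n. a n < x)" using not_less_Least[of x "\<lambda>d. \<forall>n. a n < d"] that by (auto simp: d_def)
    then obtain n where "x \<le> a n" by (auto simp: not_less)
    then have "g x < a (Suc n)" using s(2) by (simp add: a_Suc)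
    then show ?thesis using d[of "Suc n"] by (rule less_trans)
  qed
  ultimately show thesis using that[of d] by (auto simp: closing_def)
qed

lemma large_unbounded:
  assumes "large C"
  obtains d where "i < d" "d \<in> C"
  using assms closing_above unfolding large_def by metis

lemma large_mono: "large C \<Longrightarrow> C \<subseteq> D \<Longrightarrow> large D"
  unfolding large_def by blast

text \<open>One function bounds the countably many given ones pointwise, and each of its closure
  points is a closure point of all of them.\<close>

lemma large_INT:
  assumes "countable I" "\<And>x. x \<in> I \<Longrightarrow> large (C x)"
  shows "large (\<Inter>x\<in>I. C x)"
proof -
  have "\<forall>x\<in>I. \<exists>g. \<forall>d. closing g d \<longrightarrow> d \<in> C x"
    using assms(2) by (simp add: large_def)
  from bchoice[OF this] obtain G where G: "\<forall>x\<in>I. \<forall>d. closing (G x) d \<longrightarrow> d \<in> C x" ..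
  have "\<exists>b. \<forall>x\<in>I. G x i < b" for i
  proof -
    have "countable ((\<lambda>x. G x i) ` I)" using assms(1) by simp
    then obtain b where "\<And>a. a \<in> (\<lambda>x. G x i) ` I \<Longrightarrow> a < b"
      using countable_bounded_omega1 by blast
    then show ?thesis by blast
  qed
  then obtain g where g: "\<And>i x. x \<in> I \<Longrightarrow> G x i < g i" by metis
  have "d \<in> C x" if "closing g d" "x \<in> I" for d x
  proof -
    have "closing (G x) d" using that g unfolding closing_def by (meson less_trans)
    then show ?thesis using G that by blast
  qed
  then show ?thesis unfolding large_def by (intro exI[of _ g]) blast
qed

lemma large_Int: "large C \<Longrightarrow> large D \<Longrightarrow> large (C \<inter> D)"
  using large_INT[of "UNIV :: bool set" "\<lambda>b. if b then C else D"] by (simp add: UNIV_bool Int_commute)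

lemma large_atLeast: "large {i..}"
  unfolding large_def
proof (intro exI allI impI)
  fix d assume "closing (\<lambda>_. i) d"
  then show "d \<in> {i..}" by (auto simp: closing_def)
qed

text \<open>The increasing enumeration of a club of type omega1 in \<open>g\<close>; the last clause
  is continuity at limit indices.\<close>

definition cont_seq :: "(omega1 \<Rightarrow> 's :: wellorder) \<Rightarrow> 's \<Rightarrow> bool" where
  "cont_seq a g \<longleftrightarrow> (\<forall>i. a i < g) \<and> (\<forall>i j. i < j \<longrightarrow> a i < a j) \<and> (\<forall>x<g. \<exists>i. x \<le> a i) \<and>
    (\<forall>d x. (\<exists>i. i < d) \<longrightarrow> (\<forall>i<d. \<exists>j<d. i < j) \<longrightarrow> x < a d \<longrightarrow> (\<exists>i<d. x \<le> a i))"

text \<open>Each sequence overtakes the other within a step of some function \<open>g\<close>, so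
  below a closure point of \<open>g\<close> both have the same supremum, and by continuity they are
  equal there.\<close>

lemma cont_seq_agree:
  assumes a: "cont_seq a \<gamma>" and c: "cont_seq c \<gamma>"
  shows "large {d. a d = c d}"
proof -
  have "\<exists>j. i < j \<and> a i < c j \<and> c i < a j" for i
  proof -
    obtain j k where jk: "a i \<le> c j" "c i \<le> a k"
      using a c unfolding cont_seq_def by meson
    have "countable {i, j, k}" by simp
    then obtain l where "\<And>a. a \<in> {i, j, k} \<Longrightarrow> a < l" using countable_bounded_omega1 by blast
    then have l: "i < l" "j < l" "k < l" by simp_all
    then have "c j < c l" "a k < a l" using a c unfolding cont_seq_def by blast+
    with jk l(1) show ?thesis by (meson le_less_trans)
  qed
  then obtain g where g: "\<And>i. i < g i" "\<And>i. a i < c (g i)" "\<And>i. c i < a (g i)" by metis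
  have le: "a' d \<le> c' d" if cl: "closing g d" and ac: "cont_seq a' \<gamma>" "cont_seq c' \<gamma>" "\<And>i. a' i < c' (g i)" for d a' c'
  proof (rule ccontr)
    assume "\<not> a' d \<le> c' d"
    then have "c' d < a' d" by simp
    moreover have "\<forall>i<d. \<exists>j<d. i < j" "\<exists>i. i < d" using cl g(1) by (auto simp: closing_def)
    ultimately obtain i where i: "i < d" "c' d \<le> a' i" using ac(1) unfolding cont_seq_def by blast
    have "c' (g i) < c' d" using cl i(1) ac(2) unfolding closing_def cont_seq_def by blast
    with i(2) ac(3)[of i] show False by (meson le_less_trans less_asym less_trans)
  qed
  have "a d = c d" if "closing g d" for d
    using le[OF that a c g(2)] le[OF that c a g(3)] by (rule antisym)
  then show ?thesis unfolding large_def by (intro exI[of _ g]) blast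
qed

text \<open>A supremum blind to what happens off a club, so that it can be computed from any
  continuous sequence with the same limit.\<close>

definition ess_bound :: "(omega1 \<Rightarrow> 'w :: wellorder) \<Rightarrow> 'w" where
  "ess_bound v = (LEAST z. large {i. v i \<le> z})"

lemma ess_bound_le: "large {i. v i \<le> z} \<Longrightarrow> ess_bound v \<le> z"
  unfolding ess_bound_def by (rule Least_le)

lemma large_le_ess_bound: "large {i. v i \<le> z} \<Longrightarrow> large {i. v i \<le> ess_bound v}"
  unfolding ess_bound_def by (rule LeastI)

lemma ess_bound_cong:
  assumes "large {i. v i = w i}"
  shows "ess_bound v = ess_bound w"
proof -
  have "large {i. v i \<le> z} \<longleftrightarrow> large {i. w i \<le> z}" for z
  proof
    assume "large {i. v i \<le> z}"
    from large_Int[OF this assms] show "large {i. w i \<le> z}" by (rule large_mono) auto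
  next
    assume "large {i. w i \<le> z}"
    from large_Int[OF this assms] show "large {i. v i \<le> z}" by (rule large_mono) auto
  qed
  then show ?thesis by (simp add: ess_bound_def)
qed

text \<open>The characteristic function of \<open>N\<close> in the sense of pcf theory, with strict
  bounds, so that it also exceeds a largest element of \<open>N\<close> below
  \<open>n\<close>.\<close>

definition sup_below :: "'w set \<Rightarrow> 'w \<Rightarrow> 'w :: wellorder" where
  "sup_below N n = (LEAST z. \<forall>x\<in>N. x < n \<longrightarrow> x < z)"

lemma sup_below_le: "sup_below N n \<le> n"
  unfolding sup_below_def by (rule Least_le) blast

lemma less_sup_below: "x \<in> N \<Longrightarrow> x < n \<Longrightarrow> x < sup_below N n"
  unfolding sup_below_def using LeastI[of "\<lambda>z. \<forall>x\<in>N. x < n \<longrightarrow> x < z" n] by blast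

lemma less_sup_belowD:
  assumes "z < sup_below N n"
  obtains x where "x \<in> N" "x < n" "z \<le> x"
proof -
  have "\<not> (\<forall>x\<in>N. x < n \<longrightarrow> x < z)"
    using assms unfolding sup_below_def by (rule not_less_Least)
  with that show thesis by (auto simp: not_less)
qed

lemma sup_below_less:
  assumes "big n" "countable N"
  shows "sup_below N n < n"
proof -
  have c: "countable {x \<in> N. x < n}" using assms(2) by simp
  obtain b where "b < n" "\<And>x. x \<in> {x \<in> N. x < n} \<Longrightarrow> x < b"
    using big_countable_bound[OF assms(1) c] by blast
  then have "sup_below N n \<le> b" unfolding sup_below_def by (intro Least_le) auto
  with \<open>b < n\<close> show ?thesis by simp
qed

text \<open>Lengths and scales are chosen once for each \<open>Y\<close>, independently of any
  chain, so that codes need only list positions in them.\<close>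

definition scale_len :: "'w :: wellorder set \<Rightarrow> ('w \<Rightarrow> 'w) wo" where
  "scale_len Y = (SOME l. \<exists>f. is_scale Y l f)"

definition the_scale :: "'w :: wellorder set \<Rightarrow> ('w \<Rightarrow> 'w) wo \<Rightarrow> 'w \<Rightarrow> 'w" where
  "the_scale Y = (SOME f. is_scale Y (scale_len Y) f)"

lemma is_scale_the_scale:
  assumes "countable Y" "\<And>n. n \<in> Y \<Longrightarrow> big n" "Y \<noteq> {}"
  shows "is_scale Y (scale_len Y) (the_scale Y)"
proof -
  have "\<exists>f. is_scale Y (scale_len Y) f"
    unfolding scale_len_def by (rule someI_ex[OF scale_exists[OF assms]])
  then show ?thesis unfolding the_scale_def by (rule someI_ex)
qed

definition some_cont_seq :: "'s :: wellorder \<Rightarrow> omega1 \<Rightarrow> 's" where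
  "some_cont_seq g = (SOME c. cont_seq c g)"

definition deficit :: "'w :: wellorder set \<Rightarrow> ('w \<Rightarrow> 'w) wo \<Rightarrow> 'w set \<Rightarrow> 'w set" where
  "deficit Y x p = {n \<in> Y. the_scale Y x n < sup_below p n}"

text \<open>A list codes a function that agrees, off a smaller and smaller set, with canonical bounds of
  initial segments of scales. All data come from sets of size \<open>cf[\<kappa>]\<^sup>\<omega>\<close>.\<close>

primrec decode :: "(('w \<Rightarrow> 'w) wo \<times> 'w :: wellorder set \<times> ('w \<Rightarrow> 'w) wo) list \<Rightarrow> 'w set \<Rightarrow> 'w \<Rightarrow> 'w" where
  "decode [] Y = (\<lambda>n. n)"
| "decode (a # l) Y = (\<lambda>n. let Y' = deficit Y (snd (snd a)) (fst (snd a)) in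
     if n \<in> Y' then decode l Y' n else ess_bound (\<lambda>i. the_scale Y (some_cont_seq (fst a) i) n))"

definition first_bound :: "'w :: wellorder set \<Rightarrow> 'w set \<Rightarrow> ('w \<Rightarrow> 'w) wo" where
  "first_bound Y p = (LEAST x. small (scale_len Y) (deficit Y x p))"

text \<open>The sets in \<open>YY i\<close> are those whose scales are consulted by stage
  \<open>i\<close>, and \<open>idx i Y\<close> is a position in the scale of \<open>Y\<close>. The
  least strict upper bound makes \<open>idx\<close> continuous in \<open>i\<close>, and exceeding
  \<open>first_bound\<close> makes deficits against earlier stages small. The guard
  \<open>< n\<close> in \<open>the_scale_in\<close> excludes junk values of a scale read beyond its
  length.\<close>

locale scale_chain =
  fixes B :: "omega1 \<Rightarrow> 'w :: wellorder set" and YY :: "omega1 \<Rightarrow> 'w set set"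
    and idx :: "omega1 \<Rightarrow> 'w set \<Rightarrow> ('w \<Rightarrow> 'w) wo"
  assumes B_mono: "\<And>i j. j < i \<Longrightarrow> B j \<subseteq> B i" and B_countable: "\<And>i. countable (B i)"
    and YY_mono: "\<And>i j. j < i \<Longrightarrow> YY j \<subseteq> YY i"
    and YY_big: "\<And>i Y. Y \<in> YY i \<Longrightarrow> countable Y" "\<And>i Y n. Y \<in> YY i \<Longrightarrow> n \<in> Y \<Longrightarrow> big n"
    and YY_step: "\<And>i j k Y. j < i \<Longrightarrow> k < i \<Longrightarrow> Y \<in> YY j \<Longrightarrow> deficit Y (idx j Y) (B k) \<in> YY i"
    and idx: "\<And>i Y. idx i Y = (LEAST x. \<forall>j<i. idx j Y < x \<and> first_bound Y (B j) < x)"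
    and the_scale_in: "\<And>i Y n. Y \<in> YY i \<Longrightarrow> n \<in> Y \<Longrightarrow> the_scale Y (idx i Y) n < n \<Longrightarrow> the_scale Y (idx i Y) n \<in> B i"
begin

lemma YY_mono': "j \<le> i \<Longrightarrow> YY j \<subseteq> YY i" using YY_mono[of j i] by (cases "j = i") auto

lemma B_mono': "j \<le> i \<Longrightarrow> B j \<subseteq> B i" using B_mono[of j i] by (cases "j = i") auto

definition N where "N = (\<Union>i. B i)"

text \<open>The length of the scale has cofinality greater than omega1, so neither the recursion for
  \<open>idx\<close> nor the supremum of its omega1 many values leaves the scale.\<close>

lemma idx_cont_seq:
  assumes Y: "Y \<in> YY i0" "Y \<noteq> {}"
  obtains \<gamma> where "\<gamma> < scale_len Y" "cont_seq (\<lambda>i. idx i Y) \<gamma>" "\<And>i. idx i Y < scale_len Y"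
    "\<And>i j. j < i \<Longrightarrow> small (scale_len Y) (deficit Y (idx i Y) (B j))"
proof -
  note big = YY_big[OF Y(1)]
  have scale: "is_scale Y (scale_len Y) (the_scale Y)" using is_scale_the_scale Y(2) big by blast
  then have om: "\<exists>x<scale_len Y. \<forall>i. m i < x" if "\<And>i. m i < scale_len Y" for m :: "omega1 \<Rightarrow> _"
    by (rule is_scaleD(4)) (intro allI that)
  have inf: "infinite {..<scale_len Y}" using is_scale_infinite[OF scale] big by blast
  have first_bound: "first_bound Y (B j) < scale_len Y" "small (scale_len Y) (deficit Y (first_bound Y (B j)) (B j))" for j
  proof -
    have "sup_below (B j) \<in> below Y" using sup_below_less big B_countable by (auto intro!: belowI)
    then obtain x where x: "x < scale_len Y" "\<forall>n\<in>Y. sup_below (B j) n \<le> the_scale Y x n"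
      using is_scaleD(3)[OF scale] by blast
    then have e: "deficit Y x (B j) = {}" by (auto simp: deficit_def not_less)
    have "|{\<lambda>n :: 'w. n}| <o |{..<scale_len Y}|"
      using inf by (simp flip: not_card_le_iff) (metis card_of_ordLeq_finite finite.emptyI finite_insert)
    then have sm: "small (scale_len Y) (deficit Y x (B j))"
      unfolding e small_def by (intro exI[of _ "{\<lambda>n. n}"]) (auto simp: dominating_def below_def)
    show "first_bound Y (B j) < scale_len Y" unfolding first_bound_def using Least_le[of _ x] sm x(1) by (meson le_less_trans)
    show "small (scale_len Y) (deficit Y (first_bound Y (B j)) (B j))" unfolding first_bound_def using sm by (rule LeastI)
  qed
  have idx_less: "idx i Y < scale_len Y \<and> (\<forall>j<i. idx j Y < idx i Y \<and> first_bound Y (B j) < idx i Y)" for i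
  proof (induction i rule: less_induct)
    case (less i)
    obtain z where z: "z < scale_len Y" using om[of "\<lambda>i. first_bound Y (B i)"] first_bound by blast
    \<comment> \<open>The value \<open>z\<close> fills the indices from \<open>i\<close> on, since
      \<open>om\<close> takes sequences indexed by all of omega1.\<close>
    have "(if j < i then max (idx j Y) (first_bound Y (B j)) else z) < scale_len Y" for j using less first_bound z by auto
    then obtain x where x: "x < scale_len Y" "\<And>j. (if j < i then max (idx j Y) (first_bound Y (B j)) else z) < x"
      using om[of "\<lambda>j. if j < i then max (idx j Y) (first_bound Y (B j)) else z"] by blast
    have *: "\<forall>j<i. idx j Y < x \<and> first_bound Y (B j) < x"
    proof (intro allI impI)
      fix j assume "j < i"
      with x(2)[of j] show "idx j Y < x \<and> first_bound Y (B j) < x" by simp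
    qed
    have "idx i Y \<le> x" unfolding idx[of i] by (rule Least_le) (rule *)
    moreover have "\<forall>j<i. idx j Y < idx i Y \<and> first_bound Y (B j) < idx i Y"
      unfolding idx[of i] by (rule LeastI[of "\<lambda>x. \<forall>j<i. idx j Y < x \<and> first_bound Y (B j) < x", OF *])
    ultimately show ?case using x(1) by simp
  qed
  then obtain x where x: "x < scale_len Y" "\<forall>i. idx i Y < x" using om[of "\<lambda>i. idx i Y"] by blast
  define \<gamma> where "\<gamma> = (LEAST x. \<forall>i. idx i Y < x)"
  show thesis
  proof (rule that[of \<gamma>])
    show "\<gamma> < scale_len Y" unfolding \<gamma>_def using Least_le[of "\<lambda>x. \<forall>i. idx i Y < x" x] x by simp
    show "idx i Y < scale_len Y" for i using idx_less by blast
    show "cont_seq (\<lambda>i. idx i Y) \<gamma>" unfolding cont_seq_def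
    proof (intro conjI allI impI)
      show "idx i Y < \<gamma>" for i
        unfolding \<gamma>_def using LeastI[of "\<lambda>x. \<forall>i. idx i Y < x" x] x by blast
      show "idx i Y < idx j Y" if "i < j" for i j using idx_less that by blast
      show "\<exists>i. x \<le> idx i Y" if "x < \<gamma>" for x
        using not_less_Least[of x "\<lambda>x. \<forall>i. idx i Y < x"] that unfolding \<gamma>_def by (auto simp: not_less)
      fix d x assume lim: "\<forall>i<d. \<exists>j<d. i < j" and "x < idx d Y"
      then have "\<not> (\<forall>j<d. idx j Y < x \<and> first_bound Y (B j) < x)"
        using not_less_Least[of x "\<lambda>x. \<forall>j<d. idx j Y < x \<and> first_bound Y (B j) < x"] idx[of d] by auto
      then obtain j where j: "j < d" "x \<le> idx j Y \<or> x \<le> first_bound Y (B j)" by (auto simp: not_less)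
      then obtain k where "k < d" "j < k" using lim by blast
      then have "x \<le> idx k Y" using j(2) idx_less[of k] by (meson less_imp_le order_trans)
      then show "\<exists>i<d. x \<le> idx i Y" using \<open>k < d\<close> by blast
    qed
    fix i j :: omega1 assume "j < i"
    then have "idx i Y < scale_len Y" "first_bound Y (B j) < idx i Y" using idx_less[of i] by blast+
    \<comment> \<open>Beyond \<open>first_bound\<close> the scale can fall back only on a small set,
      which is added to the small deficit found there.\<close>
    then have "small (scale_len Y) {n \<in> Y. the_scale Y (idx i Y) n < the_scale Y (first_bound Y (B j)) n}"
      by (rule is_scaleD(2)[OF scale])
    then have "small (scale_len Y) ({n \<in> Y. the_scale Y (idx i Y) n < the_scale Y (first_bound Y (B j)) n} \<union> deficit Y (first_bound Y (B j)) (B j))"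
      using small_Un[OF inf] first_bound(2) by blast
    then show "small (scale_len Y) (deficit Y (idx i Y) (B j))"
      by (rule small_mono) (use big in \<open>auto simp: deficit_def not_less intro: le_less_trans\<close>)
  qed
qed

text \<open>The canonical bound \<open>h\<close> at the supremum of the indices \<open>idx i Y\<close> lies below \<open>sup_below N\<close> everywhere
  and above cofinally many of the functions \<open>the_scale Y (idx i Y)\<close>. Hence it is correct off some
  \<open>deficit Y (idx i Y) (B j)\<close>, a small set which again belongs to the chain, and one recurses on it.\<close>

lemma decode_eq:
  assumes "\<And>i Y. Y \<in> YY i \<Longrightarrow> Y \<noteq> {} \<Longrightarrow> scale_len Y \<le> \<Lambda>" and P: "\<And>i. B i \<in> P"
    and "Y \<in> YY i0"
  shows "\<exists>l\<in>lists ({..<\<Lambda>} \<times> P \<times> {..<\<Lambda>}). \<forall>n\<in>Y. decode l Y n = sup_below N n"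
  using \<open>Y \<in> YY i0\<close>
proof (induction "scale_len Y" arbitrary: Y i0 rule: less_induct)
  case less
  note Y = \<open>Y \<in> YY i0\<close>
  show ?case
  proof (cases "Y = {}")
    case True
    then show ?thesis by (intro bexI[of _ "[]"]) auto
  next
    case ne: False
    note big = YY_big[OF Y]
    have scale: "is_scale Y (scale_len Y) (the_scale Y)" using is_scale_the_scale ne big by blast
    obtain \<gamma> where \<gamma>: "\<gamma> < scale_len Y" "cont_seq (\<lambda>i. idx i Y) \<gamma>" "\<And>i. idx i Y < scale_len Y"
      "\<And>i j. j < i \<Longrightarrow> small (scale_len Y) (deficit Y (idx i Y) (B j))"
      using idx_cont_seq[OF Y ne] by blast
    have "cont_seq (some_cont_seq \<gamma>) \<gamma>" 
      unfolding some_cont_seq_def by (rule someI[of "\<lambda>c. cont_seq c \<gamma>", OF \<gamma>(2)])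
    from cont_seq_agree[OF this \<gamma>(2)] have agree: "large {i. some_cont_seq \<gamma> i = idx i Y}" .
    \<comment> \<open>\<open>h\<close> is defined from the actual positions, but can be decoded from
      \<open>\<gamma>\<close> alone because the canonical sequence agrees with them on a
      club.\<close>
    define h where "h n = ess_bound (\<lambda>i. the_scale Y (idx i Y) n)" for n
    have h: "ess_bound (\<lambda>i. the_scale Y (some_cont_seq \<gamma> i) n) = h n" for n
      unfolding h_def by (rule ess_bound_cong, rule large_mono[OF agree]) auto
    have in_N: "the_scale Y (idx i Y) n < sup_below N n" if "i0 \<le> i" "n \<in> Y" for i n
    proof -
      have "the_scale Y (idx i Y) n < n"
        using belowD[OF is_scaleD(1)[OF scale \<gamma>(3)] that(2)] .
      moreover have "the_scale Y (idx i Y) n \<in> N"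
        unfolding N_def using the_scale_in[of Y i n] YY_mono'[OF that(1)] Y that(2) calculation by blast
      ultimately show ?thesis by (intro less_sup_below)
    qed
    have lrg: "large {i. the_scale Y (idx i Y) n \<le> sup_below N n}" if "n \<in> Y" for n
      by (rule large_mono[OF large_atLeast[of i0]]) (use in_N that in \<open>auto intro: less_imp_le\<close>)
    have h_le: "h n \<le> sup_below N n" if "n \<in> Y" for n
      unfolding h_def using lrg[OF that] by (rule ess_bound_le)
    \<comment> \<open>Countability of \<open>Y\<close> gives one club for all coordinates.\<close>
    have "large (\<Inter>n\<in>Y. {i. the_scale Y (idx i Y) n \<le> h n})"
      unfolding h_def using big lrg by (intro large_INT large_le_ess_bound) auto
    note lrg_h = this
    have "\<forall>n\<in>Y. \<exists>j. h n < sup_below N n \<longrightarrow> h n < sup_below (B j) n"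
    proof
      fix n assume "n \<in> Y"
      show "\<exists>j. h n < sup_below N n \<longrightarrow> h n < sup_below (B j) n"
      proof (cases "h n < sup_below N n")
        case True
        then obtain x where x: "x \<in> N" "x < n" "h n \<le> x" by (rule less_sup_belowD)
        then obtain j where "x \<in> B j" unfolding N_def by blast
        then have "h n < sup_below (B j) n" using less_sup_below[of x "B j" n] x by simp
        then show ?thesis by blast
      qed simp
    qed
    from bchoice[OF this] obtain J where J: "\<forall>n\<in>Y. h n < sup_below N n \<longrightarrow> h n < sup_below (B (J n)) n" ..
    \<comment> \<open>A single stage \<open>j\<close>, beyond countably many witnesses, detects
      every coordinate where \<open>h\<close> is too small.\<close>
    have "countable (J ` Y)" using big by simp
    then obtain j where j: "\<And>i. i \<in> J ` Y \<Longrightarrow> i < j" using countable_bounded_omega1 by blast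
    have sup_below_mono: "sup_below (B i) n \<le> sup_below (B k) n" if "i \<le> k" for i k n
    proof (rule ccontr)
      assume "\<not> ?thesis"
      then have "sup_below (B k) n < sup_below (B i) n" by simp
      then obtain x where "x \<in> B i" "x < n" "sup_below (B k) n \<le> x" by (rule less_sup_belowD)
      then show False using less_sup_below[of x "B k" n] B_mono'[OF that] by (auto simp: not_less[symmetric])
    qed
    have j': "h n < sup_below (B j) n" if "n \<in> Y" "h n < sup_below N n" for n
      using J that j[of "J n"] sup_below_mono[of "J n" j n] by (auto intro: less_le_trans)
    obtain i where i: "max i0 j < i" "i \<in> (\<Inter>n\<in>Y. {i. the_scale Y (idx i Y) n \<le> h n})"
      using large_unbounded[OF lrg_h] by blast
    define Y' where "Y' = deficit Y (idx i Y) (B j)"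
    have i': "j < i" "i0 \<le> i" using i(1) by auto
    \<comment> \<open>The deficit formed at \<open>i\<close> and \<open>j\<close> enters the chain
      only at a stage above both.\<close>
    obtain k where k: "i < k" using closing_above by blast
    have YY': "Y' \<in> YY k" unfolding Y'_def
      using YY_step[OF k less_trans[OF i'(1) k]] YY_mono'[OF i'(2)] Y by blast
    have sm: "small (scale_len Y) Y'" unfolding Y'_def using \<gamma>(4) i' by blast
    have "\<exists>l\<in>lists ({..<\<Lambda>} \<times> P \<times> {..<\<Lambda>}). \<forall>n\<in>Y'. decode l Y' n = sup_below N n"
    proof (cases "Y' = {}")
      case True
      then show ?thesis by (intro bexI[of _ "[]"]) auto
    next
      case False
      have "is_scale Y' (scale_len Y') (the_scale Y')" using is_scale_the_scale False YY_big[OF YY'] by blast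
      from small_scale_less[OF scale this sm] less(1) YY' show ?thesis by blast
    qed
    then obtain l where l: "l \<in> lists ({..<\<Lambda>} \<times> P \<times> {..<\<Lambda>})" "\<forall>n\<in>Y'. decode l Y' n = sup_below N n" by blast
    show ?thesis
    proof (intro bexI ballI)
      have "scale_len Y \<le> \<Lambda>" using assms(1)[OF Y ne] .
      then have "\<gamma> < \<Lambda>" "idx i Y < \<Lambda>" using \<gamma>(1) \<gamma>(3)[of i] by (auto intro: less_le_trans)
      then show "(\<gamma>, B j, idx i Y) # l \<in> lists ({..<\<Lambda>} \<times> P \<times> {..<\<Lambda>})" using l(1) P by auto
      fix n assume n: "n \<in> Y"
      show "decode ((\<gamma>, B j, idx i Y) # l) Y n = sup_below N n"
      proof (cases "n \<in> Y'")
        case True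
        then show ?thesis using l(2) by (simp add: Y'_def)
      next
        case False
        \<comment> \<open>Off the deficit \<open>h\<close> reaches \<open>sup_below (B j)\<close>,
          which by the choice of \<open>j\<close> excludes that \<open>h\<close> is too
          small.\<close>
        then have "sup_below (B j) n \<le> the_scale Y (idx i Y) n" using n by (auto simp: Y'_def deficit_def not_less)
        also have "\<dots> \<le> h n" using i(2) n by blast
        finally have "\<not> h n < sup_below N n" using j'[OF n] by (auto simp: not_less[symmetric])
        then have "h n = sup_below N n" using h_le[OF n] by simp
        then show ?thesis using False h by (simp add: Y'_def)
      qed
    qed
  qed
qed

end

section \<open>Stationary families of countable sets\<close>

text \<open>When \<open>h\<close> is \<open>sup_below N\<close>, \<open>e z\<close> is cofinal in \<open>z\<close> and \<open>B\<close> covers the \<open>d\<close>-th stage of the chain, this is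
  the stage: each of its members is reached from \<open>t\<close> by a finite decreasing walk.\<close>

inductive_set reach :: "('w :: wellorder \<Rightarrow> omega1 \<Rightarrow> 'w) \<Rightarrow> ('w \<Rightarrow> 'w) \<Rightarrow> 'w set \<Rightarrow> omega1 \<Rightarrow> 'w \<Rightarrow> 'w set"
  for e h B d t where
  root: "t \<in> reach e h B d t"
| step: "y \<in> reach e h B d t \<Longrightarrow> i < d \<Longrightarrow> x \<in> B \<Longrightarrow> x < y \<Longrightarrow> e (h y) i \<le> x \<Longrightarrow>
    (\<And>z. z \<in> B \<Longrightarrow> e (h y) i \<le> z \<Longrightarrow> x \<le> z) \<Longrightarrow> x \<in> reach e h B d t"

text \<open>No monotonicity is required, so countable cofinality is included. The choice is
  meaningful only for nonzero \<open>z\<close> of cofinality at most omega1.\<close>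

definition omega1_cofinal :: "'w :: wellorder \<Rightarrow> omega1 \<Rightarrow> 'w" where
  "omega1_cofinal z = (SOME m. (\<forall>i. m i < z) \<and> (\<forall>x<z. \<exists>i. x \<le> m i))"

lemma omega1_cofinal:
  assumes "\<And>i :: omega1. m i < z" "\<And>x. x < z \<Longrightarrow> \<exists>i. x \<le> m i"
  shows "omega1_cofinal z i < z" "x < z \<Longrightarrow> \<exists>i. x \<le> omega1_cofinal z i"
proof -
  have "\<exists>m :: omega1 \<Rightarrow> _. (\<forall>i. m i < z) \<and> (\<forall>x<z. \<exists>i. x \<le> m i)" using assms by blast
  from someI_ex[OF this] show "omega1_cofinal z i < z" "x < z \<Longrightarrow> \<exists>i. x \<le> omega1_cofinal z i"
    unfolding omega1_cofinal_def by blast+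
qed

lemma omega1_cofinal_not_big:
  assumes "\<not> big z" "b < z"
  shows "omega1_cofinal z i < z" "x < z \<Longrightarrow> \<exists>i. x \<le> omega1_cofinal z i"
proof -
  obtain m :: "omega1 \<Rightarrow> _" where "\<forall>i. m i < z" "\<forall>b<z. \<exists>i. \<not> m i < b"
    using assms unfolding big_def by blast
  then show "omega1_cofinal z i < z" "x < z \<Longrightarrow> \<exists>i. x \<le> omega1_cofinal z i"
    using omega1_cofinal[of m z] by (auto simp: not_less)
qed

lemma card_of_Times_le:
  "infinite C \<Longrightarrow> |A| \<le>o |C| \<Longrightarrow> |B| \<le>o |C| \<Longrightarrow> |A \<times> B| \<le>o |C|"
  by (intro card_of_Sigma_ordLeq_infinite) auto

lemma card_lists_le:
  assumes inf: "infinite C" and A: "|A| \<le>o |C|"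
  shows "|lists A| \<le>o |C|"
proof -
  have "|{l \<in> lists A. length l = n}| \<le>o |C|" for n
  proof (induction n)
    case 0
    have "{l \<in> lists A. length l = 0} = {[]}" by auto
    moreover have "|{[] :: 'b list}| \<le>o |C|" using inf
      by (metis card_of_singl_ordLeq finite.emptyI)
    ultimately show ?case by metis
  next
    case (Suc n)
    have "{l \<in> lists A. length l = Suc n} \<subseteq> (\<lambda>(a, l). a # l) ` (A \<times> {l \<in> lists A. length l = n})"
    proof
      fix l assume "l \<in> {l \<in> lists A. length l = Suc n}"
      then show "l \<in> (\<lambda>(a, l). a # l) ` (A \<times> {l \<in> lists A. length l = n})"
        by (cases l) auto
    qed
    then have "|{l \<in> lists A. length l = Suc n}| \<le>o |(\<lambda>(a, l). a # l) ` (A \<times> {l \<in> lists A. length l = n})|"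
      by (rule card_of_mono1)
    also have "|(\<lambda>(a, l). a # l) ` (A \<times> {l \<in> lists A. length l = n})| \<le>o |A \<times> {l \<in> lists A. length l = n}|"
      by (rule card_of_image)
    also have "|A \<times> {l \<in> lists A. length l = n}| \<le>o |C|"
      using inf A Suc by (intro card_of_Sigma_ordLeq_infinite) auto
    finally show ?case .
  qed
  moreover have "|UNIV :: nat set| \<le>o |C|" using inf infinite_iff_card_of_nat by blast
  ultimately have "|\<Union>n\<in>UNIV. {l \<in> lists A. length l = n}| \<le>o |C|"
    using inf by (intro card_of_UNION_ordLeq_infinite) auto
  moreover have "(\<Union>n\<in>UNIV. {l \<in> lists A. length l = n}) = lists A" by auto
  ultimately show ?thesis by simp
qed

text \<open>\<open>t\<close> is the root of the walks and \<open>c\<close> the function under which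
  a stage is to be closed. \<open>cofinal_in\<close> settles the ordinals that are not
  \<open>big\<close>; \<open>big_in\<close> hands the others to \<open>decode_eq\<close>.\<close>

locale closed_chain = scale_chain +
  fixes t :: 'a and c :: "'a \<Rightarrow> 'a set"
  assumes B_le: "\<And>i x. x \<in> B i \<Longrightarrow> x \<le> t" and root_in: "\<And>i. t \<in> B i"
    and c_in: "\<And>i j x. j < i \<Longrightarrow> x \<in> B j \<Longrightarrow> c x \<subseteq> B i"
    and cofinal_in: "\<And>i j k x. j < i \<Longrightarrow> k < i \<Longrightarrow> x \<in> B j \<Longrightarrow> \<not> big x \<Longrightarrow>
      omega1_cofinal x k < x \<Longrightarrow> omega1_cofinal x k \<in> B i"
    and big_in: "\<And>i j. j < i \<Longrightarrow> {n \<in> B j. big n} \<in> YY i"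
begin

text \<open>\<open>N\<close> contains the whole chosen cofinal sequence of such an
  \<open>x\<close>.\<close>

lemma sup_below_not_big:
  assumes "x \<in> N" "\<not> big x"
  shows "sup_below N x = x"
proof (rule ccontr)
  assume "sup_below N x \<noteq> x"
  then have less: "sup_below N x < x" using sup_below_le[of N x] by simp
  then obtain k where k: "sup_below N x \<le> omega1_cofinal x k" using omega1_cofinal_not_big(2)[OF assms(2)] by blast
  have kx: "omega1_cofinal x k < x" using omega1_cofinal_not_big(1)[OF assms(2) less] .
  obtain j where j: "x \<in> B j" using assms(1) by (auto simp: N_def)
  obtain i where "max j k < i" using closing_above by blast
  then have "omega1_cofinal x k \<in> B i" using cofinal_in[of j i k x] j kx assms(2) by auto
  then have "omega1_cofinal x k \<in> N" by (auto simp: N_def)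
  then have "omega1_cofinal x k < sup_below N x" using kx by (rule less_sup_below)
  with k show False by simp
qed

lemma card_N: "|N| \<le>o |UNIV :: omega1 set|"
proof -
  have "infinite (UNIV :: omega1 set)" using uncountable_UNIV_omega1 countable_finite by blast
  then show ?thesis unfolding N_def
    using countable_le_omega1[OF B_countable] by (intro card_of_UNION_ordLeq_infinite) (auto intro: card_of_mono1)
qed

text \<open>\<open>N\<close> has at most omega1 elements, so \<open>sup_below N y\<close> has
  cofinality at most omega1 even if \<open>y\<close> is \<open>big\<close>. The sequence chosen for
  it depends only on this ordinal, not on \<open>N\<close>.\<close>

lemma cofinal_sup_below:
  assumes "x \<in> N" "x < y"
  shows "omega1_cofinal (sup_below N y) i < sup_below N y" "z < sup_below N y \<Longrightarrow> \<exists>i. z \<le> omega1_cofinal (sup_below N y) i"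
proof -
  have "|{x \<in> N. x < y}| \<le>o |N|" by (rule card_of_mono1) auto
  then have "|{x \<in> N. x < y}| \<le>o |UNIV :: omega1 set|" using card_N by (rule ordLeq_transitive)
  then obtain m :: "omega1 \<Rightarrow> _" where m: "range m = {x \<in> N. x < y}"
    using surj_omega1[of "{x \<in> N. x < y}"] assms by blast
  have 1: "m i < sup_below N y" for i
  proof -
    have "m i \<in> {x \<in> N. x < y}" using m by blast
    then show ?thesis by (auto intro: less_sup_below)
  qed
  have 2: "\<exists>i. z \<le> m i" if z: "z < sup_below N y" for z
  proof -
    obtain x where "x \<in> N" "x < y" "z \<le> x" using z by (rule less_sup_belowD)
    moreover from this obtain i where "x = m i" using m by blast
    ultimately show ?thesis by blast
  qed
  show "omega1_cofinal (sup_below N y) i < sup_below N y" "z < sup_below N y \<Longrightarrow> \<exists>i. z \<le> omega1_cofinal (sup_below N y) i"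
    using omega1_cofinal[of m "sup_below N y", OF 1 2] by blast+
qed

definition stage where "stage d = (\<Union>i\<in>{..<d}. B i)"

definition next_in where "next_in y i = (LEAST x. x \<in> N \<and> omega1_cofinal (sup_below N y) i \<le> x)"

text \<open>A Loewenheim-Skolem argument: \<open>rk\<close> and \<open>ix\<close> tell where
  required elements and indices first appear, \<open>g\<close> bounds them, and \<open>d\<close> is
  a closure point of \<open>g\<close>.\<close>

lemma closed_stage_exists:
  obtains d where "\<And>x. x \<in> stage d \<Longrightarrow> c x \<subseteq> stage d" "t \<in> stage d"
    "\<And>y i x. y \<in> stage d \<Longrightarrow> i < d \<Longrightarrow> x \<in> N \<Longrightarrow> omega1_cofinal (sup_below N y) i \<le> x \<Longrightarrow> next_in y i \<in> stage d"
    "\<And>y x. y \<in> stage d \<Longrightarrow> x \<in> stage d \<Longrightarrow> x < y \<Longrightarrow> \<exists>i<d. x \<le> omega1_cofinal (sup_below N y) i"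
proof -
  define rk where "rk x = (LEAST i. x \<in> B i)" for x
  have rk: "x \<in> B (rk x)" if "x \<in> N" for x
    using that unfolding N_def rk_def by (auto intro: LeastI)
  define ix where "ix p = (LEAST i. snd p \<le> omega1_cofinal (sup_below N (fst p)) i)" for p
  have "\<exists>b. j < b \<and> (\<forall>y\<in>B j. \<forall>i\<le>j. rk (next_in y i) < b) \<and> (\<forall>y\<in>B j. \<forall>x\<in>B j. ix (y, x) < b)" for j
  proof -
    have "countable (insert j ((\<lambda>(y, i). rk (next_in y i)) ` (B j \<times> {..j}) \<union> ix ` (B j \<times> B j)))"
      using B_countable by auto
    then obtain b where b: "\<And>a. a \<in> insert j ((\<lambda>(y, i). rk (next_in y i)) ` (B j \<times> {..j}) \<union> ix ` (B j \<times> B j)) \<Longrightarrow> a < b"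
      using countable_bounded_omega1 by blast
    show ?thesis
    proof (intro exI[of _ b] conjI ballI allI impI)
      show "j < b" using b by blast
      show "rk (next_in y i) < b" if "y \<in> B j" "i \<le> j" for y i
        using that by (intro b insertI2 UnI1 image_eqI[of _ _ "(y, i)"]) auto
      show "ix (y, x) < b" if "y \<in> B j" "x \<in> B j" for y x
        using that by (intro b) auto
    qed
  qed
  from choice[OF allI[OF this]] obtain g where g: "\<forall>j. j < g j \<and> (\<forall>y\<in>B j. \<forall>i\<le>j. rk (next_in y i) < g j)
    \<and> (\<forall>y\<in>B j. \<forall>x\<in>B j. ix (y, x) < g j)" ..
  obtain d where d: "closing g d" using closing_above by blast
  have gd: "g j < d" if "j < d" for j using d that by (auto simp: closing_def)
  show thesis
  proof (rule that[of d])
    show "c x \<subseteq> stage d" if xd: "x \<in> stage d" for x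
    proof -
      obtain j where j: "j < d" "x \<in> B j" using xd by (auto simp: stage_def)
      then have "c x \<subseteq> B (g j)" using c_in[of j "g j" x] g by blast
      then show ?thesis using gd[OF j(1)] by (auto simp: stage_def)
    qed
    show "t \<in> stage d" using root_in d by (auto simp: stage_def closing_def)
    show "next_in y i \<in> stage d"
      if yd: "y \<in> stage d" and i: "i < d" and x: "x \<in> N" "omega1_cofinal (sup_below N y) i \<le> x" for y i x
    proof -
      obtain j where j: "j < d" "y \<in> B j" using yd by (auto simp: stage_def)
      define k where "k = max i j"
      have k: "k < d" "i \<le> k" "y \<in> B k" using i j B_mono'[of j k] by (auto simp: k_def)
      have "next_in y i \<in> N" unfolding next_in_def using x
        by (metis (mono_tags, lifting) LeastI)
      then have "next_in y i \<in> B (rk (next_in y i))" by (rule rk)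
      moreover have "rk (next_in y i) < g k" using g k by blast
      ultimately show ?thesis using gd[OF k(1)] unfolding stage_def by (meson UN_I lessThan_iff less_trans)
    qed
    show "\<exists>i<d. x \<le> omega1_cofinal (sup_below N y) i" if yd: "y \<in> stage d" and xd: "x \<in> stage d" and xy: "x < y" for y x
    proof -
      obtain j j' where j: "j < d" "y \<in> B j" "j' < d" "x \<in> B j'" using yd xd by (auto simp: stage_def)
      define k where "k = max j j'"
      have k: "k < d" "x \<in> B k" "y \<in> B k" using j B_mono'[of j k] B_mono'[of j' k] by (auto simp: k_def)
      have "x \<in> N" using k by (auto simp: N_def)
      have "\<exists>i. x \<le> omega1_cofinal (sup_below N y) i"
        using cofinal_sup_below(2)[OF \<open>x \<in> N\<close> xy] less_sup_below[OF \<open>x \<in> N\<close> xy] by blast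
      then have "x \<le> omega1_cofinal (sup_below N y) (ix (y, x))"
        unfolding ix_def fst_conv snd_conv by (rule LeastI_ex)
      moreover have "ix (y, x) < d" using g k gd by (meson less_trans)
      ultimately show ?thesis by blast
    qed
  qed
qed

lemma reach_eq_stage:
  assumes hB: "\<And>n. n \<in> B d \<Longrightarrow> h n = sup_below N n" and "t \<in> stage d"
    and nx: "\<And>y i x. y \<in> stage d \<Longrightarrow> i < d \<Longrightarrow> x \<in> N \<Longrightarrow> omega1_cofinal (sup_below N y) i \<le> x \<Longrightarrow> next_in y i \<in> stage d"
    and cf: "\<And>y x. y \<in> stage d \<Longrightarrow> x \<in> stage d \<Longrightarrow> x < y \<Longrightarrow> \<exists>i<d. x \<le> omega1_cofinal (sup_below N y) i"
  shows "reach omega1_cofinal h (B d) d t = stage d"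
proof
  have stageB: "stage d \<subseteq> B d" using B_mono by (auto simp: stage_def)
  have BN: "B d \<subseteq> N" by (auto simp: N_def)
  show "reach omega1_cofinal h (B d) d t \<subseteq> stage d"
  proof
    fix x assume "x \<in> reach omega1_cofinal h (B d) d t"
    then show "x \<in> stage d"
    proof induction
      case root
      show ?case by fact
    next
      case (step y i x)
      have hy: "h y = sup_below N y" using hB step stageB by blast
      have x: "x \<in> N" "omega1_cofinal (sup_below N y) i \<le> x" using step hy BN by auto
      have n: "next_in y i \<in> stage d" using nx step x by blast
      have n': "omega1_cofinal (sup_below N y) i \<le> next_in y i" "next_in y i \<le> x"
        unfolding next_in_def using LeastI[of "\<lambda>x. x \<in> N \<and> omega1_cofinal (sup_below N y) i \<le> x" x] x
        by (auto intro: Least_le)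
      \<comment> \<open>Minimality in \<open>B d\<close> and minimality in \<open>N\<close> select
        the same element, since \<open>next_in y i\<close> lies in both.\<close>
      have "x \<le> next_in y i" using step hy n n'(1) stageB by auto
      with n'(2) n show ?case by simp
    qed
  qed
  show "stage d \<subseteq> reach omega1_cofinal h (B d) d t"
  proof
    fix x assume x: "x \<in> stage d"
    \<comment> \<open>The walk towards \<open>x\<close>: each step goes strictly down from
      \<open>y\<close> but stays at or above \<open>x\<close>.\<close>
    have "x \<in> reach omega1_cofinal h (B d) d t" if "y \<in> reach omega1_cofinal h (B d) d t" "y \<in> stage d" "x \<le> y" for y
      using that
    proof (induction y rule: less_induct)
      case (less y)
      show ?case
      proof (cases "x = y")
        case False
        then have xy: "x < y" using less by simp
        obtain i where i: "i < d" "x \<le> omega1_cofinal (sup_below N y) i" using cf less x xy by blast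
        have xN: "x \<in> N" using x stageB BN by blast
        have "omega1_cofinal (sup_below N y) i < sup_below N y" using cofinal_sup_below(1)[OF xN xy] .
        then obtain z where z: "z \<in> N" "z < y" "omega1_cofinal (sup_below N y) i \<le> z" by (rule less_sup_belowD)
        have n: "next_in y i \<in> stage d" using nx less i z by blast
        have n': "omega1_cofinal (sup_below N y) i \<le> next_in y i" "next_in y i \<le> z"
          unfolding next_in_def using LeastI[of "\<lambda>x. x \<in> N \<and> omega1_cofinal (sup_below N y) i \<le> x" z] z
          by (auto intro: Least_le)
        have hy: "h y = sup_below N y" using hB less stageB by blast
        have "next_in y i \<in> reach omega1_cofinal h (B d) d t"
        proof (rule reach.step[OF less(2) i(1)])
          show "next_in y i \<in> B d" using n stageB by blast
          show "next_in y i < y" using n'(2) z(2) by simp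
          show "omega1_cofinal (h y) i \<le> next_in y i" using n'(1) hy by simp
          show "next_in y i \<le> w" if "w \<in> B d" "omega1_cofinal (h y) i \<le> w" for w
            unfolding next_in_def using that hy BN by (intro Least_le) auto
        qed
        moreover have "x \<le> next_in y i" using i(2) n'(1) by (rule order_trans)
        ultimately show ?thesis using less(1)[of "next_in y i"] n n'(2) z(2) by (meson le_less_trans)
      qed (use less in auto)
    qed
    moreover have "x \<le> t" using x B_le by (auto simp: stage_def)
    ultimately show "x \<in> reach omega1_cofinal h (B d) d t"
      using reach.root \<open>t \<in> stage d\<close> by blast
  qed
qed

end


section \<open>Construction of the chain by transfinite recursion\<close>

definition chain_step :: "'w :: wellorder set set \<Rightarrow> 'w \<Rightarrow> ('w \<Rightarrow> 'w set) \<Rightarrow>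
    (omega1 \<Rightarrow> 'w set \<times> 'w set set \<times> ('w set \<Rightarrow> ('w \<Rightarrow> 'w) wo)) \<Rightarrow> omega1 \<Rightarrow>
    'w set \<times> 'w set set \<times> ('w set \<Rightarrow> ('w \<Rightarrow> 'w) wo) \<Rightarrow> bool" where
  "chain_step P t c f i r \<longleftrightarrow> (case r of (B, Y, a) \<Rightarrow>
    B \<in> P \<and> t \<in> B \<and> countable Y \<and>
    (\<forall>y\<in>Y. countable y \<and> (\<forall>n\<in>y. big n \<and> n \<le> t)) \<and>
    (\<forall>j<i. fst (f j) \<subseteq> B \<and> fst (snd (f j)) \<subseteq> Y \<and> {n \<in> fst (f j). big n} \<in> Y \<and>
      (\<forall>x\<in>fst (f j). c x \<subseteq> B) \<and>
      (\<forall>k<i. \<forall>x\<in>fst (f j). omega1_cofinal x k < x \<longrightarrow> omega1_cofinal x k \<in> B) \<and>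
      (\<forall>k<i. \<forall>y\<in>fst (snd (f j)). deficit y (snd (snd (f j)) y) (fst (f k)) \<in> Y)) \<and>
    (\<forall>y. a y = (LEAST x. \<forall>j<i. snd (snd (f j)) y < x \<and> first_bound y (fst (f j)) < x)) \<and>
    (\<forall>y\<in>Y. \<forall>n\<in>y. the_scale y (a y) n < n \<longrightarrow> the_scale y (a y) n \<in> B))"

lemma chain_step_cong:
  assumes "\<And>j. j < i \<Longrightarrow> f j = g j"
  shows "chain_step P t c f i r = chain_step P t c g i r"
  using assms by (simp add: chain_step_def cong: conj_cong)

text \<open>All demands on the new stage amount to containing a countable set \<open>R\<close>,
  which some member of \<open>P\<close> covers. The sets \<open>YY\<close> and positions
  \<open>a\<close> come first: they depend only on earlier stages and contribute scale values to
  \<open>R\<close>.\<close>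

lemma chain_step_exists:
  fixes t :: "'w :: wellorder"
  assumes P: "\<And>p. p \<in> P \<Longrightarrow> countable p" "\<And>p. p \<in> P \<Longrightarrow> p \<subseteq> {..t}"
    and cover: "\<And>A. countable A \<Longrightarrow> A \<subseteq> {..t} \<Longrightarrow> \<exists>p\<in>P. A \<subseteq> p"
    and c: "\<And>x. x \<le> t \<Longrightarrow> countable (c x)" "\<And>x. x \<le> t \<Longrightarrow> c x \<subseteq> {..t}"
    and f: "\<And>j. j < i \<Longrightarrow> chain_step P t c f j (f j)"
  shows "\<exists>r. chain_step P t c f i r"
proof -
  have fB: "countable (fst (f j))" "fst (f j) \<subseteq> {..t}" if "j < i" for j
    using f[OF that] P by (auto simp: chain_step_def split_beta)
  have fY: "countable (fst (snd (f j)))" "y \<in> fst (snd (f j)) \<Longrightarrow> countable y \<and> (\<forall>n\<in>y. big n \<and> n \<le> t)" if "j < i" for j y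
    using f[OF that] by (auto simp: chain_step_def split_beta)
  define YY where "YY = (\<Union>j\<in>{..<i}. fst (snd (f j)) \<union> {{n \<in> fst (f j). big n}} \<union>
    (\<Union>k\<in>{..<i}. (\<lambda>y. deficit y (snd (snd (f j)) y) (fst (f k))) ` fst (snd (f j))))"
  define a where "a y = (LEAST x. \<forall>j<i. snd (snd (f j)) y < x \<and> first_bound y (fst (f j)) < x)" for y
  have YYc: "countable YY" unfolding YY_def using fY by auto
  have YYb: "countable y \<and> (\<forall>n\<in>y. big n \<and> n \<le> t)" if "y \<in> YY" for y
    using that fY(2) fB(1) fB(2)[THEN subsetD] unfolding YY_def deficit_def by auto
  define R where "R = {t} \<union> (\<Union>j\<in>{..<i}. fst (f j) \<union> (\<Union>x\<in>fst (f j). c x) \<union>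
      (\<Union>k\<in>{..<i}. \<Union>x\<in>fst (f j). {z. z = omega1_cofinal x k \<and> z < x})) \<union>
    (\<Union>y\<in>YY. \<Union>n\<in>y. {z. z = the_scale y (a y) n \<and> z < n})"
  have sing: "countable {z. z = u \<and> z < v}" for u v :: 'w
    by (rule countable_subset[of _ "{u}"]) auto
  have "countable R"
    unfolding R_def using fB c YYc YYb sing by (intro countable_Un countable_UN) auto
  moreover have "R \<subseteq> {..t}"
  proof -
    have "z \<le> t" if "x \<le> t" "z < x" for x z using that by simp
    then show ?thesis unfolding R_def using fB(2) c(2) YYb by fastforce
  qed
  ultimately obtain p where p: "p \<in> P" "R \<subseteq> p" using cover by blast
  have "chain_step P t c f i (p, YY, a)"
    unfolding chain_step_def prod.case
  proof (intro conjI ballI allI impI)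
    show "p \<in> P" "t \<in> p" using p by (auto simp: R_def)
    show "countable YY" by fact
    show "a y = (LEAST x. \<forall>j<i. snd (snd (f j)) y < x \<and> first_bound y (fst (f j)) < x)" for y
      by (simp add: a_def)
    fix j assume j: "j < i"
    show "fst (f j) \<subseteq> p" using p(2) j by (auto simp: R_def)
    show "fst (snd (f j)) \<subseteq> YY" "{n \<in> fst (f j). big n} \<in> YY" using j by (auto simp: YY_def)
    show "c x \<subseteq> p" if "x \<in> fst (f j)" for x using p(2) j that by (auto simp: R_def)
    fix k assume k: "k < i"
    show "omega1_cofinal x k \<in> p" if "x \<in> fst (f j)" "omega1_cofinal x k < x" for x
    proof -
      have "omega1_cofinal x k \<in> R" using j k that unfolding R_def by blast
      with p(2) show ?thesis by blast
    qed
    show "deficit y (snd (snd (f j)) y) (fst (f k)) \<in> YY" if "y \<in> fst (snd (f j))" for y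
      using j k that by (auto simp: YY_def)
  next
    fix y n assume "y \<in> YY" "n \<in> y"
    then show "big n" "n \<le> t" using YYb by auto
    assume "the_scale y (a y) n < n"
    then have "the_scale y (a y) n \<in> R" using \<open>y \<in> YY\<close> \<open>n \<in> y\<close> unfolding R_def by blast
    with p(2) show "the_scale y (a y) n \<in> p" by blast
  qed (use YYb in auto)
  then show ?thesis by blast
qed

theorem stationary_family_le:
  fixes t :: "'w :: wellorder" and P :: "'w set set"
  assumes unc: "uncountable {..t}"
    and P: "\<And>p. p \<in> P \<Longrightarrow> countable p" "\<And>p. p \<in> P \<Longrightarrow> p \<subseteq> {..t}"
    and cover: "\<And>A. countable A \<Longrightarrow> A \<subseteq> {..t} \<Longrightarrow> \<exists>p\<in>P. A \<subseteq> p"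
  shows "\<exists>S. |S| \<le>o |P| \<and> (\<forall>c. (\<forall>x\<le>t. countable (c x) \<and> c x \<subseteq> {..t}) \<longrightarrow>
    (\<exists>A\<in>S. countable A \<and> A \<subseteq> {..t} \<and> A \<noteq> {} \<and> (\<forall>x\<in>A. c x \<subseteq> A)))"
proof -
  have "uncountable P"
  proof
    assume "countable P"
    then have "countable (\<Union>p\<in>P. p)" using P(1) by (rule countable_UN)
    then have "countable (\<Union>P)" by simp
    moreover have "{..t} \<subseteq> \<Union>P"
    proof
      fix x assume "x \<in> {..t}"
      then show "x \<in> \<Union>P" using cover[of "{x}"] by auto
    qed
    ultimately show False using unc countable_subset by blast
  qed
  then have infP: "infinite P" and omP: "|UNIV :: omega1 set| \<le>o |P|"
    using countable_finite card_omega1_le by blast+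
  \<comment> \<open>Some \<open>p\<close> in \<open>P\<close> covers the values of a function on a
    countable \<open>Y\<close>, so \<open>D\<close> dominates every product in question and
    \<open>\<Lambda>\<close> bounds all scale lengths.\<close>
  define D where "D = sup_below ` P"
  have D_le: "|D| \<le>o |P|" unfolding D_def by (rule card_of_image)
  obtain \<Lambda> :: "('w \<Rightarrow> 'w) wo" where \<Lambda>: "|{..<\<Lambda>}| =o |D|"
    using wo_index[of D] by blast
  have \<Lambda>_le: "|{..<\<Lambda>}| \<le>o |P|" using \<Lambda> D_le by (rule ordIso_ordLeq_trans)
  have scale_len_le: "scale_len Y \<le> \<Lambda>"
    if Y: "countable Y" "\<And>n. n \<in> Y \<Longrightarrow> big n" "\<And>n. n \<in> Y \<Longrightarrow> n \<le> t" "Y \<noteq> {}" for Y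
  proof (rule ccontr)
    assume "\<not> scale_len Y \<le> \<Lambda>"
    have scale: "is_scale Y (scale_len Y) (the_scale Y)" using is_scale_the_scale Y by blast
    then have "|{..<\<Lambda>}| <o |{..<scale_len Y}|"
      by (rule is_scaleD(6)) (use \<open>\<not> scale_len Y \<le> \<Lambda>\<close> in simp)
    moreover have "dominating Y D" unfolding dominating_def
    proof (intro conjI ballI)
      show "D \<subseteq> below Y" unfolding D_def using sup_below_less P(1) Y(2) by (auto intro!: belowI)
      fix f assume f: "f \<in> below Y"
      have "f ` Y \<subseteq> {..t}"
      proof
        fix x assume "x \<in> f ` Y"
        then obtain n where "n \<in> Y" "x = f n" by blast
        then show "x \<in> {..t}" using belowD[OF f] Y(3)[of n] by fastforce
      qed
      moreover have "countable (f ` Y)" using Y(1) by simp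
      ultimately obtain p where p: "p \<in> P" "f ` Y \<subseteq> p" using cover by blast
      have "\<forall>n\<in>Y. f n \<le> sup_below p n" using p(2) belowD[OF f] by (auto intro!: less_imp_le less_sup_below)
      then show "\<exists>d\<in>D. \<forall>n\<in>Y. f n \<le> d n" using p(1) D_def by blast
    qed
    then have "|{..<scale_len Y}| \<le>o |D|" by (rule is_scaleD(5)[OF scale])
    then have "|{..<scale_len Y}| \<le>o |{..<\<Lambda>}|" using \<Lambda> ordIso_symmetric ordLeq_ordIso_trans by blast
    ultimately show False by (simp flip: not_card_le_iff)
  qed
  define L where "L = lists ({..<\<Lambda>} \<times> P \<times> {..<\<Lambda>})"
  have L: "|L| \<le>o |P|" unfolding L_def
    using infP \<Lambda>_le by (intro card_lists_le card_of_Times_le card_of_mono1) auto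
  define h where "h p l n = (if big n then decode l {n \<in> p. big n} n else n)" for p l and n :: 'w
  \<comment> \<open>All three parameters range over sets fixed before \<open>c\<close>; only the
    choice of the right ones depends on \<open>c\<close>.\<close>
  define S where "S = (\<lambda>(p, d, l). reach omega1_cofinal (h p l) p d t) ` (P \<times> UNIV \<times> L)"
  have S_le: "|S| \<le>o |P|"
  proof -
    have "|P \<times> (UNIV :: omega1 set) \<times> L| \<le>o |P|"
      using infP omP L by (intro card_of_Times_le card_of_mono1) auto
    with card_of_image show ?thesis unfolding S_def by (rule ordLeq_transitive)
  qed
  have S_stat: "\<exists>A\<in>S. countable A \<and> A \<subseteq> {..t} \<and> A \<noteq> {} \<and> (\<forall>x\<in>A. c x \<subseteq> A)"
    if c: "\<And>x. x \<le> t \<Longrightarrow> countable (c x)" "\<And>x. x \<le> t \<Longrightarrow> c x \<subseteq> {..t}" for c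
  proof -
    have "\<exists>f. \<forall>i. chain_step P t c f i (f i)"
    proof (rule dependent_wf_choice[OF wf, where P = "chain_step P t c"])
      show "chain_step P t c f i r = chain_step P t c g i r" if "\<And>z. (z, i) \<in> {(x, y). x < y} \<Longrightarrow> f z = g z" for f g i r
        using that by (intro chain_step_cong) simp
      show "\<exists>r. chain_step P t c f i r"
        if "\<And>y. (y, i) \<in> {(x, y). x < y} \<Longrightarrow> chain_step P t c f y (f y)" for i f
        using chain_step_exists[of P t c i f, OF P cover c] that by simp
    qed
    then obtain f where f: "\<And>i. chain_step P t c f i (f i)" by blast
    define B where "B i = fst (f i)" for i
    define YY where "YY i = fst (snd (f i))" for i
    define idx where "idx i = snd (snd (f i))" for i
    note defs = B_def YY_def idx_def
    have f': "chain_step P t c f i (B i, YY i, idx i)" for i using f[of i] by (simp add: defs)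
    note f = f'[unfolded chain_step_def prod.case, folded defs]
    have BP: "B i \<in> P" for i using f[of i] by blast
    interpret closed_chain B YY idx t c
    proof
      show "B i \<subseteq> B j" "YY i \<subseteq> YY j" if "i < j" for i j using f[of j] that by auto
      show "countable (B i)" for i using P(1)[OF BP] .
      show "countable Y" "n \<in> Y \<Longrightarrow> big n" if "Y \<in> YY i" for i Y n using f[of i] that by auto
      show "deficit Y (idx j Y) (B k) \<in> YY i" if "j < i" "k < i" "Y \<in> YY j" for i j k Y
        using f[of i] that by blast
      show "idx i Y = (LEAST x. \<forall>j<i. idx j Y < x \<and> first_bound Y (B j) < x)" for i Y
        using f[of i] by blast
      show "the_scale Y (idx i Y) n \<in> B i" if "Y \<in> YY i" "n \<in> Y" "the_scale Y (idx i Y) n < n" for i Y n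
        using f[of i] that by blast
      show "x \<le> t" if "x \<in> B i" for i x using P(2)[OF BP[of i]] that by blast
      show "t \<in> B i" for i using f[of i] by blast
      show "c x \<subseteq> B i" if "j < i" "x \<in> B j" for i j x using f[of i] that by blast
      show "omega1_cofinal x k \<in> B i" if "j < i" "k < i" "x \<in> B j" "\<not> big x" "omega1_cofinal x k < x" for i j k x
        using f[of i] that by blast
      show "{n \<in> B j. big n} \<in> YY i" if "j < i" for i j using f[of i] that by blast
    qed
    obtain d where d: "\<And>x. x \<in> stage d \<Longrightarrow> c x \<subseteq> stage d" "t \<in> stage d"
      "\<And>y i x. y \<in> stage d \<Longrightarrow> i < d \<Longrightarrow> x \<in> N \<Longrightarrow> omega1_cofinal (sup_below N y) i \<le> x \<Longrightarrow> next_in y i \<in> stage d"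
      "\<And>y x. y \<in> stage d \<Longrightarrow> x \<in> stage d \<Longrightarrow> x < y \<Longrightarrow> \<exists>i<d. x \<le> omega1_cofinal (sup_below N y) i"
      using closed_stage_exists by blast
    \<comment> \<open>The set of \<open>big\<close> members of \<open>B d\<close> is guaranteed to
      be in \<open>YY\<close> only after stage \<open>d\<close>.\<close>
    obtain k where k: "d < k" using closing_above by blast
    have lY: "scale_len Y \<le> \<Lambda>" if "Y \<in> YY i" "Y \<noteq> {}" for Y i
      using f[of i] that by (intro scale_len_le) (auto simp: defs)
    have "\<exists>l\<in>L. \<forall>n\<in>{n \<in> B d. big n}. decode l {n \<in> B d. big n} n = sup_below N n"
      unfolding L_def by (rule decode_eq[OF _ BP big_in[OF k]]) (use lY in blast)
    then obtain l where l: "l \<in> L" "\<forall>n\<in>{n \<in> B d. big n}. decode l {n \<in> B d. big n} n = sup_below N n" by blast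
    have hB: "h (B d) l n = sup_below N n" if "n \<in> B d" for n
    proof -
      have "n \<in> N" using that by (auto simp: N_def)
      then show ?thesis using l(2) that sup_below_not_big[of n] by (auto simp: h_def)
    qed
    have "reach omega1_cofinal (h (B d) l) (B d) d t = stage d"
      by (rule reach_eq_stage) (fact hB d)+
    then have "stage d \<in> S"
      unfolding S_def using BP l(1) by (intro image_eqI[of _ _ "(B d, d, l)"]) auto
    moreover have "countable (stage d)" unfolding stage_def using B_countable by auto
    moreover have "stage d \<subseteq> {..t}" using B_le by (auto simp: stage_def)
    ultimately show ?thesis using d(1,2) by blast
  qed
  show ?thesis by (intro exI[of _ S] conjI S_le allI impI S_stat) simp_all
qed

section \<open>Nowhere dense sets and labelled trees of open sets\<close>

theorem stationary_family:
  fixes K :: "'k set" and P :: "'k set set"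
  assumes inf: "infinite K"
    and P: "\<And>p. p \<in> P \<Longrightarrow> countable p" "\<And>p. p \<in> P \<Longrightarrow> p \<subseteq> K"
    and cover: "\<And>A. countable A \<Longrightarrow> A \<subseteq> K \<Longrightarrow> \<exists>p\<in>P. A \<subseteq> p"
  shows "\<exists>S. |S| \<le>o |P| \<and> (\<forall>c. (\<forall>x\<in>K. countable (c x) \<and> c x \<subseteq> K) \<longrightarrow>
    (\<exists>A\<in>S. countable A \<and> A \<subseteq> K \<and> A \<noteq> {} \<and> (\<forall>x\<in>A. c x \<subseteq> A)))"
proof (cases "countable K")
  case True
  obtain p where "p \<in> P" using cover[of "{}"] by auto
  then have "|{K}| \<le>o |P|" by (intro card_of_singl_ordLeq) auto
  then show ?thesis
    using True inf by (intro exI[of _ "{K}"]) auto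
next
  case unc: False
  obtain t :: "'k wo" where t: "|{..<t}| =o |K|" using wo_index by blast
  have "infinite {..<t}" using t inf card_of_ordIso_finite by blast
  \<comment> \<open>An infinite segment absorbs one more point, so \<open>K\<close> has a copy with
    a largest element, the root of the walks.\<close>
  then obtain f where "bij_betw f {..<t} ({..<t} \<union> {t})" using infinite_imp_bij_betw2 by metis
  then have "|{..<t}| =o |{..<t} \<union> {t}|" by (rule card_of_ordIsoI)
  moreover have "{..<t} \<union> {t} = {..t}" by auto
  ultimately have "|{..t}| =o |{..<t}|" by (simp add: ordIso_symmetric)
  then have "|{..t}| =o |K|" using t by (rule ordIso_transitive)
  then obtain b where b: "bij_betw b {..t} K" using card_of_ordIso by blast
  define a where "a = inv_into {..t} b"
  have a: "bij_betw a K {..t}" unfolding a_def using b by (rule bij_betw_inv_into)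
  have ba: "b (a x) = x" if "x \<in> K" for x
    unfolding a_def using b that by (simp add: bij_betw_inv_into_right)
  have ab: "a (b x) = x" if "x \<le> t" for x
    unfolding a_def using b that by (simp add: bij_betw_inv_into_left)
  have aK: "a x \<le> t" if "x \<in> K" for x using a that by (auto dest: bij_betwE)
  have bK: "b x \<in> K" if "x \<le> t" for x using b that by (auto dest: bij_betwE)
  have 1: "uncountable {..t}" using unc b by (metis bij_betw_def countable_image)
  have 2: "countable p" if "p \<in> image a ` P" for p using that P(1) by auto
  have 3: "p \<subseteq> {..t}" if "p \<in> image a ` P" for p using that P(2) aK by auto
  have 4: "\<exists>p\<in>image a ` P. A \<subseteq> p" if A: "countable A" "A \<subseteq> {..t}" for A
  proof -
    have "countable (b ` A)" "b ` A \<subseteq> K" using A bK by auto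
    then obtain p where p: "p \<in> P" "b ` A \<subseteq> p" using cover by blast
    have "A \<subseteq> a ` p"
    proof
      fix x assume x: "x \<in> A"
      then have "x = a (b x)" using ab A(2) by auto
      then show "x \<in> a ` p" using p(2) x by blast
    qed
    then show ?thesis using p(1) by blast
  qed
  obtain S where S: "|S| \<le>o |image a ` P|"
    "\<forall>c. (\<forall>x\<le>t. countable (c x) \<and> c x \<subseteq> {..t}) \<longrightarrow>
      (\<exists>A\<in>S. countable A \<and> A \<subseteq> {..t} \<and> A \<noteq> {} \<and> (\<forall>x\<in>A. c x \<subseteq> A))"
    using stationary_family_le[of t "image a ` P", OF 1 2 3 4] by auto
  show ?thesis
  proof (intro exI[of _ "image b ` S"] conjI allI impI)
    have "|image b ` S| \<le>o |S|" by (rule card_of_image)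
    also note S(1)
    also have "|image a ` P| \<le>o |P|" by (rule card_of_image)
    finally show "|image b ` S| \<le>o |P|" .
    fix c assume "\<forall>x\<in>K. countable (c x) \<and> c x \<subseteq> K"
    then have c: "\<And>x. x \<in> K \<Longrightarrow> countable (c x)" "\<And>x. x \<in> K \<Longrightarrow> c x \<subseteq> K" by auto
    have "\<exists>A\<in>S. countable A \<and> A \<subseteq> {..t} \<and> A \<noteq> {} \<and> (\<forall>x\<in>A. a ` c (b x) \<subseteq> A)"
    proof (rule S(2)[rule_format], intro conjI)
      show "countable (a ` c (b x))" if "x \<le> t" for x using c(1) bK that by auto
      show "a ` c (b x) \<subseteq> {..t}" if "x \<le> t" for x using c(2)[OF bK[OF that]] aK by auto
    qed
    then obtain A where A: "A \<in> S" "countable A" "A \<subseteq> {..t}" "A \<noteq> {}" "\<forall>x\<in>A. a ` c (b x) \<subseteq> A" by blast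
    have "c y \<subseteq> b ` A" if y: "y \<in> b ` A" for y
    proof
      fix z assume z: "z \<in> c y"
      obtain x where x: "x \<in> A" "y = b x" using y by blast
      have "y \<in> K" using x A(3) bK by auto
      then have "z \<in> K" using c(2) z by blast
      moreover have "a z \<in> A" using A(5) x z by blast
      ultimately show "z \<in> b ` A" using ba by force
    qed
    then show "\<exists>A\<in>image b ` S. countable A \<and> A \<subseteq> K \<and> A \<noteq> {} \<and> (\<forall>x\<in>A. c x \<subseteq> A)"
      using A bK by (intro bexI[of _ "b ` A"]) auto
  qed
qed

section \<open>Nowhere dense sets and meagerness\<close>

lemma nowhere_dense_inD:
  assumes "nowhere_dense_in X A" "openin X U" "U \<noteq> {}"
  obtains V where "openin X V" "V \<noteq> {}" "V \<subseteq> U" "V \<inter> A = {}"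
proof -
  have "\<not> U \<subseteq> X closure_of A"
    using assms interior_of_maximal unfolding nowhere_dense_in_def by fastforce
  show thesis
  proof (rule that[of "U - X closure_of A"])
    show "openin X (U - X closure_of A)" using assms(2) by (simp add: openin_diff)
    show "(U - X closure_of A) \<inter> A = {}"
      using assms(1) closure_of_subset unfolding nowhere_dense_in_def by blast
  qed (use \<open>\<not> U \<subseteq> X closure_of A\<close> in auto)
qed

lemma nowhere_dense_inI:
  assumes "A \<subseteq> topspace X"
    and "\<And>U. openin X U \<Longrightarrow> U \<noteq> {} \<Longrightarrow> \<exists>V. openin X V \<and> V \<noteq> {} \<and> V \<subseteq> U \<and> V \<inter> A = {}"
  shows "nowhere_dense_in X A"
proof -
  let ?U = "X interior_of (X closure_of A)"
  have "?U = {}"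
  proof (rule ccontr)
    assume "?U \<noteq> {}"
    then obtain V where V: "openin X V" "V \<noteq> {}" "V \<subseteq> ?U" "V \<inter> A = {}"
      using assms(2)[of ?U] by auto
    then obtain x where "x \<in> V" by blast
    then have "x \<in> X closure_of A"
      using V(3) interior_of_subset[of X "X closure_of A"] by auto
    then show False using V(1,4) \<open>x \<in> V\<close> by (auto simp: in_closure_of)
  qed
  then show ?thesis using assms(1) by (simp add: nowhere_dense_in_def)
qed

lemma nowhere_dense_in_subset:
  assumes "nowhere_dense_in X A" "B \<subseteq> A"
  shows "nowhere_dense_in X B"
proof (rule nowhere_dense_inI)
  show "B \<subseteq> topspace X" using assms by (auto simp: nowhere_dense_in_def)
  fix U assume "openin X U" "U \<noteq> {}"
  then obtain V where "openin X V" "V \<noteq> {}" "V \<subseteq> U" "V \<inter> A = {}"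
    using nowhere_dense_inD[OF assms(1)] by blast
  then show "\<exists>V. openin X V \<and> V \<noteq> {} \<and> V \<subseteq> U \<and> V \<inter> B = {}" using assms(2) by blast
qed

lemma not_meagerD:
  assumes "Y \<notin> meager_sets X" "Y \<subseteq> topspace X" "countable \<N>" "\<And>N. N \<in> \<N> \<Longrightarrow> nowhere_dense_in X N"
  obtains y where "y \<in> Y" "\<And>N. N \<in> \<N> \<Longrightarrow> y \<notin> N"
proof (rule ccontr)
  assume "\<not> thesis"
  then have "Y = \<Union>((\<lambda>N. N \<inter> Y) ` \<N>)" using that by blast
  moreover have "countable ((\<lambda>N. N \<inter> Y) ` \<N>)" using assms(3) by simp
  moreover have "\<forall>N\<in>(\<lambda>N. N \<inter> Y) ` \<N>. nowhere_dense_in X N"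
    using assms(4) nowhere_dense_in_subset by blast
  ultimately have "Y \<in> meager_sets X" unfolding meager_sets_def by blast
  with assms(1) show False by blast
qed

lemma not_meagerI:
  assumes "\<And>N :: nat \<Rightarrow> _. (\<And>n. nowhere_dense_in X (N n)) \<Longrightarrow> \<exists>y\<in>Y. \<forall>n. y \<notin> N n"
  shows "Y \<notin> meager_sets X"
proof
  assume "Y \<in> meager_sets X"
  then obtain \<N> where N: "countable \<N>" "\<forall>N\<in>\<N>. nowhere_dense_in X N" "Y = \<Union>\<N>"
    unfolding meager_sets_def by blast
  \<comment> \<open>The empty set pads the family so that \<open>from_nat_into\<close> enumerates a
    nonempty set.\<close>
  have "nowhere_dense_in X {}" by (simp add: nowhere_dense_in_def)
  then have F: "nowhere_dense_in X (from_nat_into (insert {} \<N>) n)" for n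
    using N(2) from_nat_into[of "insert {} \<N>" n] by auto
  obtain y where y: "y \<in> Y" "\<forall>n. y \<notin> from_nat_into (insert {} \<N>) n"
    using assms[of "from_nat_into (insert {} \<N>)"] F by blast
  then obtain A where "A \<in> \<N>" "y \<in> A" using N(3) by blast
  moreover obtain n where "from_nat_into (insert {} \<N>) n = A"
    using from_nat_into_surj[of "insert {} \<N>" A] N(1) \<open>A \<in> \<N>\<close> by auto
  ultimately show False using y(2) by blast
qed

section \<open>Binary sequences and labelled trees\<close>

definition follows :: "(nat \<Rightarrow> bool) \<Rightarrow> (bool list \<Rightarrow> bool list) \<Rightarrow> nat \<Rightarrow> bool" where
  "follows q G n \<longleftrightarrow> map q [n..<n + length (G (map q [0..<n]))] = G (map q [0..<n])"

text \<open>Nonmeagerness in Cantor space: the sequences that follow \<open>G\<close> infinitely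
  often form a dense G-delta set, and every comeager set contains one of these.\<close>

definition seq_nonmeager :: "(nat \<Rightarrow> bool) set \<Rightarrow> bool" where
  "seq_nonmeager Q \<longleftrightarrow> (\<forall>G. \<exists>q\<in>Q. \<forall>k. \<exists>n\<ge>k. follows q G n)"

definition labelled_split :: "'a topology \<Rightarrow> 'l set \<Rightarrow> bool" where
  "labelled_split X L \<longleftrightarrow> (\<forall>W. openin X W \<longrightarrow> W \<noteq> {} \<longrightarrow>
    (\<exists>f. (\<forall>l\<in>L. openin X (f l) \<and> f l \<noteq> {} \<and> f l \<subseteq> W) \<and> disjoint_family_on f L))"

text \<open>Pairs are compared, so a nonempty set carries only one label.\<close>

definition sparse :: "('a set \<times> 'l) set \<Rightarrow> bool" where
  "sparse \<C> \<longleftrightarrow> (\<forall>p\<in>\<C>. \<forall>q\<in>\<C>. p \<noteq> q \<longrightarrow> fst p \<inter> fst q = {})"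

lemma sparse_Union_chain:
  assumes "\<And>\<C>. \<C> \<in> \<CC> \<Longrightarrow> sparse \<C>" "subset.chain A \<CC>"
  shows "sparse (\<Union>\<CC>)"
  unfolding sparse_def
proof (intro ballI impI)
  fix p q assume "p \<in> \<Union>\<CC>" "q \<in> \<Union>\<CC>" "p \<noteq> q"
  then obtain C D where "C \<in> \<CC>" "D \<in> \<CC>" "p \<in> C" "q \<in> D" by blast
  then have "(p \<in> C \<and> q \<in> C) \<or> (p \<in> D \<and> q \<in> D)"
    using assms(2) unfolding subset_chain_def by blast
  then show "fst p \<inter> fst q = {}"
    using assms(1) \<open>C \<in> \<CC>\<close> \<open>D \<in> \<CC>\<close> \<open>p \<noteq> q\<close> unfolding sparse_def by blast
qed

context Metric_space
begin

definition small_open :: "nat \<Rightarrow> 'a set \<Rightarrow> 'a set \<Rightarrow> bool" where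
  "small_open n W V \<longleftrightarrow> openin mtopology V \<and> V \<noteq> {} \<and> V \<subseteq> W \<and> (\<exists>a\<in>M. V \<subseteq> mball a (1 / 2 ^ n))"

lemma small_open_exists:
  assumes "openin mtopology W" "W \<noteq> {}"
  obtains V where "small_open n W V"
proof -
  obtain a where a: "a \<in> W" "a \<in> M" using assms openin_subset by fastforce
  have "small_open n W (W \<inter> mball a (1 / 2 ^ n))"
    unfolding small_open_def using assms a by (auto intro!: openin_Int)
  then show thesis by (rule that)
qed

text \<open>One piece for each label is extended by Zorn's lemma to a maximal disjoint family, whose
  union is dense in \<open>W\<close>.\<close>

lemma refinement_step:
  fixes L :: "'l set"
  assumes L: "labelled_split mtopology L" and W: "openin mtopology W" "W \<noteq> {}"
  obtains \<C> :: "('a set \<times> 'l) set" where "sparse \<C>" "\<And>p. p \<in> \<C> \<Longrightarrow> small_open n W (fst p)"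
    "\<And>l. l \<in> L \<Longrightarrow> \<exists>V. (V, l) \<in> \<C>"
    "\<And>U. openin mtopology U \<Longrightarrow> U \<inter> W \<noteq> {} \<Longrightarrow> \<exists>p\<in>\<C>. U \<inter> fst p \<noteq> {}"
proof -
  obtain f where f: "\<And>l. l \<in> L \<Longrightarrow> openin mtopology (f l) \<and> f l \<noteq> {} \<and> f l \<subseteq> W" "disjoint_family_on f L"
    using L W unfolding labelled_split_def by meson
  have "\<forall>l\<in>L. \<exists>V. small_open n (f l) V" using f(1) small_open_exists by metis
  from bchoice[OF this] obtain g where g: "\<forall>l\<in>L. small_open n (f l) (g l)" ..
  define \<C>0 where "\<C>0 = (\<lambda>l. (g l, l)) ` L"
  define \<AA> where "\<AA> = {\<C>. \<C>0 \<subseteq> \<C> \<and> sparse \<C> \<and> (\<forall>p\<in>\<C>. small_open n W (fst p))}"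
  have "\<C>0 \<in> \<AA>"
  proof -
    have "g l \<inter> g l' = {}" if "l \<in> L" "l' \<in> L" "l \<noteq> l'" for l l'
      using f(2) g that unfolding disjoint_family_on_def small_open_def by blast
    then have "sparse \<C>0" by (auto simp: sparse_def \<C>0_def)
    moreover have "small_open n W (g l)" if "l \<in> L" for l
      using f(1)[OF that] g that unfolding small_open_def by blast
    ultimately show ?thesis by (auto simp: \<AA>_def \<C>0_def)
  qed
  have "\<exists>\<C>\<in>\<AA>. \<forall>\<D>\<in>\<AA>. \<C> \<subseteq> \<D> \<longrightarrow> \<D> = \<C>"
  proof (rule subset_Zorn_nonempty)
    show "\<AA> \<noteq> {}" using \<open>\<C>0 \<in> \<AA>\<close> by blast
    fix \<CC> assume C: "\<CC> \<noteq> {}" "subset.chain \<AA> \<CC>"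
    then have sub: "\<CC> \<subseteq> \<AA>" by (simp add: subset_chain_def)
    have "sparse (\<Union>\<CC>)" using sparse_Union_chain[OF _ C(2)] sub by (auto simp: \<AA>_def)
    moreover have "\<C>0 \<subseteq> \<Union>\<CC>" using C(1) sub by (auto simp: \<AA>_def)
    moreover have "\<forall>p\<in>\<Union>\<CC>. small_open n W (fst p)" using sub by (auto simp: \<AA>_def)
    ultimately show "\<Union>\<CC> \<in> \<AA>" by (simp add: \<AA>_def)
  qed
  then obtain \<C> where \<C>: "\<C> \<in> \<AA>" "\<And>\<D>. \<D> \<in> \<AA> \<Longrightarrow> \<C> \<subseteq> \<D> \<Longrightarrow> \<D> = \<C>" by blast
  show thesis
  proof (rule that[of \<C>])
    show "sparse \<C>" "\<And>p. p \<in> \<C> \<Longrightarrow> small_open n W (fst p)" using \<C>(1) by (auto simp: \<AA>_def)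
    show "\<exists>V. (V, l) \<in> \<C>" if "l \<in> L" for l using \<C>(1) that by (auto simp: \<AA>_def \<C>0_def)
    fix U assume U: "openin mtopology U" "U \<inter> W \<noteq> {}"
    show "\<exists>p\<in>\<C>. U \<inter> fst p \<noteq> {}"
    proof (rule ccontr)
      assume no: "\<not> ?thesis"
      have "openin mtopology (U \<inter> W)" using U W by auto
      then obtain V where V: "small_open n (U \<inter> W) V" using small_open_exists U(2) by blast
      then have V': "small_open n W V" "V \<subseteq> U" by (auto simp: small_open_def)
      \<comment> \<open>Pieces added only for density need no particular label, so
        \<open>undefined\<close> will do.\<close>
      have "insert (V, undefined) \<C> \<in> \<AA>"
        using \<C>(1) V' no unfolding \<AA>_def sparse_def by fastforce
      then have "(V, undefined) \<in> \<C>" using \<C>(2)[of "insert (V, undefined) \<C>"] by blast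
      then have "U \<inter> fst (V, undefined :: 'l) = {}" using no by blast
      then show False using V V'(2) by (auto simp: small_open_def)
    qed
  qed
qed

lemma labelled_tree:
  fixes L :: "nat \<Rightarrow> 'l set"
  assumes "\<And>n. labelled_split mtopology (L n)" and "M \<noteq> {}"
  obtains \<W> :: "nat \<Rightarrow> ('a set \<times> 'l) set" where
    "\<And>n. sparse (\<W> n)"
    "\<And>n p. p \<in> \<W> n \<Longrightarrow> openin mtopology (fst p) \<and> fst p \<noteq> {} \<and> (\<exists>a\<in>M. fst p \<subseteq> mball a (1 / 2 ^ n))"
    "\<And>n U. openin mtopology U \<Longrightarrow> U \<noteq> {} \<Longrightarrow> \<exists>p\<in>\<W> n. U \<inter> fst p \<noteq> {}"
    "\<And>n p l. p \<in> \<W> n \<Longrightarrow> l \<in> L n \<Longrightarrow> \<exists>V. V \<subseteq> fst p \<and> (V, l) \<in> \<W> (Suc n)"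
    "\<And>n p. p \<in> \<W> (Suc n) \<Longrightarrow> \<exists>q\<in>\<W> n. fst p \<subseteq> fst q"
proof -
  let ?ref = "\<lambda>n i W \<C>. sparse \<C> \<and> (\<forall>p\<in>\<C>. small_open n W (fst p)) \<and> (\<forall>l\<in>L i. \<exists>V. (V, l) \<in> \<C>) \<and>
    (\<forall>U. openin mtopology U \<longrightarrow> U \<inter> W \<noteq> {} \<longrightarrow> (\<exists>p\<in>\<C>. U \<inter> fst p \<noteq> {}))"
  define R where "R n i W = (SOME \<C>. ?ref n i W \<C>)" for n i W
  have R: "?ref n i W (R n i W)" if "openin mtopology W" "W \<noteq> {}" for n i W
    unfolding R_def
    by (rule someI_ex, rule refinement_step[OF assms(1)[of i] that, of n]) blast
  \<comment> \<open>The set \<open>L n\<close> labels the children of level \<open>n\<close>, which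
    form level \<open>Suc n\<close>. Level 0 reuses \<open>L 0\<close>, and nothing is promised
    about its labels.\<close>
  define \<W> where "\<W> = rec_nat (R 0 0 M) (\<lambda>n \<C>. \<Union>p\<in>\<C>. R (Suc n) n (fst p))"
  have W0: "\<W> 0 = R 0 0 M" and WS: "\<W> (Suc n) = (\<Union>p\<in>\<W> n. R (Suc n) n (fst p))" for n
    by (simp_all add: \<W>_def)
  have M: "openin mtopology M" by (metis openin_topspace topspace_mtopology)
  note R0 = R[OF M assms(2), of 0 0]
  have main: "sparse (\<W> n) \<and> (\<forall>p\<in>\<W> n. openin mtopology (fst p) \<and> fst p \<noteq> {} \<and> (\<exists>a\<in>M. fst p \<subseteq> mball a (1 / 2 ^ n))) \<and>
    (\<forall>U. openin mtopology U \<longrightarrow> U \<noteq> {} \<longrightarrow> (\<exists>p\<in>\<W> n. U \<inter> fst p \<noteq> {}))" for n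
  proof (induction n)
    case 0
    have U: "U \<inter> M \<noteq> {}" if "openin mtopology U" "U \<noteq> {}" for U
      using openin_subset[OF that(1)] that(2) by auto
    show ?case
    proof (intro conjI ballI allI impI)
      show "sparse (\<W> 0)" using R0 unfolding W0 by (rule conjunct1)
      show "\<exists>p\<in>\<W> 0. U \<inter> fst p \<noteq> {}" if "openin mtopology U" "U \<noteq> {}" for U
        using R0 U[OF that] that(1) unfolding W0 by simp
      fix p assume "p \<in> \<W> 0"
      then have "small_open 0 M (fst p)" using R0 unfolding W0 by simp
      then show "openin mtopology (fst p)" "fst p \<noteq> {}" "\<exists>a\<in>M. fst p \<subseteq> mball a (1 / 2 ^ 0)"
        by (auto simp: small_open_def)
    qed
  next
    case (Suc n)
    have r: "?ref (Suc n) n (fst p) (R (Suc n) n (fst p))" if "p \<in> \<W> n" for p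
      using Suc that by (intro R) auto
    have "sparse (\<W> (Suc n))" unfolding sparse_def
    proof (intro ballI impI)
      fix p q assume "p \<in> \<W> (Suc n)" "q \<in> \<W> (Suc n)" "p \<noteq> q"
      then obtain p' q' where pq: "p' \<in> \<W> n" "p \<in> R (Suc n) n (fst p')" "q' \<in> \<W> n" "q \<in> R (Suc n) n (fst q')"
        unfolding WS by blast
      show "fst p \<inter> fst q = {}"
      proof (cases "p' = q'")
        case True
        moreover have "sparse (R (Suc n) n (fst p'))" using r[OF pq(1)] by (rule conjunct1)
        ultimately show ?thesis using pq(2,4) \<open>p \<noteq> q\<close> unfolding sparse_def by blast
      next
        case False
        then have "fst p' \<inter> fst q' = {}" using Suc pq unfolding sparse_def by blast
        moreover have "small_open (Suc n) (fst p') (fst p)" "small_open (Suc n) (fst q') (fst q)"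
          using r[OF pq(1)] r[OF pq(3)] pq(2,4) by simp_all
        ultimately show ?thesis unfolding small_open_def by blast
      qed
    qed
    moreover have "openin mtopology (fst p) \<and> fst p \<noteq> {} \<and> (\<exists>a\<in>M. fst p \<subseteq> mball a (1 / 2 ^ Suc n))"
      if pW: "p \<in> \<W> (Suc n)" for p
    proof -
      obtain p' where "p' \<in> \<W> n" "p \<in> R (Suc n) n (fst p')" using pW unfolding WS by blast
      then have "small_open (Suc n) (fst p') (fst p)" using r[of p'] by simp
      then show ?thesis by (auto simp: small_open_def)
    qed
    moreover have "\<exists>p\<in>\<W> (Suc n). U \<inter> fst p \<noteq> {}" if U: "openin mtopology U" "U \<noteq> {}" for U
    proof -
      obtain p' where p': "p' \<in> \<W> n" "U \<inter> fst p' \<noteq> {}" using Suc U by blast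
      have "\<exists>p\<in>R (Suc n) n (fst p'). U \<inter> fst p \<noteq> {}" using r[OF p'(1)] U(1) p'(2) by simp
      then show ?thesis using p'(1) unfolding WS by blast
    qed
    ultimately show ?case by blast
  qed
  have r: "?ref (Suc n) n (fst p) (R (Suc n) n (fst p))" if "p \<in> \<W> n" for p n
    using main[of n] that by (intro R) auto
  show thesis
  proof (rule that[of \<W>])
    show "\<exists>V. V \<subseteq> fst p \<and> (V, l) \<in> \<W> (Suc n)" if "p \<in> \<W> n" "l \<in> L n" for n p l
    proof -
      have "\<exists>V. (V, l) \<in> R (Suc n) n (fst p)" using r[OF that(1)] that(2) by simp
      then obtain V where V: "(V, l) \<in> R (Suc n) n (fst p)" ..
      then have "small_open (Suc n) (fst p) V" using r[OF that(1)] by fastforce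
      then show ?thesis using V that(1) unfolding WS small_open_def by blast
    qed
    show "\<exists>q\<in>\<W> n. fst p \<subseteq> fst q" if p: "p \<in> \<W> (Suc n)" for n p
    proof -
      obtain p' where "p' \<in> \<W> n" "p \<in> R (Suc n) n (fst p')" using p unfolding WS by blast
      moreover from this have "small_open (Suc n) (fst p') (fst p)" using r[of p' n] by simp
      ultimately show ?thesis unfolding small_open_def by blast
    qed
  qed (use main in blast)+
qed

end

locale branching = Metric_space M d for M :: "'a set" and d +
  fixes L :: "nat \<Rightarrow> 'l set" and \<W> :: "nat \<Rightarrow> ('a set \<times> 'l) set"
  assumes sparse: "\<And>n. sparse (\<W> n)"
    and node_open: "\<And>n p. p \<in> \<W> n \<Longrightarrow> openin mtopology (fst p)" "\<And>n p. p \<in> \<W> n \<Longrightarrow> fst p \<noteq> {}"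
    and node_small: "\<And>n p. p \<in> \<W> n \<Longrightarrow> \<exists>a\<in>M. fst p \<subseteq> mball a (1 / 2 ^ n)"
    and dense: "\<And>n U. openin mtopology U \<Longrightarrow> U \<noteq> {} \<Longrightarrow> \<exists>p\<in>\<W> n. U \<inter> fst p \<noteq> {}"
    and child: "\<And>n p l. p \<in> \<W> n \<Longrightarrow> l \<in> L n \<Longrightarrow> \<exists>V. V \<subseteq> fst p \<and> (V, l) \<in> \<W> (Suc n)"
    and parent: "\<And>n p. p \<in> \<W> (Suc n) \<Longrightarrow> \<exists>q\<in>\<W> n. fst p \<subseteq> fst q"
begin

text \<open>Meaningful on the dense open union of level \<open>n\<close>, arbitrary
  elsewhere.\<close>

definition node :: "'a \<Rightarrow> nat \<Rightarrow> 'a set \<times> 'l" where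
  "node x n = (SOME p. p \<in> \<W> n \<and> x \<in> fst p)"

lemma node_eq:
  assumes "p \<in> \<W> n" "x \<in> fst p"
  shows "node x n = p"
proof -
  have "node x n \<in> \<W> n \<and> x \<in> fst (node x n)"
    unfolding node_def using assms by (intro someI[of "\<lambda>p. p \<in> \<W> n \<and> x \<in> fst p"]) simp
  then show ?thesis using sparse[of n] assms unfolding sparse_def by blast
qed

text \<open>A deep node that meets the ball of half the radius has diameter below the other
  half.\<close>

lemma eventually_inside:
  assumes "openin mtopology U" "U \<noteq> {}"
  obtains n0 where "\<And>n. n \<ge> n0 \<Longrightarrow> \<exists>p\<in>\<W> n. fst p \<subseteq> U"
proof -
  obtain y where y: "y \<in> U" using assms(2) by blast
  then obtain r where r: "r > 0" "mball y r \<subseteq> U" using assms(1) unfolding openin_mtopology by blast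
  have yM: "y \<in> M" using y assms(1) openin_subset by fastforce
  obtain n0 where n0: "(1 / 2) ^ n0 < r / 4"
    using real_arch_pow_inv[of "r / 4" "1 / 2"] r(1) by auto
  have "\<exists>p\<in>\<W> n. fst p \<subseteq> U" if n: "n \<ge> n0" for n
  proof -
    have "y \<in> mball y (r / 2)" using yM r(1) by simp
    then have "mball y (r / 2) \<noteq> {}" by blast
    then obtain p where p: "p \<in> \<W> n" "mball y (r / 2) \<inter> fst p \<noteq> {}"
      using dense[OF openin_mball] by blast
    obtain a where a: "a \<in> M" "fst p \<subseteq> mball a (1 / 2 ^ n)" using node_small[OF p(1)] by blast
    obtain z where z: "z \<in> mball y (r / 2)" "z \<in> fst p" using p(2) by blast
    have small: "1 / 2 ^ n < r / 4"
    proof -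
      have "(1 / 2 :: real) ^ n \<le> (1 / 2) ^ n0" using n by (intro power_decreasing) auto
      then show ?thesis using n0 by (simp add: power_one_over)
    qed
    have "fst p \<subseteq> mball y r"
    proof
      fix x assume "x \<in> fst p"
      then have x: "x \<in> M" "d a x < 1 / 2 ^ n" and z': "z \<in> M" "d a z < 1 / 2 ^ n" "d y z < r / 2"
        using a z by auto
      have "d y x \<le> d y z + d z a + d a x"
        using triangle[of y z x] triangle[of z a x] yM x z' a by linarith
      also have "\<dots> < r" using x z' small commute[of z a] by simp
      finally show "x \<in> mball y r" using yM x by simp
    qed
    then show ?thesis using p(1) r(2) by blast
  qed
  then show thesis by (rule that)
qed

lemma ancestor:
  assumes "p \<in> \<W> n" "m \<le> n"
  shows "\<exists>q\<in>\<W> m. fst p \<subseteq> fst q"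
  using assms
proof (induction n arbitrary: p)
  case (Suc n)
  show ?case
  proof (cases "m = Suc n")
    case False
    obtain q where q: "q \<in> \<W> n" "fst p \<subseteq> fst q" using parent[OF Suc(2)] by blast
    moreover obtain q' where "q' \<in> \<W> m" "fst q \<subseteq> fst q'" using Suc(1)[OF q(1)] Suc(3) False by auto
    ultimately show ?thesis by blast
  qed (use Suc in blast)
qed auto

lemma node_cong:
  assumes "p \<in> \<W> n" "m \<le> n" "x \<in> fst p" "y \<in> fst p"
  shows "node x m = node y m"
proof -
  obtain q where q: "q \<in> \<W> m" "fst p \<subseteq> fst q" using ancestor[OF assms(1,2)] by blast
  then have "x \<in> fst q" "y \<in> fst q" using assms(3,4) by blast+
  then show ?thesis using node_eq[OF q(1)] by simp
qed

text \<open>The points missing a given label are nowhere dense: every open set contains nodes of all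
  deep levels, and at some of these levels each node has a child with that label.\<close>

lemma exists_label:
  assumes Y: "Y \<subseteq> M" "Y \<notin> meager_sets mtopology" and A: "countable A"
    and freq: "\<And>a k. a \<in> A \<Longrightarrow> \<exists>n\<ge>k. a \<in> L n"
  shows "\<exists>y\<in>Y. \<forall>a\<in>A. \<exists>n. snd (node y n) = a"
proof -
  define B where "B a = {x \<in> M. \<forall>n. snd (node x n) \<noteq> a}" for a
  have "nowhere_dense_in mtopology (B a)" if a: "a \<in> A" for a
  proof (rule nowhere_dense_inI)
    show "B a \<subseteq> topspace mtopology" by (auto simp: B_def)
    fix U assume U: "openin mtopology U" "U \<noteq> {}"
    then obtain n0 where n0: "\<And>n. n \<ge> n0 \<Longrightarrow> \<exists>p\<in>\<W> n. fst p \<subseteq> U" using eventually_inside by blast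
    obtain n where n: "n \<ge> n0" "a \<in> L n" using freq[OF a] by blast
    then obtain p where p: "p \<in> \<W> n" "fst p \<subseteq> U" using n0 by blast
    obtain V where V: "V \<subseteq> fst p" "(V, a) \<in> \<W> (Suc n)" using child[OF p(1) n(2)] by blast
    have "x \<notin> B a" if "x \<in> V" for x
    proof -
      have "snd (node x (Suc n)) = a" using node_eq[OF V(2), of x] that by simp
      then show ?thesis unfolding B_def by blast
    qed
    then show "\<exists>V. openin mtopology V \<and> V \<noteq> {} \<and> V \<subseteq> U \<and> V \<inter> B a = {}"
      using node_open[OF V(2)] V(1) p(2) by (intro exI[of _ V]) auto
  qed
  then have "\<And>N. N \<in> B ` A \<Longrightarrow> nowhere_dense_in mtopology N" by blast
  moreover have "countable (B ` A)" using A by simp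
  ultimately obtain y where y: "y \<in> Y" "\<And>N. N \<in> B ` A \<Longrightarrow> y \<notin> N"
    using not_meagerD[OF Y(2)] Y(1) by (metis topspace_mtopology)
  have "\<exists>n. snd (node y n) = a" if "a \<in> A" for a
    using y(2)[of "B a"] that y(1) Y(1) by (auto simp: B_def)
  then show ?thesis using y(1) by blast
qed

lemma descend:
  assumes L: "\<And>n. L n = UNIV" and "p \<in> \<W> n"
  shows "\<exists>p'\<in>\<W> (n + length u). fst p' \<subseteq> fst p \<and>
    (\<forall>x\<in>fst p'. map (\<lambda>i. snd (node x (Suc i))) [n..<n + length u] = u)"
  using \<open>p \<in> \<W> n\<close>
proof (induction u arbitrary: n p)
  case (Cons b u)
  obtain V where V: "V \<subseteq> fst p" "(V, b) \<in> \<W> (Suc n)" using child[OF Cons(2)] L by blast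
  obtain p' where p': "p' \<in> \<W> (Suc n + length u)" "fst p' \<subseteq> V"
    "\<forall>x\<in>fst p'. map (\<lambda>i. snd (node x (Suc i))) [Suc n..<Suc n + length u] = u"
    using Cons(1)[OF V(2)] by auto
  have "map (\<lambda>i. snd (node x (Suc i))) [n..<n + length (b # u)] = b # u" if "x \<in> fst p'" for x
  proof -
    have "node x (Suc n) = (V, b)" using node_eq[OF V(2), of x] p'(2) that by auto
    moreover have "[n..<n + length (b # u)] = n # [Suc n..<Suc n + length u]"
      by (simp add: upt_conv_Cons del: upt_Suc)
    ultimately show ?thesis using p'(3) that by simp
  qed
  then show ?case using p'(1,2) V(1) by (intro bexI[of _ p']) auto
qed auto

end

lemma (in branching) seq_nonmeager_labels:
  fixes b :: "'a \<Rightarrow> nat \<Rightarrow> bool"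
  assumes Y: "Y \<subseteq> M" "Y \<notin> meager_sets mtopology" and L: "\<And>n. L n = UNIV"
    and b: "\<And>x i. b x i = f (snd (node x (Suc i)))" and f: "surj f"
  shows "seq_nonmeager (b ` Y)"
  unfolding seq_nonmeager_def
proof
  fix G :: "bool list \<Rightarrow> bool list"
  define B where "B k = {x \<in> M. \<forall>n\<ge>k. \<not> follows (b x) G n}" for k
  have "nowhere_dense_in mtopology (B k)" for k
  proof (rule nowhere_dense_inI)
    show "B k \<subseteq> topspace mtopology" by (auto simp: B_def)
    fix U assume U: "openin mtopology U" "U \<noteq> {}"
    then obtain n0 where n0: "\<And>n. n \<ge> n0 \<Longrightarrow> \<exists>p\<in>\<W> n. fst p \<subseteq> U" using eventually_inside by blast
    define n where "n = max n0 k"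
    obtain p where p: "p \<in> \<W> n" "fst p \<subseteq> U" using n0[of n] by (auto simp: n_def)
    \<comment> \<open>Points of a node at level \<open>n\<close> share their first \<open>n\<close>
      digits, so the word demanded by \<open>G\<close> is read off from one point and spelled below
      the node.\<close>
    obtain x0 where x0: "x0 \<in> fst p" using node_open(2)[OF p(1)] by blast
    define u where "u = map (inv f) (G (map (b x0) [0..<n]))"
    obtain p' where p': "p' \<in> \<W> (n + length u)" "fst p' \<subseteq> fst p"
      "\<forall>x\<in>fst p'. map (\<lambda>i. snd (node x (Suc i))) [n..<n + length u] = u"
      using descend[OF L p(1), of u] by blast
    have "follows (b x) G n" if x: "x \<in> fst p'" for x
    proof -
      have "node x (Suc i) = node x0 (Suc i)" if "i < n" for i
        using node_cong[OF p(1)] that x x0 p'(2) by (meson Suc_leI subsetD)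
      then have eq: "map (b x) [0..<n] = map (b x0) [0..<n]" by (simp add: b)
      moreover have "map (b x) [n..<n + length u] = G (map (b x0) [0..<n])"
      proof -
        have "map (b x) [n..<n + length u] = map f (map (\<lambda>i. snd (node x (Suc i))) [n..<n + length u])"
          by (simp add: b)
        also have "\<dots> = map f u" using p'(3) x by simp
        also have "\<dots> = G (map (b x0) [0..<n])"
          unfolding u_def using f by (simp add: surj_f_inv_f map_idI)
        finally show ?thesis .
      qed
      ultimately show ?thesis unfolding follows_def eq by (simp add: u_def del: map_eq_conv)
    qed
    moreover have "k \<le> n" by (simp add: n_def)
    ultimately have "fst p' \<inter> B k = {}" unfolding B_def by blast
    then show "\<exists>V. openin mtopology V \<and> V \<noteq> {} \<and> V \<subseteq> U \<and> V \<inter> B k = {}"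
      using node_open[OF p'(1)] p'(2) p(2) by blast
  qed
  then have "\<And>N. N \<in> range B \<Longrightarrow> nowhere_dense_in mtopology N" by blast
  then obtain y where y: "y \<in> Y" "\<And>N. N \<in> range B \<Longrightarrow> y \<notin> N"
    using not_meagerD[OF Y(2), of "range B"] Y(1) by auto
  have "\<exists>n\<ge>k. follows (b y) G n" for k using y(2)[of "B k"] y(1) Y(1) by (auto simp: B_def)
  then show "\<exists>q\<in>b ` Y. \<forall>k. \<exists>n\<ge>k. follows q G n" using y(1) by blast
qed

context Metric_space
begin

lemma labelled_split_bool:
  assumes "\<forall>x\<in>M. \<not> openin mtopology {x}"
  shows "labelled_split mtopology (UNIV :: bool set)"
  unfolding labelled_split_def
proof (intro allI impI)
  fix W assume W: "openin mtopology W" "W \<noteq> {}"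
  then obtain x where x: "x \<in> W" "x \<in> M" using openin_subset by fastforce
  have "W \<noteq> {x}" using assms W(1) x(2) by auto
  then obtain y where y: "y \<in> W" "y \<noteq> x" using x by blast
  then have "y \<in> M" using W(1) openin_subset by fastforce
  then obtain U V where UV: "openin mtopology U" "openin mtopology V" "x \<in> U" "y \<in> V" "disjnt U V"
    using Hausdorff_space_mtopology x(2) y(2) unfolding Hausdorff_space_def by (metis topspace_mtopology)
  let ?f = "\<lambda>b. if b then U \<inter> W else V \<inter> W"
  have "\<forall>l\<in>UNIV. openin mtopology (?f l) \<and> ?f l \<noteq> {} \<and> ?f l \<subseteq> W"
    using UV W(1) x y by auto
  moreover have "disjoint_family_on ?f UNIV"
    using UV(5) by (auto simp: disjoint_family_on_def disjnt_def)
  ultimately show "\<exists>f. (\<forall>l\<in>(UNIV :: bool set). openin mtopology (f l) \<and> f l \<noteq> {} \<and> f l \<subseteq> W) \<and> disjoint_family_on f UNIV"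
    by (intro exI[of _ ?f] conjI)
qed

lemma branching_exists:
  fixes L :: "nat \<Rightarrow> 'l set"
  assumes "\<And>n. labelled_split mtopology (L n)" and "M \<noteq> {}"
  obtains \<W> where "branching M d L \<W>"
proof (rule labelled_tree[of L, OF assms])
  fix \<W> :: "nat \<Rightarrow> ('a set \<times> 'l) set"
  assume *: "\<And>n. sparse (\<W> n)"
    "\<And>n p. p \<in> \<W> n \<Longrightarrow> openin mtopology (fst p) \<and> fst p \<noteq> {} \<and> (\<exists>a\<in>M. fst p \<subseteq> mball a (1 / 2 ^ n))"
    "\<And>n U. openin mtopology U \<Longrightarrow> U \<noteq> {} \<Longrightarrow> \<exists>p\<in>\<W> n. U \<inter> fst p \<noteq> {}"
    "\<And>n p l. p \<in> \<W> n \<Longrightarrow> l \<in> L n \<Longrightarrow> \<exists>V. V \<subseteq> fst p \<and> (V, l) \<in> \<W> (Suc n)"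
    "\<And>n p. p \<in> \<W> (Suc n) \<Longrightarrow> \<exists>q\<in>\<W> n. fst p \<subseteq> fst q"
  have "branching M d L \<W>"
  proof
    show "sparse (\<W> n)" for n by (rule *(1))
    show "openin mtopology (fst p)" "fst p \<noteq> {}" "\<exists>a\<in>M. fst p \<subseteq> mball a (1 / 2 ^ n)" if "p \<in> \<W> n" for n p
      using *(2)[OF that] by simp_all
  qed (fact *(3-5))+
  then show thesis by (rule that)
qed

lemma seq_nonmeager_exists:
  assumes "\<forall>x\<in>M. \<not> openin mtopology {x}" and Y: "Y \<subseteq> M" "Y \<notin> meager_sets mtopology"
  obtains Q where "seq_nonmeager Q" "|Q| \<le>o |Y|"
proof -
  have "Y \<noteq> {}"
  proof
    assume "Y = {}"
    then have "Y = \<Union>{}" by simp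
    then have "Y \<in> meager_sets mtopology" unfolding meager_sets_def by blast
    with Y(2) show False by blast
  qed
  then have "M \<noteq> {}" using Y(1) by blast
  then obtain \<W> where "branching M d (\<lambda>_. UNIV :: bool set) \<W>"
    using branching_exists[of "\<lambda>_. UNIV :: bool set"] labelled_split_bool[OF assms(1)] by blast
  then interpret branching M d "\<lambda>_. UNIV :: bool set" \<W> .
  have "seq_nonmeager ((\<lambda>x i. id (snd (node x (Suc i)))) ` Y)"
    using Y by (rule seq_nonmeager_labels[where f = id]) auto
  moreover have "|(\<lambda>x i. id (snd (node x (Suc i)))) ` Y| \<le>o |Y|" by (rule card_of_image)
  ultimately show thesis by (rule that)
qed

section \<open>Disjoint open families from separated sets\<close>

definition separated :: "real \<Rightarrow> 'a set \<Rightarrow> bool" where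
  "separated e S \<longleftrightarrow> (\<forall>x\<in>S. \<forall>y\<in>S. x \<noteq> y \<longrightarrow> e \<le> d x y)"

lemma maximal_separated:
  assumes "e > 0" "W \<subseteq> M"
  obtains S where "S \<subseteq> W" "separated e S" "\<And>x. x \<in> W \<Longrightarrow> \<exists>s\<in>S. d s x < e"
proof -
  define \<AA> where "\<AA> = {S. S \<subseteq> W \<and> separated e S}"
  have "\<exists>S\<in>\<AA>. \<forall>T\<in>\<AA>. S \<subseteq> T \<longrightarrow> T = S"
  proof (rule subset_Zorn_nonempty)
    have "{} \<in> \<AA>" by (simp add: \<AA>_def separated_def)
    then show "\<AA> \<noteq> {}" by blast
    fix \<CC> assume C: "\<CC> \<noteq> {}" "subset.chain \<AA> \<CC>"
    have "e \<le> d x y" if xy: "x \<in> \<Union>\<CC>" "y \<in> \<Union>\<CC>" "x \<noteq> y" for x y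
    proof -
      obtain S T where "S \<in> \<CC>" "T \<in> \<CC>" "x \<in> S" "y \<in> T" using xy by blast
      moreover from this have "S \<subseteq> T \<or> T \<subseteq> S" using C(2) unfolding subset_chain_def by blast
      ultimately obtain R where "R \<in> \<CC>" "x \<in> R" "y \<in> R" by blast
      moreover have "\<CC> \<subseteq> \<AA>" using C(2) by (simp add: subset_chain_def)
      ultimately show ?thesis using xy(3) by (auto simp: \<AA>_def separated_def)
    qed
    moreover have "\<Union>\<CC> \<subseteq> W" using C(2) by (auto simp: subset_chain_def \<AA>_def)
    ultimately show "\<Union>\<CC> \<in> \<AA>" by (simp add: \<AA>_def separated_def)
  qed
  then obtain S where S: "S \<in> \<AA>" "\<And>T. T \<in> \<AA> \<Longrightarrow> S \<subseteq> T \<Longrightarrow> T = S" by blast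
  have "\<exists>s\<in>S. d s x < e" if x: "x \<in> W" for x
  proof (rule ccontr)
    assume no: "\<not> ?thesis"
    then have "insert x S \<in> \<AA>"
      using S(1) x by (auto simp: \<AA>_def separated_def not_less commute)
    then have "x \<in> S" using S(2)[of "insert x S"] by blast
    moreover have "d x x < e" using assms x by auto
    ultimately show False using no by blast
  qed
  then show thesis using that S(1) by (auto simp: \<AA>_def)
qed

lemma separated_disjoint_opens:
  assumes "e > 0" "separated e S" "S \<subseteq> W" "openin mtopology W" "|Lb| \<le>o |S|"
  shows "\<exists>f. (\<forall>l\<in>Lb. openin mtopology (f l) \<and> f l \<noteq> {} \<and> f l \<subseteq> W) \<and> disjoint_family_on f Lb"
proof -
  obtain j where j: "inj_on j Lb" "j ` Lb \<subseteq> S" using assms(5) card_of_ordLeq[of Lb S] by blast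
  have SM: "S \<subseteq> M" using assms(3,4) openin_subset by fastforce
  let ?f = "\<lambda>l. mball (j l) (e / 2) \<inter> W"
  have "openin mtopology (?f l) \<and> ?f l \<noteq> {} \<and> ?f l \<subseteq> W" if "l \<in> Lb" for l
  proof -
    have "j l \<in> S" using j(2) that by blast
    then have "j l \<in> ?f l" using SM assms(1,3) by auto
    then have "?f l \<noteq> {}" by blast
    then show ?thesis using assms(4) by (auto intro!: openin_Int)
  qed
  moreover have "disjoint_family_on ?f Lb" unfolding disjoint_family_on_def
  proof (intro ballI impI)
    fix l l' assume l: "l \<in> Lb" "l' \<in> Lb" "l \<noteq> l'"
    then have jl: "j l \<in> S" "j l' \<in> S" "j l \<noteq> j l'" using j by (auto simp: inj_on_def)
    have False if z: "z \<in> ?f l" "z \<in> ?f l'" for z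
    proof -
      have "d (j l) (j l') \<le> d (j l) z + d z (j l')" using triangle z by auto
      also have "\<dots> < e" using z commute[of z "j l'"] by auto
      finally have "d (j l) (j l') < e" .
      moreover have "e \<le> d (j l) (j l')" using assms(2) jl unfolding separated_def by blast
      ultimately show False by simp
    qed
    then show "?f l \<inter> ?f l' = {}" by blast
  qed
  ultimately show ?thesis by (intro exI[of _ ?f] conjI[of "\<forall>l\<in>Lb. _ l"] ballI)
qed

text \<open>One set \<open>Km m = K\<close> suffices unless some open set has no disjoint family of \<open>|K|\<close> open subsets; then
  \<open>K\<close> is a countable union of sets of smaller size.\<close>

lemma labelled_split_cover:
  fixes K :: "'k set"
  assumes unc: "uncountable K"
    and K: "\<And>W D. openin mtopology W \<Longrightarrow> W \<noteq> {} \<Longrightarrow> D \<subseteq> W \<Longrightarrow>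
      (\<And>V. openin mtopology V \<Longrightarrow> V \<noteq> {} \<Longrightarrow> V \<subseteq> W \<Longrightarrow> V \<inter> D \<noteq> {}) \<Longrightarrow> |K| \<le>o |D|"
  obtains Km :: "nat \<Rightarrow> 'k set" where "K = (\<Union>m. Km m)" "\<And>m. labelled_split mtopology (Km m)"
proof -
  define e where "e n = 1 / real (Suc n)" for n
  have e: "e n > 0" for n by (simp add: e_def)
  define sep where "sep W n = (SOME S. S \<subseteq> W \<and> separated (e n) S \<and> (\<forall>x\<in>W. \<exists>s\<in>S. d s x < e n))" for W n
  have sep: "sep W n \<subseteq> W" "separated (e n) (sep W n)" "\<And>x. x \<in> W \<Longrightarrow> \<exists>s\<in>sep W n. d s x < e n" if "W \<subseteq> M" for W n
  proof -
    have "\<exists>S. S \<subseteq> W \<and> separated (e n) S \<and> (\<forall>x\<in>W. \<exists>s\<in>S. d s x < e n)"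
      using maximal_separated[OF e that] by metis
    from someI_ex[OF this, folded sep_def]
    show "sep W n \<subseteq> W" "separated (e n) (sep W n)" "\<And>x. x \<in> W \<Longrightarrow> \<exists>s\<in>sep W n. d s x < e n" by auto
  qed
  \<comment> \<open>The maximal separated sets for all radii together are dense in
    \<open>W\<close>.\<close>
  have K_le: "|K| \<le>o |\<Union>n. sep W n|" if W: "openin mtopology W" "W \<noteq> {}" for W
  proof (rule K[OF W])
    have WM: "W \<subseteq> M" using W(1) openin_subset by fastforce
    then show "(\<Union>n. sep W n) \<subseteq> W" using sep(1) by blast
    fix V assume V: "openin mtopology V" "V \<noteq> {}" "V \<subseteq> W"
    then obtain y where y: "y \<in> V" by blast
    then obtain r where r: "r > 0" "mball y r \<subseteq> V" using V(1) unfolding openin_mtopology by blast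
    obtain n where n: "e n < r" unfolding e_def using r(1) by (metis reals_Archimedean inverse_eq_divide)
    have yW: "y \<in> W" using y V(3) by blast
    then obtain s where s: "s \<in> sep W n" "d s y < e n" using sep(3)[OF WM] by blast
    have "s \<in> M" using s(1) sep(1)[OF WM] WM by blast
    then have "s \<in> mball y r" using s(2) n yW WM commute[of s y] by auto
    then show "V \<inter> (\<Union>n. sep W n) \<noteq> {}" using r(2) s(1) by blast
  qed
  have split: "labelled_split mtopology Lb"
    if Lb: "\<And>W. openin mtopology W \<Longrightarrow> W \<noteq> {} \<Longrightarrow> \<exists>n. |Lb| \<le>o |sep W n|" for Lb :: "'k set"
    unfolding labelled_split_def
  proof (intro allI impI)
    fix W assume W: "openin mtopology W" "W \<noteq> {}"
    then have WM: "W \<subseteq> M" using openin_subset by fastforce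
    obtain n where n: "|Lb| \<le>o |sep W n|" using Lb W by blast
    show "\<exists>f. (\<forall>l\<in>Lb. openin mtopology (f l) \<and> f l \<noteq> {} \<and> f l \<subseteq> W) \<and> disjoint_family_on f Lb"
      using separated_disjoint_opens[OF e sep(2)[OF WM] sep(1)[OF WM] W(1) n] .
  qed
  show thesis
  proof (cases "\<forall>W. openin mtopology W \<longrightarrow> W \<noteq> {} \<longrightarrow> (\<exists>n. |K| \<le>o |sep W n| )")
    case True
    then have "labelled_split mtopology K" by (intro split) blast
    then show ?thesis using that[of "\<lambda>_. K"] by auto
  next
    case False
    then obtain W0 where W0: "openin mtopology W0" "W0 \<noteq> {}" "\<And>n. |sep W0 n| <o |K|"
      by (auto simp: not_card_le_iff)
    obtain j where j: "inj_on j K" "j ` K \<subseteq> (\<Union>n. sep W0 n)"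
      using K_le[OF W0(1,2)] card_of_ordLeq[of K "\<Union>n. sep W0 n"] by blast
    \<comment> \<open>An injection into the separated sets of the exceptional \<open>W0\<close>,
      each smaller than \<open>K\<close>, cuts \<open>K\<close> into pieces.\<close>
    define Km where "Km n = {k \<in> K. j k \<in> sep W0 n}" for n
    have Km: "|Km n| <o |K|" for n
    proof -
      have "|Km n| \<le>o |sep W0 n|"
        using j by (intro card_of_ordLeqI[of j]) (auto simp: Km_def inj_on_def)
      then show ?thesis using W0(3) by (rule ordLeq_ordLess_trans)
    qed
    have "labelled_split mtopology (Km m)" for m
    proof (rule split)
      fix W assume W: "openin mtopology W" "W \<noteq> {}"
      show "\<exists>n. |Km m| \<le>o |sep W n|"
      proof (rule ccontr)
        assume "\<not> ?thesis"
        \<comment> \<open>If all separated sets in \<open>W\<close> were smaller than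
          \<open>Km m\<close>, their union would be countable or of size at most
          \<open>|Km m|\<close>, hence smaller than \<open>K\<close>.\<close>
        then have less: "|sep W n| <o |Km m|" for n by (simp add: not_card_le_iff)
        show False
        proof (cases "finite (Km m)")
          case True
          then have "countable (sep W n)" for n
            using card_of_ordLeq_finite[OF ordLess_imp_ordLeq[OF less]] countable_finite by blast
          then have "countable (\<Union>n. sep W n)" by auto
          then have "countable K" using K_le[OF W] by (metis countable_ordLeq)
          then show False using unc by blast
        next
          case False
          then have "|UNIV :: nat set| \<le>o |Km m|" using infinite_iff_card_of_nat by blast
          then have "|\<Union>n. sep W n| \<le>o |Km m|"
            using False less by (intro card_of_UNION_ordLeq_infinite) (auto intro: ordLess_imp_ordLeq)
          with K_le[OF W] have "|K| \<le>o |Km m|" by (rule ordLeq_transitive)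
          then show False using Km[of m] by (simp flip: not_card_le_iff)
        qed
      qed
    qed
    moreover have "K = (\<Union>m. Km m)" using j(2) by (auto simp: Km_def)
    ultimately show ?thesis using that by blast
  qed
qed

end

section \<open>Nonmeager sets from closed families of base elements\<close>

lemma base_ofD:
  assumes "base_of X \<B>" "openin X V" "x \<in> V"
  obtains B where "B \<in> \<B>" "x \<in> B" "B \<subseteq> V"
proof -
  have "(arbitrary union_of (\<lambda>U. U \<in> \<B>)) V" using assms(1,2) by (simp add: base_of_def)
  then obtain \<U> where "\<U> \<subseteq> \<B>" "\<Union>\<U> = V" unfolding union_of_def arbitrary_def by auto
  then show thesis using assms(3) that by blast
qed

lemma base_of_open:
  assumes "base_of X \<B>" "B \<in> \<B>"
  shows "openin X B"
proof -
  have "(arbitrary union_of (\<lambda>U. U \<in> \<B>)) B"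
    unfolding union_of_def arbitrary_def using assms(2) by (intro exI[of _ "{B}"]) auto
  then show ?thesis using assms(1) by (simp add: base_of_def)
qed

lemma base_ofI:
  assumes "\<And>B. B \<in> \<B> \<Longrightarrow> openin X B"
    and "\<And>V x. openin X V \<Longrightarrow> x \<in> V \<Longrightarrow> \<exists>B\<in>\<B>. x \<in> B \<and> B \<subseteq> V"
  shows "base_of X \<B>"
  unfolding base_of_def
proof
  fix V
  show "openin X V = (arbitrary union_of (\<lambda>U. U \<in> \<B>)) V"
  proof
    assume V: "openin X V"
    have "\<Union>{B \<in> \<B>. B \<subseteq> V} = V" using assms(2)[OF V] by blast
    then show "(arbitrary union_of (\<lambda>U. U \<in> \<B>)) V"
      unfolding union_of_def arbitrary_def by (intro exI[of _ "{B \<in> \<B>. B \<subseteq> V}"]) auto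
  next
    assume "(arbitrary union_of (\<lambda>U. U \<in> \<B>)) V"
    then obtain \<U> where "\<U> \<subseteq> \<B>" "\<Union>\<U> = V" unfolding union_of_def arbitrary_def by auto
    then show "openin X V" using assms(1) by blast
  qed
qed

text \<open>The machine counts the digits \<open>0\<close>; at a digit \<open>1\<close> it resets the counter \<open>m\<close> and moves to \<open>A m\<close> if
  that set lies well inside the current one.\<close>

definition shrink_step :: "'a topology \<Rightarrow> (nat \<Rightarrow> 'a set) \<Rightarrow> nat \<times> 'a set \<Rightarrow> bool \<Rightarrow> nat \<times> 'a set" where
  "shrink_step X A s b = (if b then (0, if A (fst s) \<noteq> {} \<and> X closure_of A (fst s) \<subseteq> snd s then A (fst s) else snd s)
    else (Suc (fst s), snd s))"

definition shrink_run :: "'a topology \<Rightarrow> (nat \<Rightarrow> 'a set) \<Rightarrow> 'a set \<Rightarrow> bool list \<Rightarrow> nat \<times> 'a set" where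
  "shrink_run X A W bs = foldl (shrink_step X A) (0, W) bs"

lemma shrink_run_append: "shrink_run X A W (s @ u) = foldl (shrink_step X A) (shrink_run X A W s) u"
  by (simp add: shrink_run_def)

lemma foldl_shrink_step_False:
  "foldl (shrink_step X A) s (replicate m False) = (fst s + m, snd s)"
  by (induction m arbitrary: s) (auto simp: shrink_step_def)

definition shrink_set :: "'a topology \<Rightarrow> (nat \<Rightarrow> 'a set) \<Rightarrow> 'a set \<Rightarrow> (nat \<Rightarrow> bool) \<Rightarrow> nat \<Rightarrow> 'a set" where
  "shrink_set X A W q n = snd (shrink_run X A W (map q [0..<n]))"

lemma shrink_set_Suc:
  "shrink_set X A W q (Suc n) = shrink_set X A W q n \<or>
    (shrink_set X A W q (Suc n) \<noteq> {} \<and> shrink_set X A W q (Suc n) \<in> range A \<and>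
     X closure_of shrink_set X A W q (Suc n) \<subseteq> shrink_set X A W q n)"
  by (auto simp: shrink_set_def shrink_run_append shrink_step_def)

definition shrink_point :: "'a topology \<Rightarrow> (nat \<Rightarrow> 'a set) \<Rightarrow> 'a set \<Rightarrow> (nat \<Rightarrow> bool) \<Rightarrow> 'a" where
  "shrink_point X A W q = (SOME z. \<forall>n. z \<in> shrink_set X A W q n)"

context Metric_space
begin

lemma closure_of_mball_subset: "mtopology closure_of mball y r \<subseteq> mcball y r"
  by (intro closure_of_minimal closedin_mcball mball_subset_mcball)

lemma avoiding_base_element:
  assumes U0: "openin mtopology U0" and K: "base_of (subtopology mtopology U0) K"
    and N: "\<And>i. nowhere_dense_in mtopology (N i)" and V: "V \<in> K" "V \<noteq> {}"
  shows "\<exists>W\<in>K. W \<noteq> {} \<and> mtopology closure_of W \<subseteq> V \<and> (\<exists>a\<in>M. W \<subseteq> mball a (1 / 2 ^ k)) \<and> (\<forall>i\<le>k. W \<inter> N i = {})"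
proof -
  have "openin (subtopology mtopology U0) V" using K V(1) by (rule base_of_open)
  then have Vo: "openin mtopology V" "V \<subseteq> U0" using U0 openin_open_subtopology by blast+
  have "\<exists>W. openin mtopology W \<and> W \<noteq> {} \<and> W \<subseteq> V \<and> (\<forall>i<j. W \<inter> N i = {})" for j
  proof (induction j)
    case 0
    then show ?case using Vo V(2) by blast
  next
    case (Suc j)
    then obtain W where W: "openin mtopology W" "W \<noteq> {}" "W \<subseteq> V" "\<forall>i<j. W \<inter> N i = {}" by blast
    obtain W' where W': "openin mtopology W'" "W' \<noteq> {}" "W' \<subseteq> W" "W' \<inter> N j = {}"
      using nowhere_dense_inD[OF N[of j] W(1,2)] by blast
    have disj: "W' \<inter> N i = {}" if "i < Suc j" for i
    proof (cases "i = j")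
      case False
      then have "W \<inter> N i = {}" using W(4) that by simp
      then show ?thesis using W'(3) by blast
    qed (use W'(4) in simp)
    have "W' \<subseteq> V" using W'(3) W(3) by (rule order_trans)
    then show ?case using W'(1,2) disj by (intro exI[of _ W'] conjI allI impI)
  qed
  then obtain W where W: "openin mtopology W" "W \<noteq> {}" "W \<subseteq> V" "\<forall>i<Suc k. W \<inter> N i = {}" by blast
  then obtain y where y: "y \<in> W" by blast
  then obtain r where r: "r > 0" "mball y r \<subseteq> W" using W(1) unfolding openin_mtopology by blast
  have yM: "y \<in> M" using y W(1) openin_subset by fastforce
  \<comment> \<open>Half of \<open>r\<close> puts even the closed ball inside \<open>V\<close>; the
    other bound controls the size.\<close>
  define r' where "r' = min (r / 2) (1 / 2 ^ k)"
  have r': "r' > 0" "r' < r" "r' \<le> 1 / 2 ^ k" using r(1) by (auto simp: r'_def)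
  have sub: "mball y r' \<subseteq> mball y r" using r'(2) by (intro mball_subset_concentric) auto
  have "openin (subtopology mtopology U0) (mball y r')"
    using U0 sub r(2) W(3) Vo(2) by (subst openin_open_subtopology) auto
  moreover have "y \<in> mball y r'" using yM r'(1) by simp
  ultimately obtain B where B: "B \<in> K" "y \<in> B" "B \<subseteq> mball y r'"
    using base_ofD[OF K] by blast
  have "mtopology closure_of B \<subseteq> mtopology closure_of mball y r'" using B(3) by (rule closure_of_mono)
  also have "\<dots> \<subseteq> mcball y r'" by (rule closure_of_mball_subset)
  also have "\<dots> \<subseteq> mball y r" using r'(2) by auto
  finally have "mtopology closure_of B \<subseteq> V" using r(2) W(3) by blast
  moreover have "\<exists>a\<in>M. B \<subseteq> mball a (1 / 2 ^ k)"
    using yM B(3) mball_subset_concentric[OF r'(3), of y] by blast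
  moreover have "\<forall>i\<le>k. B \<inter> N i = {}"
  proof (intro allI impI)
    fix i assume "i \<le> k"
    then have "W \<inter> N i = {}" using W(4) by (simp add: less_Suc_eq_le)
    then show "B \<inter> N i = {}" using B(3) sub r(2) by blast
  qed
  moreover have "B \<noteq> {}" using B(2) by blast
  ultimately show ?thesis using B(1) by (intro bexI[of _ B] conjI)
qed

text \<open>Closure of \<open>range A\<close> under \<open>F\<close> gives every desired move an
  index that binary digits can spell. Since some \<open>q\<close> makes such moves at arbitrarily
  late times, completeness yields a point, and it avoids every \<open>N k\<close>.\<close>

lemma shrink_point_avoids:
  assumes "mcomplete" and U0: "openin mtopology U0" and K: "base_of (subtopology mtopology U0) K"
    and F: "\<And>k V. V \<in> K \<Longrightarrow> V \<noteq> {} \<Longrightarrow> F k V \<in> K \<and> F k V \<noteq> {} \<and> mtopology closure_of F k V \<subseteq> V \<and>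
      (\<exists>a\<in>M. F k V \<subseteq> mball a (1 / 2 ^ k)) \<and> (\<forall>i\<le>k. F k V \<inter> N i = {})"
    and A: "range A \<subseteq> K" "\<And>V k. V \<in> range A \<Longrightarrow> V \<noteq> {} \<Longrightarrow> F k V \<in> range A"
    and W0: "W0 \<in> range A" "W0 \<noteq> {}" and Q: "seq_nonmeager Q"
  shows "\<exists>q\<in>Q. shrink_point mtopology A W0 q \<in> M \<and> (\<forall>k. shrink_point mtopology A W0 q \<notin> N k)"
proof -
  let ?run = "shrink_run mtopology A W0"
  \<comment> \<open>The first digit resets the counter but may itself cause a move, so the target is
    computed from the set reached after it. The digits \<open>0\<close> count up to the index
    \<open>m\<close>, and the final \<open>1\<close> makes the move.\<close>
  define G where "G s = True # replicate (SOME m. A m = F (length s) (snd (?run (s @ [True])))) False @ [True]"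
    for s :: "bool list"
  obtain q where q: "q \<in> Q" "\<And>k. \<exists>n\<ge>k. follows q G n"
    using Q unfolding seq_nonmeager_def by blast
  define V where "V = shrink_set mtopology A W0 q"
  have V0: "V 0 = W0" by (simp add: V_def shrink_set_def shrink_run_def)
  have step: "V (Suc n) = V n \<or> (V (Suc n) \<noteq> {} \<and> V (Suc n) \<in> range A \<and> mtopology closure_of V (Suc n) \<subseteq> V n)" for n
    unfolding V_def by (rule shrink_set_Suc)
  have V: "V n \<in> range A \<and> V n \<noteq> {}" for n
    by (induction n) (use V0 W0 step in metis)+
  have VK: "V n \<in> K" for n using V A(1) by blast
  have V_open: "openin mtopology (V n)" for n
    using base_of_open[OF K VK] U0 openin_open_subtopology by blast
  then have VM: "V n \<subseteq> M" for n using openin_subset by fastforce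
  have dec1: "V (Suc n) \<subseteq> V n" for n
    using step[of n] closure_of_subset[of "V (Suc n)" mtopology] VM by auto
  have dec: "V n \<subseteq> V m" if "m \<le> n" for m n
    using lift_Suc_antimono_le[of V m n] dec1 that by (auto simp: antimono_def)
  have strict: "\<exists>j m. n < m \<and> k \<le> j \<and> V m = F j (V (Suc n))" if fol: "follows q G n" "k \<le> n" for n k
  proof -
    define s where "s = map q [0..<n]"
    define W where "W = snd (?run (s @ [True]))"
    define m where "m = (SOME m. A m = F n W)"
    have len: "length s = n" by (simp add: s_def)
    have Gs: "G s = True # replicate m False @ [True]" by (simp add: G_def len W_def m_def)
    have eq: "map q [0..<n + length (G s)] = s @ G s"
    proof -
      have "[0..<n + length (G s)] = [0..<n] @ [n..<n + length (G s)]" by (rule upt_add_eq_append) simp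
      then show ?thesis using fol(1) by (simp add: follows_def s_def)
    qed
    have "q n = True"
    proof -
      have "map q [n..<n + length (G s)] = G s" using fol(1) by (simp add: follows_def s_def)
      then have "hd (map q [n..<n + length (G s)]) = hd (G s)" by (rule arg_cong)
      moreover have "[n..<n + length (G s)] = n # [Suc n..<n + length (G s)]"
        by (rule upt_conv_Cons) (simp add: Gs)
      ultimately show ?thesis by (simp add: Gs del: upt_Suc)
    qed
    then have W: "W = V (Suc n)" by (simp add: W_def V_def shrink_set_def s_def)
    have "F n W \<in> range A" using A(2)[of "V (Suc n)" n] V[of "Suc n"] W by simp
    then obtain i where "F n W = A i" by (rule rangeE)
    then have "A i = F n W" by (rule sym)
    then have Am: "A m = F n W" unfolding m_def by (rule someI)
    have FW: "F n W \<noteq> {}" "mtopology closure_of F n W \<subseteq> W" using F[OF VK, of "Suc n" n] V[of "Suc n"] W by simp_all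
    have "V (n + length (G s)) = snd (?run (s @ G s))" by (simp only: V_def shrink_set_def eq)
    also have "s @ G s = (s @ [True]) @ replicate m False @ [True]" by (simp add: Gs)
    also have "snd (?run \<dots>) = F n W"
    proof -
      have "fst (?run (s @ [True])) = 0" by (simp add: shrink_run_append shrink_step_def)
      then show ?thesis
        unfolding shrink_run_append[of _ _ _ "s @ [True]"] foldl_append foldl_shrink_step_False
        using FW Am by (simp add: shrink_step_def W_def)
    qed
    finally have "V (n + length (G s)) = F n (V (Suc n))" using W by simp
    then show ?thesis using fol(2) by (intro exI[of _ n] exI[of _ "n + length (G s)"]) (simp add: Gs)
  qed
  have small: "\<exists>m j n. k \<le> n \<and> n < m \<and> k \<le> j \<and> V m = F j (V (Suc n))" for k
    using q(2)[of k] strict by meson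
  let ?C = "\<lambda>n. mtopology closure_of V n"
  have "\<Inter>(range ?C) \<noteq> {}"
  proof (rule mcomplete_nest[THEN iffD1, OF \<open>mcomplete\<close>, rule_format], intro conjI allI impI)
    show "closedin mtopology (?C n)" for n by (rule closedin_closure_of)
    show "?C n \<noteq> {}" for n using V[of n] VM[of n] closure_of_subset[of "V n" mtopology] by auto
    show "decseq ?C" unfolding decseq_def using dec closure_of_mono by blast
    fix \<epsilon> :: real assume "\<epsilon> > 0"
    then obtain k where k: "(1 / 2) ^ k < \<epsilon>" using real_arch_pow_inv[of \<epsilon> "1 / 2"] by auto
    obtain m j n where *: "k \<le> j" "V m = F j (V (Suc n))" using small by blast
    then obtain a where a: "V m \<subseteq> mball a (1 / 2 ^ j)" using F[OF VK, of "Suc n" j] V[of "Suc n"] by auto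
    have "?C m \<subseteq> mtopology closure_of mball a (1 / 2 ^ j)" using a by (rule closure_of_mono)
    also have "\<dots> \<subseteq> mcball a (1 / 2 ^ j)" by (rule closure_of_mball_subset)
    also have "\<dots> \<subseteq> mcball a \<epsilon>"
    proof (rule mcball_subset_concentric)
      have "(1 / 2 :: real) ^ j \<le> (1 / 2) ^ k" using *(1) by (intro power_decreasing) auto
      then show "1 / 2 ^ j \<le> \<epsilon>" using k by (simp add: power_one_over)
    qed
    finally show "\<exists>n a. ?C n \<subseteq> mcball a \<epsilon>" by blast
  qed
  then obtain z where z: "\<And>n. z \<in> ?C n" by blast
  have "z \<in> V n" for n
  proof -
    obtain m j n' where *: "n \<le> n'" "V m = F j (V (Suc n'))" using small by blast
    have "z \<in> V (Suc n')" using z[of m] * F[OF VK, of "Suc n'" j] V[of "Suc n'"] by auto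
    then show ?thesis using dec[of n "Suc n'"] *(1) by auto
  qed
  then have "\<exists>z. \<forall>n. z \<in> shrink_set mtopology A W0 q n" by (auto simp: V_def)
  from someI_ex[OF this] have p: "shrink_point mtopology A W0 q \<in> V n" for n
    unfolding shrink_point_def V_def by blast
  have "shrink_point mtopology A W0 q \<notin> N k" for k
  proof -
    obtain m j n where *: "k \<le> j" "V m = F j (V (Suc n))" using small by blast
    then have "V m \<inter> N k = {}" using F[OF VK, of "Suc n" j] V[of "Suc n"] by auto
    then show ?thesis using p[of m] by blast
  qed
  moreover have "shrink_point mtopology A W0 q \<in> M" using p VM by blast
  ultimately show ?thesis using q(1) by blast
qed

lemma nonmeager_from_stationary:
  assumes "mcomplete" and U0: "openin mtopology U0" "U0 \<noteq> {}" and K: "base_of (subtopology mtopology U0) K"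
    and S: "\<forall>c. (\<forall>x\<in>K. countable (c x) \<and> c x \<subseteq> K) \<longrightarrow>
      (\<exists>A\<in>S. countable A \<and> A \<subseteq> K \<and> A \<noteq> {} \<and> (\<forall>x\<in>A. c x \<subseteq> A))"
    and Q: "seq_nonmeager Q"
  obtains Z where "Z \<subseteq> M" "Z \<notin> meager_sets mtopology" "|Z| \<le>o |S \<times> Q|"
proof -
  have "openin (subtopology mtopology U0) U0" using U0(1) by (subst openin_open_subtopology) auto
  moreover obtain u where "u \<in> U0" using U0(2) by blast
  ultimately obtain W0 where W0: "W0 \<in> K" "W0 \<noteq> {}" using base_ofD[OF K] by blast
  define pt where "pt = (\<lambda>(A, q). shrink_point mtopology (from_nat_into A) W0 q)"
  \<comment> \<open>For a bad pair the choice in \<open>shrink_point\<close> may be junk outside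
    \<open>M\<close>.\<close>
  define Z where "Z = pt ` (S \<times> Q) \<inter> M"
  have "Z \<notin> meager_sets mtopology"
  proof (rule not_meagerI)
    fix N :: "nat \<Rightarrow> 'a set" assume N: "\<And>n. nowhere_dense_in mtopology (N n)"
    let ?R = "\<lambda>k V W. W \<in> K \<and> W \<noteq> {} \<and> mtopology closure_of W \<subseteq> V \<and>
      (\<exists>a\<in>M. W \<subseteq> mball a (1 / 2 ^ k)) \<and> (\<forall>i\<le>k. W \<inter> N i = {})"
    define F where "F k V = (SOME W. ?R k V W)" for k V
    have F: "?R k V (F k V)" if "V \<in> K" "V \<noteq> {}" for k V
    proof -
      have "\<exists>W. ?R k V W" using avoiding_base_element[of U0 K N V k, OF U0(1) K N that] by blast
      then show ?thesis unfolding F_def by (rule someI_ex)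
    qed
    \<comment> \<open>Including \<open>W0\<close> forces every nonempty closed \<open>A\<close> to
      contain the starting set.\<close>
    define c where "c V = insert W0 (if V = {} then {} else range (\<lambda>k. F k V))" for V
    have "\<forall>x\<in>K. countable (c x) \<and> c x \<subseteq> K"
    proof
      fix V assume "V \<in> K"
      then show "countable (c V) \<and> c V \<subseteq> K" using F[of V] W0(1) by (auto simp: c_def)
    qed
    from S[THEN spec, THEN mp, OF this]
    obtain A where A: "A \<in> S" "countable A" "A \<subseteq> K" "A \<noteq> {}" "\<forall>x\<in>A. c x \<subseteq> A"
      by blast
    have rng: "range (from_nat_into A) = A" using A(2,4) by (rule range_from_nat_into[rotated])
    have 1: "range (from_nat_into A) \<subseteq> K" unfolding rng by (rule A(3))
    have 2: "F k V \<in> range (from_nat_into A)" if "V \<in> range (from_nat_into A)" "V \<noteq> {}" for V k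
    proof -
      have "c V \<subseteq> A" using A(5) that(1) unfolding rng by blast
      moreover have "F k V \<in> c V" using that(2) by (simp add: c_def)
      ultimately show ?thesis unfolding rng by blast
    qed
    have 3: "W0 \<in> range (from_nat_into A)" using A(4,5) unfolding rng c_def by blast
    have "\<exists>q\<in>Q. pt (A, q) \<in> M \<and> (\<forall>k. pt (A, q) \<notin> N k)"
      unfolding pt_def prod.case
      by (rule shrink_point_avoids[where F = F, OF assms(1) U0(1) K _ 1 2 3 W0(2) Q]) (fact F)
    then obtain q where "q \<in> Q" "pt (A, q) \<in> M" "\<forall>k. pt (A, q) \<notin> N k" by blast
    then show "\<exists>y\<in>Z. \<forall>n. y \<notin> N n" using A(1) unfolding Z_def by blast
  qed
  moreover have "|Z| \<le>o |S \<times> Q|"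
  proof -
    have "|Z| \<le>o |pt ` (S \<times> Q)|" unfolding Z_def by (rule card_of_mono1) auto
    with card_of_image show ?thesis using ordLeq_transitive by blast
  qed
  moreover have "Z \<subseteq> M" by (auto simp: Z_def)
  ultimately show thesis using that by blast
qed

end

section \<open>The cardinal invariants\<close>

lemma least_cardinal_card_of:
  assumes "P A0"
  obtains A where "P A" "least_cardinal (card_of ` {A. P A}) = |A|" "\<And>B. P B \<Longrightarrow> |A| \<le>o |B|"
proof -
  let ?R = "card_of ` {A. P A}"
  have "?R \<noteq> {}" "\<forall>r\<in>?R. Card_order r" using assms by (auto simp: card_of_Card_order)
  note l = least_cardinal[OF this]
  from l(1) obtain A where A: "P A" "least_cardinal ?R = |A|" by auto
  then have "|A| \<le>o |B|" if "P B" for B using l(2) that by auto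
  with A show thesis by (rule that)
qed

lemma base_of_openin: "base_of X {U. openin X U}"
  by (rule base_ofI) auto

lemma weight_attained:
  obtains \<B> where "base_of X \<B>" "weight X = |\<B>|" "\<And>\<B>'. base_of X \<B>' \<Longrightarrow> |\<B>| \<le>o |\<B>'|"
proof (rule least_cardinal_card_of[of "base_of X", OF base_of_openin])
  fix \<B> assume "base_of X \<B>" "least_cardinal (card_of ` {\<B>. base_of X \<B>}) = |\<B>|"
    "\<And>\<B>'. base_of X \<B>' \<Longrightarrow> |\<B>| \<le>o |\<B>'|"
  then show thesis by (intro that[of \<B>]) (simp_all add: weight_def)
qed

lemma local_weight_attained:
  assumes "topspace X \<noteq> {}"
  obtains U \<B> where "openin X U" "U \<noteq> {}" "base_of (subtopology X U) \<B>" "local_weight X = |\<B>|"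
    "\<And>V \<B>'. openin X V \<Longrightarrow> V \<noteq> {} \<Longrightarrow> base_of (subtopology X V) \<B>' \<Longrightarrow> |\<B>| \<le>o |\<B>'|"
proof -
  let ?R = "{weight (subtopology X U) |U. openin X U \<and> U \<noteq> {}}"
  have "\<exists>U. openin X U \<and> U \<noteq> {}" using assms by (intro exI[of _ "topspace X"]) simp
  then have ne: "?R \<noteq> {}" by simp
  have Card: "Card_order (weight Y)" for Y :: "'a topology"
  proof (rule weight_attained[of Y])
    show "Card_order (weight Y)" if "weight Y = |\<B>|" for \<B>
      by (simp only: that card_of_Card_order)
  qed
  have "\<forall>r\<in>?R. Card_order r" using Card by auto
  note l = least_cardinal[OF ne this, folded local_weight_def]
  from l(1) obtain U where U: "openin X U" "U \<noteq> {}" "local_weight X = weight (subtopology X U)" by blast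
  obtain \<B> where B: "base_of (subtopology X U) \<B>" "weight (subtopology X U) = |\<B>|"
    by (rule weight_attained[of "subtopology X U"]) (rule that)
  have le: "|\<B>| \<le>o |\<B>'|" if V: "openin X V" "V \<noteq> {}" "base_of (subtopology X V) \<B>'" for V \<B>'
  proof -
    have "weight (subtopology X V) \<in> ?R"
      by (intro CollectI exI[of _ V] conjI refl V)
    then have "local_weight X \<le>o weight (subtopology X V)" using l(2) by (rule bspec[rotated])
    then have "|\<B>| \<le>o weight (subtopology X V)" using U(3) B(2) by simp
    moreover have "weight (subtopology X V) \<le>o |\<B>'|"
    proof (rule weight_attained[of "subtopology X V"])
      show ?thesis if "weight (subtopology X V) = |\<C>|"
        "\<And>\<B>'. base_of (subtopology X V) \<B>' \<Longrightarrow> |\<C>| \<le>o |\<B>'|" for \<C>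
        using that V(3) by simp
    qed
    ultimately show ?thesis by (rule ordLeq_transitive)
  qed
  show thesis
  proof (rule that[OF U(1,2) B(1)])
    show "local_weight X = |\<B>|" by (rule trans[OF U(3) B(2)])
  qed (rule le)
qed

text \<open>Baire category; it makes \<open>non_ideal\<close> a minimum over a nonempty
  family.\<close>

lemma topspace_not_meager:
  assumes "completely_metrizable_space X" "topspace X \<noteq> {}"
  shows "topspace X \<notin> meager_sets X"
proof
  assume "topspace X \<in> meager_sets X"
  then obtain \<N> where N: "countable \<N>" "\<forall>N\<in>\<N>. nowhere_dense_in X N" "topspace X = \<Union>\<N>"
    unfolding meager_sets_def by (elim CollectE exE conjE) (rule that)
  have "X interior_of \<Union>((\<lambda>N. X closure_of N) ` \<N>) = {}"
  proof (rule Baire_category_alt)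
    show "completely_metrizable_space X \<or> locally_compact_space X \<and> regular_space X"
      using assms(1) by (rule disjI1)
    show "countable ((\<lambda>N. X closure_of N) ` \<N>)" using N(1) by (rule countable_image)
    fix T assume "T \<in> (\<lambda>N. X closure_of N) ` \<N>"
    then obtain N where "N \<in> \<N>" "T = X closure_of N" by blast
    then show "closedin X T \<and> X interior_of T = {}"
      using N(2) by (simp add: nowhere_dense_in_def)
  qed
  moreover have "topspace X \<subseteq> \<Union>((\<lambda>N. X closure_of N) ` \<N>)"
  proof -
    have "N \<subseteq> X closure_of N" if "N \<in> \<N>" for N
      using N(2) that by (intro closure_of_subset) (simp add: nowhere_dense_in_def)
    then have "\<Union>\<N> \<subseteq> \<Union>((\<lambda>N. X closure_of N) ` \<N>)" by blast
    then show ?thesis by (simp only: N(3))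
  qed
  ultimately have "X interior_of (topspace X) = {}"
    using interior_of_mono by (metis subset_empty)
  then show False using assms(2) by simp
qed

lemma non_ideal_meager_attained:
  assumes "completely_metrizable_space X" "topspace X \<noteq> {}"
  obtains Y where "Y \<subseteq> topspace X" "Y \<notin> meager_sets X" "non_ideal (topspace X) (meager_sets X) = |Y|"
    "\<And>Z. Z \<subseteq> topspace X \<Longrightarrow> Z \<notin> meager_sets X \<Longrightarrow> |Y| \<le>o |Z|"
proof (rule least_cardinal_card_of[of "\<lambda>Y. Y \<subseteq> topspace X \<and> Y \<notin> meager_sets X" "topspace X"])
  fix Y assume Y: "Y \<subseteq> topspace X \<and> Y \<notin> meager_sets X"
    "least_cardinal (card_of ` {Y. Y \<subseteq> topspace X \<and> Y \<notin> meager_sets X}) = |Y|"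
    "\<And>Z. Z \<subseteq> topspace X \<and> Z \<notin> meager_sets X \<Longrightarrow> |Y| \<le>o |Z|"
  show thesis by (rule that[of Y]) (use Y in \<open>auto simp: non_ideal_def\<close>)
qed (use topspace_not_meager[OF assms] in simp)

lemma cf_ctbl_attained:
  obtains \<F> where "cofinal_family \<kappa> \<F>" "cf_ctbl \<kappa> = |\<F>|" "\<And>\<G>. cofinal_family \<kappa> \<G> \<Longrightarrow> |\<F>| \<le>o |\<G>|"
proof (rule least_cardinal_card_of[of "cofinal_family \<kappa>" "ctbl_inf_subsets \<kappa>"])
  show "cofinal_family \<kappa> (ctbl_inf_subsets \<kappa>)" by (auto simp: cofinal_family_def)
  fix \<F> assume F: "cofinal_family \<kappa> \<F>" "least_cardinal (card_of ` {\<F>. cofinal_family \<kappa> \<F>}) = |\<F>|"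
    "\<And>\<G>. cofinal_family \<kappa> \<G> \<Longrightarrow> |\<F>| \<le>o |\<G>|"
  show thesis by (rule that[of \<F>]) (use F in \<open>auto simp: cf_ctbl_def\<close>)
qed

text \<open>A minimal nonempty member of a finite base would contain two disjoint nonempty open
  sets, hence a smaller nonempty member.\<close>

lemma infinite_base:
  assumes X: "metrizable_space X" "\<forall>x\<in>topspace X. \<not> openin X {x}"
    and U: "openin X U" "U \<noteq> {}" and K: "base_of (subtopology X U) K"
  shows "infinite K"
proof
  assume "finite K"
  obtain M d where "Metric_space M d" and Xd: "X = Metric_space.mtopology M d"
    using X(1) unfolding metrizable_space_def by blast
  interpret Metric_space M d by fact
  have split: "labelled_split X (UNIV :: bool set)"
    using labelled_split_bool X(2) unfolding Xd by simp
  have sub: "openin (subtopology X U) V \<longleftrightarrow> openin X V \<and> V \<subseteq> U" for V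
    using U(1) by (rule openin_open_subtopology)
  obtain u where u: "u \<in> U" using U(2) by blast
  have "openin (subtopology X U) U" using sub U(1) by simp
  then obtain B0 where "B0 \<in> K" "u \<in> B0" by (rule base_ofD[OF K _ u]) (rule that)
  then have ne: "{B \<in> K. B \<noteq> {}} \<noteq> {}" by blast
  have fin: "finite {B \<in> K. B \<noteq> {}}" using \<open>finite K\<close> by simp
  obtain B where B: "B \<in> K" "B \<noteq> {}" and B_min: "\<not> (\<exists>B'\<in>{B \<in> K. B \<noteq> {}}. B' < B)"
    using ex_min_if_finite[OF fin ne] by (elim bexE CollectE conjE) (rule that)
  have "openin (subtopology X U) B" using K B(1) by (rule base_of_open)
  then have Bo: "openin X B" "B \<subseteq> U" using sub by auto
  have "\<exists>f. (\<forall>l\<in>(UNIV :: bool set). openin X (f l) \<and> f l \<noteq> {} \<and> f l \<subseteq> B) \<and> disjoint_family_on f UNIV"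
    using split Bo(1) B(2) unfolding labelled_split_def by simp
  then obtain f :: "bool \<Rightarrow> 'a set" where ff: "\<forall>l\<in>UNIV. openin X (f l) \<and> f l \<noteq> {} \<and> f l \<subseteq> B"
    "disjoint_family_on f UNIV" by (elim exE conjE) (rule that)
  then have f: "openin X (f l)" "f l \<noteq> {}" "f l \<subseteq> B" for l by simp_all
  have disj: "f True \<inter> f False = {}" using ff(2) unfolding disjoint_family_on_def by blast
  obtain x where x: "x \<in> f True" using f(2) by fast
  obtain y where y: "y \<in> f False" using f(2) by fast
  have "openin (subtopology X U) (f True)" using sub f(1,3) Bo(2) by (metis order_trans)
  then obtain B' where B': "B' \<in> K" "x \<in> B'" "B' \<subseteq> f True" by (rule base_ofD[OF K _ x])
  have "y \<in> B" "y \<notin> B'" using y f(3) B'(3) disj by blast+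
  moreover have "B' \<subseteq> B" using B'(3) f(3) by (rule order_trans)
  ultimately have "B' < B" by blast
  then show False using B_min B'(1,2) by blast
qed

lemma not_meager_infinite:
  assumes X: "Hausdorff_space X" "\<forall>x\<in>topspace X. \<not> openin X {x}"
    and Y: "Y \<subseteq> topspace X" "Y \<notin> meager_sets X"
  shows "infinite Y"
proof
  assume "finite Y"
  have "nowhere_dense_in X {y}" if "y \<in> Y" for y
  proof (rule nowhere_dense_inI)
    show "{y} \<subseteq> topspace X" using that Y(1) by blast
    fix U assume U: "openin X U" "U \<noteq> {}"
    have "closedin X {y}" using closedin_Hausdorff_sing_eq[OF X(1), of y] that Y(1) by auto
    with U(1) have "openin X (U - {y})" by (rule openin_diff)
    moreover have "U \<noteq> {y}" using X(2) U(1) that Y(1) by auto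
    ultimately show "\<exists>V. openin X V \<and> V \<noteq> {} \<and> V \<subseteq> U \<and> V \<inter> {y} = {}"
      using U(2) by (intro exI[of _ "U - {y}"]) auto
  qed
  then have "\<forall>N\<in>(\<lambda>y. {y}) ` Y. nowhere_dense_in X N" by blast
  moreover have "countable ((\<lambda>y. {y}) ` Y)" using \<open>finite Y\<close> by (simp add: countable_finite)
  moreover have "Y = \<Union>((\<lambda>y. {y}) ` Y)" by blast
  ultimately have "Y \<in> meager_sets X"
    unfolding meager_sets_def by (intro CollectI exI[of _ "(\<lambda>y. {y}) ` Y"] conjI)
  with Y(2) show False by blast
qed

lemma seq_nonmeager_of_nonmeager:
  assumes X: "completely_metrizable_space X" "\<forall>x\<in>topspace X. \<not> openin X {x}"
    and Y: "Y \<subseteq> topspace X" "Y \<notin> meager_sets X"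
  obtains Q where "seq_nonmeager Q" "|Q| \<le>o |Y|"
proof -
  obtain M d where "Metric_space M d" and Xd: "X = Metric_space.mtopology M d"
    using X(1) unfolding completely_metrizable_space_def by blast
  interpret Metric_space M d by fact
  show thesis
  proof (rule seq_nonmeager_exists)
    show "\<forall>x\<in>M. \<not> openin mtopology {x}" "Y \<subseteq> M" "Y \<notin> meager_sets mtopology"
      using X(2) Y by (simp_all add: Xd)
  qed (rule that)
qed

lemma nonmeager_of_seq_nonmeager:
  assumes X: "completely_metrizable_space X" and U: "openin X U" "U \<noteq> {}" and K: "base_of (subtopology X U) K"
    and S: "\<forall>c. (\<forall>x\<in>K. countable (c x) \<and> c x \<subseteq> K) \<longrightarrow>
      (\<exists>A\<in>S. countable A \<and> A \<subseteq> K \<and> A \<noteq> {} \<and> (\<forall>x\<in>A. c x \<subseteq> A))"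
    and Q: "seq_nonmeager Q"
  obtains Z where "Z \<subseteq> topspace X" "Z \<notin> meager_sets X" "|Z| \<le>o |S \<times> Q|"
proof -
  obtain M d where "Metric_space M d" "Metric_space.mcomplete M d" and Xd: "X = Metric_space.mtopology M d"
    using X unfolding completely_metrizable_space_def by blast
  interpret Metric_space M d by fact
  obtain Z where "Z \<subseteq> M" "Z \<notin> meager_sets mtopology" "|Z| \<le>o |S \<times> Q|"
    by (rule nonmeager_from_stationary[OF \<open>mcomplete\<close> U[unfolded Xd] K[unfolded Xd] S Q]) (rule that)
  then show thesis by (intro that[of Z]) (simp_all add: Xd)
qed

lemma cofinal_family_le_nonmeager:
  assumes X: "completely_metrizable_space X"
    and K: "uncountable K" "\<And>V \<B>. openin X V \<Longrightarrow> V \<noteq> {} \<Longrightarrow> base_of (subtopology X V) \<B> \<Longrightarrow> |K| \<le>o |\<B>|"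
    and Y: "Y \<subseteq> topspace X" "Y \<notin> meager_sets X"
  shows "\<exists>\<F>. cofinal_family |K| \<F> \<and> |\<F>| \<le>o |Y|"
proof -
  obtain M d where "Metric_space M d" and Xd: "X = Metric_space.mtopology M d"
    using X(1) unfolding completely_metrizable_space_def by blast
  interpret Metric_space M d by fact
  have YM: "Y \<subseteq> M" using Y(1) Xd by simp
  have "M \<noteq> {}"
  proof
    assume "M = {}"
    then have "Y = \<Union>{}" using YM by simp
    then have "Y \<in> meager_sets X" unfolding meager_sets_def by blast
    with Y(2) show False by blast
  qed
  \<comment> \<open>Balls of radius \<open>1 / (n + 1)\<close> around a dense set \<open>D\<close>
    form a base of \<open>W\<close>, so the uncountable bound on weights is also a bound on
    densities.\<close>
  have K_le: "|K| \<le>o |D|" if W: "openin mtopology W" "W \<noteq> {}" "D \<subseteq> W"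
    and D: "\<And>V. openin mtopology V \<Longrightarrow> V \<noteq> {} \<Longrightarrow> V \<subseteq> W \<Longrightarrow> V \<inter> D \<noteq> {}" for W D
  proof -
    define \<B> where "\<B> = {B \<in> (\<lambda>(s, n). mball s (1 / real (Suc n))) ` (D \<times> UNIV). B \<subseteq> W}"
    have WM: "W \<subseteq> M" using W(1) openin_subset by fastforce
    have "base_of (subtopology mtopology W) \<B>"
    proof (rule base_ofI)
      show "openin (subtopology mtopology W) B" if "B \<in> \<B>" for B
        using that W(1) by (auto simp: openin_open_subtopology \<B>_def)
      fix V x assume "openin (subtopology mtopology W) V" and x: "x \<in> V"
      then have V: "openin mtopology V" "V \<subseteq> W" using W(1) openin_open_subtopology by blast+
      then obtain r where r: "r > 0" "mball x r \<subseteq> V" using x unfolding openin_mtopology by blast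
      have xM: "x \<in> M" using x V(2) WM by blast
      obtain n where n: "1 / real (Suc n) < r / 2"
        using r(1) by (metis reals_Archimedean inverse_eq_divide half_gt_zero)
      have "mball x (1 / real (Suc n)) \<subseteq> mball x r" using n r(1) by (intro mball_subset_concentric) simp
      moreover have "x \<in> mball x (1 / real (Suc n))" using xM by simp
      then have "mball x (1 / real (Suc n)) \<noteq> {}" by blast
      ultimately have "mball x (1 / real (Suc n)) \<inter> D \<noteq> {}"
        using r(2) V(2) by (intro D openin_mball) auto
      then obtain s where s: "s \<in> D" "s \<in> M" "d x s < 1 / real (Suc n)" by auto
      have "mball s (1 / real (Suc n)) \<subseteq> mball x r"
      proof
        fix z assume "z \<in> mball s (1 / real (Suc n))"
        then have z: "z \<in> M" "d s z < 1 / real (Suc n)" by auto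
        have "d x z \<le> d x s + d s z" using triangle xM s(2) z(1) by blast
        also have "\<dots> < r" using s(3) z(2) n by simp
        finally show "z \<in> mball x r" using xM z(1) by simp
      qed
      then have "mball s (1 / real (Suc n)) \<in> \<B>" "mball s (1 / real (Suc n)) \<subseteq> V"
        unfolding \<B>_def using s(1) r(2) V(2) by auto
      moreover have "x \<in> mball s (1 / real (Suc n))" using s xM commute[of x s] by simp
      ultimately show "\<exists>B\<in>\<B>. x \<in> B \<and> B \<subseteq> V" by blast
    qed
    then have "|K| \<le>o |\<B>|" using K(2) W(1,2) unfolding Xd by blast
    also have "|\<B>| \<le>o |(\<lambda>(s, n). mball s (1 / real (Suc n))) ` (D \<times> UNIV)|"
      unfolding \<B>_def by (rule card_of_mono1) blast
    also have "|(\<lambda>(s, n). mball s (1 / real (Suc n))) ` (D \<times> UNIV)| \<le>o |D \<times> (UNIV :: nat set)|"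
      by (rule card_of_image)
    finally have le: "|K| \<le>o |D \<times> (UNIV :: nat set)|" .
    have "uncountable D"
    proof
      assume "countable D"
      then have "countable (D \<times> (UNIV :: nat set))" by simp
      then show False using countable_ordLeq[OF le] K(1) by blast
    qed
    then have "infinite D" using countable_finite by blast
    then have "|D \<times> (UNIV :: nat set)| \<le>o |D|"
      using infinite_iff_card_of_nat by (intro card_of_Times_le) (auto intro: card_of_mono1)
    with le show ?thesis by (rule ordLeq_transitive)
  qed
  obtain Km :: "nat \<Rightarrow> 'b set" where Km: "K = (\<Union>m. Km m)" "\<And>m. labelled_split mtopology (Km m)"
  proof (rule labelled_split_cover[OF K(1)])
    fix W D assume "openin mtopology W" "W \<noteq> {}" "D \<subseteq> W"
      "\<And>V. openin mtopology V \<Longrightarrow> V \<noteq> {} \<Longrightarrow> V \<subseteq> W \<Longrightarrow> V \<inter> D \<noteq> {}"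
    then show "|K| \<le>o |D|" by (rule K_le)
  qed (rule that)
  \<comment> \<open>Pairing repeats each \<open>Km m\<close> at infinitely many levels, as
    \<open>exists_label\<close> demands.\<close>
  define L where "L n = Km (fst (prod_decode n))" for n
  obtain \<W> where "branching M d L \<W>"
    using branching_exists[of L] Km(2) \<open>M \<noteq> {}\<close> unfolding L_def by blast
  then interpret branching M d L \<W> .
  have freq: "\<exists>n\<ge>k. a \<in> L n" if aK: "a \<in> K" for a k
  proof -
    obtain m where "a \<in> Km m" using aK Km(1) by blast
    then show ?thesis
      by (intro exI[of _ "prod_encode (m, k)"]) (simp add: L_def le_prod_encode_2)
  qed
  have "infinite K" using K(1) countable_finite by blast
  then obtain C where C: "C \<subseteq> K" "countable C" "infinite C" using infinite_countable_subset' by blast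
  \<comment> \<open>Intersecting with \<open>K\<close> removes filler and junk labels, and
    \<open>C\<close> keeps the set infinite.\<close>
  define B where "B y = (range (\<lambda>n. snd (node y n)) \<inter> K) \<union> C" for y
  have "cofinal_family |K| (B ` Y)" unfolding cofinal_family_def
  proof (intro conjI ballI)
    show "B ` Y \<subseteq> ctbl_inf_subsets |K|"
      using C by (auto simp: ctbl_inf_subsets_def B_def Field_card_of)
    fix A assume "A \<in> ctbl_inf_subsets |K|"
    then have A: "A \<subseteq> K" "countable A" by (auto simp: ctbl_inf_subsets_def Field_card_of)
    obtain y where "y \<in> Y" "\<forall>a\<in>A. \<exists>n. snd (node y n) = a"
      using exists_label[OF YM Y(2)[unfolded Xd] A(2)] freq A(1) by blast
    then have "A \<subseteq> B y" using A(1) unfolding B_def by fastforce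
    then show "\<exists>B\<in>B ` Y. A \<subseteq> B" using \<open>y \<in> Y\<close> by blast
  qed
  moreover have "|B ` Y| \<le>o |Y|" by (rule card_of_image)
  ultimately show ?thesis by blast
qed

theorem theorem3p4:
  fixes X :: "'a topology" and \<kappa> :: "'a set rel"
  assumes "topspace X \<noteq> {}"
    and "completely_metrizable_space X"
    and "\<forall>x\<in>topspace X. \<not> openin X {x}"
    and "\<kappa> = local_weight X"
  shows "non_ideal (topspace X) (meager_sets X)
    =o non_ideal (UNIV :: real set) (meager_sets (euclidean :: real topology)) *c cf_ctbl \<kappa>"
proof -
  note X = assms(2,3)
  obtain Y where Y: "Y \<subseteq> topspace X" "Y \<notin> meager_sets X" "non_ideal (topspace X) (meager_sets X) = |Y|"
    "\<And>Z. Z \<subseteq> topspace X \<Longrightarrow> Z \<notin> meager_sets X \<Longrightarrow> |Y| \<le>o |Z|"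
    by (rule non_ideal_meager_attained[OF assms(2,1)]) (rule that)
  have R: "completely_metrizable_space (euclidean :: real topology)"
    "\<forall>x\<in>topspace (euclidean :: real topology). \<not> openin euclidean {x}"
    by (auto simp: completely_metrizable_space_euclidean not_open_singleton)
  obtain R :: "real set" where Rm: "R \<notin> meager_sets euclidean" and Rn: "non_ideal (UNIV :: real set) (meager_sets euclidean) = |R|"
    and R_min: "\<And>Z :: real set. Z \<notin> meager_sets euclidean \<Longrightarrow> |R| \<le>o |Z|"
    using non_ideal_meager_attained[OF R(1)] by auto
  obtain U K where U: "openin X U" "U \<noteq> {}" and K: "base_of (subtopology X U) K" "local_weight X = |K|"
    and K_min: "\<And>V \<B>. openin X V \<Longrightarrow> V \<noteq> {} \<Longrightarrow> base_of (subtopology X V) \<B> \<Longrightarrow> |K| \<le>o |\<B>|"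
    by (rule local_weight_attained[OF assms(1)]) (rule that)
  have \<kappa>: "\<kappa> = |K|" using assms(4) K(2) by simp
  obtain F where F: "cofinal_family |K| F" "cf_ctbl |K| = |F|" "\<And>\<G>. cofinal_family |K| \<G> \<Longrightarrow> |F| \<le>o |\<G>|"
    by (rule cf_ctbl_attained) (rule that)
  have met: "metrizable_space X" using X(1) by (rule completely_metrizable_imp_metrizable_space)
  have infK: "infinite K" using infinite_base[OF met X(2) U K(1)] .
  then obtain C where C: "C \<subseteq> K" "countable C" "infinite C" using infinite_countable_subset' by blast
  have infY: "infinite Y"
    using not_meager_infinite[OF metrizable_imp_Hausdorff_space[OF met] X(2) Y(1,2)] .
  have "|Y| \<le>o |R \<times> F|"
  proof -
    obtain Q where Q: "seq_nonmeager Q" "|Q| \<le>o |R|"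
      using seq_nonmeager_of_nonmeager[OF R _ Rm] by auto
    have 1: "countable p" "p \<subseteq> K" if "p \<in> F" for p
      using F(1) that by (auto simp: cofinal_family_def ctbl_inf_subsets_def Field_card_of)
    have 2: "\<exists>p\<in>F. A \<subseteq> p" if "countable A" "A \<subseteq> K" for A
    proof -
      \<comment> \<open>The family covers only infinite sets, so a possibly finite \<open>A\<close>
        is enlarged by \<open>C\<close>.\<close>
      have "A \<union> C \<in> ctbl_inf_subsets |K|"
        using that C by (auto simp: ctbl_inf_subsets_def Field_card_of)
      then obtain p where "p \<in> F" "A \<union> C \<subseteq> p" using F(1) unfolding cofinal_family_def by blast
      then show ?thesis by blast
    qed
    have "\<exists>S. |S| \<le>o |F| \<and> (\<forall>c. (\<forall>x\<in>K. countable (c x) \<and> c x \<subseteq> K) \<longrightarrow>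
      (\<exists>A\<in>S. countable A \<and> A \<subseteq> K \<and> A \<noteq> {} \<and> (\<forall>x\<in>A. c x \<subseteq> A)))"
      using infK 1 2 by (rule stationary_family)
    then obtain S where S: "|S| \<le>o |F|" "\<forall>c. (\<forall>x\<in>K. countable (c x) \<and> c x \<subseteq> K) \<longrightarrow>
      (\<exists>A\<in>S. countable A \<and> A \<subseteq> K \<and> A \<noteq> {} \<and> (\<forall>x\<in>A. c x \<subseteq> A))"
      by (elim exE conjE)
    obtain Z where Z: "Z \<subseteq> topspace X" "Z \<notin> meager_sets X" "|Z| \<le>o |S \<times> Q|"
      by (rule nonmeager_of_seq_nonmeager[OF X(1) U K(1) S(2) Q(1)])
    note Y(4)[OF Z(1,2)]
    also note Z(3)
    also have "|S \<times> Q| \<le>o |F \<times> Q|" using S(1) by (rule card_of_Times_mono1)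
    also have "|F \<times> Q| \<le>o |F \<times> R|" using Q(2) by (rule card_of_Times_mono2)
    also have "|F \<times> R| =o |R \<times> F|" by (rule card_of_Times_commute)
    finally show ?thesis .
  qed
  moreover have "|R \<times> F| \<le>o |Y|"
  proof (rule card_of_Times_le[OF infY])
    obtain Q where Q: "seq_nonmeager Q" "|Q| \<le>o |Y|"
      using seq_nonmeager_of_nonmeager[OF X Y(1,2)] by blast
    \<comment> \<open>A countable base is closed under every function \<open>c\<close>, so
      \<open>{\<B>}\<close> serves as its stationary family and the machine needs only
      \<open>|Q|\<close> many points.\<close>
    obtain \<B> :: "real set set" where B: "countable \<B>" "topological_basis \<B>" using ex_countable_basis by blast
    have base: "base_of (subtopology euclidean UNIV) \<B>"
    proof (rule base_ofI)
      show "openin (subtopology euclidean UNIV) b" if "b \<in> \<B>" for b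
        using B(2) that by (simp add: topological_basis_open)
      show "\<exists>b\<in>\<B>. x \<in> b \<and> b \<subseteq> V" if "openin (subtopology euclidean UNIV) V" "x \<in> V" for V x
        using topological_basisE[OF B(2), of V x] that by (metis open_openin subtopology_UNIV)
    qed
    obtain b where "b \<in> \<B>" using base_ofD[OF base, of UNIV 0] by auto
    then have "\<forall>c. (\<forall>x\<in>\<B>. countable (c x) \<and> c x \<subseteq> \<B>) \<longrightarrow>
      (\<exists>A\<in>{\<B>}. countable A \<and> A \<subseteq> \<B> \<and> A \<noteq> {} \<and> (\<forall>x\<in>A. c x \<subseteq> A))"
      using B(1) by auto
    from nonmeager_of_seq_nonmeager[OF R(1) _ _ base this Q(1)]
    obtain Z where Z: "Z \<notin> meager_sets (euclidean :: real topology)" "|Z| \<le>o |{\<B>} \<times> Q|" by auto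
    have "|{\<B>} \<times> Q| \<le>o |Q|"
      by (rule card_of_ordLeqI[of snd]) (auto simp: inj_on_def)
    with Z(2) have "|Z| \<le>o |Q|" by (rule ordLeq_transitive)
    then have "|Z| \<le>o |Y|" using Q(2) by (rule ordLeq_transitive)
    with R_min[OF Z(1)] show "|R| \<le>o |Y|" by (rule ordLeq_transitive)
    show "|F| \<le>o |Y|"
    proof (cases "countable K")
      case True
      then have "cofinal_family |K| {K}"
        using infK by (auto simp: cofinal_family_def ctbl_inf_subsets_def Field_card_of)
      then have "|F| \<le>o |{K}|" by (rule F(3))
      also have "|{K}| \<le>o |Y|" using infY by (intro card_of_singl_ordLeq) auto
      finally show ?thesis .
    next
      case False
      have "\<exists>\<G>. cofinal_family |K| \<G> \<and> |\<G>| \<le>o |Y|"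
        using X(1) False K_min Y(1,2) by (rule cofinal_family_le_nonmeager)
      then show ?thesis using F(3) ordLeq_transitive by blast
    qed
  qed
  ultimately have "|Y| =o |R \<times> F|" by (simp add: ordIso_iff_ordLeq)
  then show ?thesis unfolding Y(3) Rn \<kappa> F(2) by (simp add: cprod_def Field_card_of)
qed

end
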